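(* Let $k$ be a commutative field. All skew fields in (a)–(d) are skew field extensions of $k$ (with $k$ central), and amenability is understood over $k$. (a) If $k\subseteq D$ is a skew field that is finite dimensional over its center, then $D$ is amenable. (b) If $k\subseteq D$ is a skew field with finite Gelfand–Kirillov transcendence degree over $k$, then $D$ is amenable. (c) There exist amenable skew fields $D\supseteq k$ that are finitely generated (as skew fields over $k$) and have infinite Gelfand–Kirillov transcendence degree over $k$. (d) If $k\subseteq D\subseteq E$ are skew fields and $D$ is non-amenable, then $E$ is non-amenable as well. (e) The free field of Cohn over $\mathbb{C}$ on two generators is non-amenable (as a $\mathbb{C}$-algebra).
   Context: A skew field extension $k\subseteq D$ is a skew field (division ring) $D$ that is a unital $k$-algebra, with $k$ identified with a subfield of the center of $D$; in $k\subseteq D\subseteq E$, $D$ is a sub-skew-field and $k$-subalgebra of $E$. Amenability: a unital $k$-algebra $\mathcal{A}$ is amenable if for any finite subset $\{r_1,\dots,r_n\}\subset\mathcal{A}$ and any real $\epsilon>0$ there is a (nonzero) finite dimensional $k$-subspace $V\subset\mathcal{A}$ such that $\frac{\dim_k(\sum_{i=1}^n r_iV)}{\dim_k V}<1+\epsilon$. Non-amenable means not amenable. A skew field extension of $k$ is called amenable if it is amenable as a $k$-algebra. Gelfand–Kirillov transcendence degree: for a skew field extension $D$ of $k$, $$\text{GK-tr deg}(D)=\sup_V\ \inf_{0\neq r\in D}\ \limsup_{n\to\infty}\frac{\log\dim_k((k+Vr)^n)}{\log n},$$ where $V$ runs through all finite dimensional $k$-subspaces of $D$ containing the unit, and $(k+Vr)^n$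 is the $k$-span of all products of $n$ elements of $k+Vr$. Finitely generated: $D$ is finitely generated if there is a finite subset of $D$ such that no proper sub-skew-field of $D$ contains both $k$ and that subset. Free field of Cohn over $\mathbb{C}$ on two generators: the universal field of fractions of the free associative algebra $R=\mathbb{C}\langle x,y\rangle$, i.e. the skew field $F$ (unique up to isomorphism over $R$) containing $R$, generated by $R$ as a skew field, and such that every full square matrix over $R$ is invertible over $F$. Here an $n\times n$ matrix over $R$ is full if it is not a product of an $n\times(n-1)$ matrix and an $(n-1)\times n$ matrix over $R$ (a $1\times 1$ matrix is full iff it is nonzero). *)

theory Defs
  imports "HOL-Algebra.Algebra" "HOL-Algebra.Algebraic_Closure_Type"
    "HOL-Library.Extended_Real" "HOL-Library.Liminf_Limsup"
begin

section \<open>Skew fields and algebras over a field\<close>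

locale skew_field = ring R for R (structure) +
  assumes one_not_zero: "\<one> \<noteq> \<zero>"
    and skew_field_Units: "Units R = carrier R - {\<zero>}"

definition sub_skew_field :: "'a set \<Rightarrow> ('a, 'b) ring_scheme \<Rightarrow> bool" where
  "sub_skew_field L D \<longleftrightarrow> subring L D \<and> skew_field (D\<lparr>carrier := L\<rparr>)"

definition ring_center :: "('a, 'b) ring_scheme \<Rightarrow> 'a set" where
  "ring_center D = {z \<in> carrier D. \<forall>x \<in> carrier D. z \<otimes>\<^bsub>D\<^esub> x = x \<otimes>\<^bsub>D\<^esub> z}"

text \<open>A unital associative \<open>k\<close>-algebra is given by a ring \<open>A\<close> and a unital homomorphism \<open>\<iota>\<close>
  from \<open>k\<close> into the center of \<open>A\<close>. When \<open>A\<close> is nonzero, \<open>\<iota>\<close> is injective and \<open>k\<close> is identified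
  with the subfield \<open>\<iota> ` carrier k\<close>; all dimensions below are taken over this subfield.\<close>

locale unital_algebra = field k + A: ring A
  for k :: "('k, 'm) ring_scheme" and \<iota> :: "'k \<Rightarrow> 'a" and A :: "('a, 'n) ring_scheme" +
  assumes structure_hom: "\<iota> \<in> ring_hom k A"
    and structure_central: "\<iota> ` carrier k \<subseteq> ring_center A"

locale skew_field_extension = unital_algebra k \<iota> D + skew_field D
  for k :: "('k, 'm) ring_scheme" and \<iota> :: "'k \<Rightarrow> 'a" and D :: "('a, 'n) ring_scheme"

definition finitely_generated_skew_field ::
    "('k, 'm) ring_scheme \<Rightarrow> ('k \<Rightarrow> 'a) \<Rightarrow> ('a, 'n) ring_scheme \<Rightarrow> bool" where
  "finitely_generated_skew_field k \<iota> D \<longleftrightarrow>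
     (\<exists>S. finite S \<and> S \<subseteq> carrier D \<and>
        (\<forall>L. sub_skew_field L D \<and> \<iota> ` carrier k \<subseteq> L \<and> S \<subseteq> L \<longrightarrow> L = carrier D))"

section \<open>Amenability\<close>

text \<open>The sum of subspaces \<open>r V\<close> for \<open>r\<close> in the finite set \<open>S\<close>.\<close>

definition sum_left_translates :: "('a, 'n) ring_scheme \<Rightarrow> 'a set \<Rightarrow> 'a set \<Rightarrow> 'a set" where
  "sum_left_translates A S V = {(\<Oplus>\<^bsub>A\<^esub>r\<in>S. r \<otimes>\<^bsub>A\<^esub> v r) | v. v \<in> S \<rightarrow> V}"

text \<open>The library predicate \<open>ring.finite_dimension A K V\<close> includes that \<open>V\<close> is a \<open>K\<close>-subspace
  of \<open>A\<close>.\<close>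

definition amenable :: "('k, 'm) ring_scheme \<Rightarrow> ('k \<Rightarrow> 'a) \<Rightarrow> ('a, 'n) ring_scheme \<Rightarrow> bool" where
  "amenable k \<iota> A \<longleftrightarrow>
     (\<forall>S. \<forall>\<epsilon>::real. finite S \<and> S \<subseteq> carrier A \<and> 0 < \<epsilon> \<longrightarrow>
       (\<exists>V. ring.finite_dimension A (\<iota> ` carrier k) V \<and> V \<noteq> {\<zero>\<^bsub>A\<^esub>} \<and>
          real (ring.dim A (\<iota> ` carrier k) (sum_left_translates A S V))
            / real (ring.dim A (\<iota> ` carrier k) V) < 1 + \<epsilon>))"

section \<open>Gelfand--Kirillov transcendence degree\<close>

text \<open>The \<open>K\<close>-span of all products of \<open>n\<close> elements of \<open>U\<close>. The library predicate
  \<open>subalgebra K W A\<close> says that \<open>W\<close> is an additive subgroup closed under multiplication by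
  elements of \<open>K\<close>, i.e. a \<open>K\<close>-subspace; closure under products is not part of it.\<close>

definition span_power :: "('a, 'n) ring_scheme \<Rightarrow> 'a set \<Rightarrow> 'a set \<Rightarrow> nat \<Rightarrow> 'a set" where
  "span_power A K U n =
     (\<lambda>W. subalgebra K W A) hull
       {foldr (\<otimes>\<^bsub>A\<^esub>) xs \<one>\<^bsub>A\<^esub> | xs. length xs = n \<and> set xs \<subseteq> U}"

definition GK_tr_deg :: "('k, 'm) ring_scheme \<Rightarrow> ('k \<Rightarrow> 'a) \<Rightarrow> ('a, 'n) ring_scheme \<Rightarrow> ereal" where
  "GK_tr_deg k \<iota> D =
     (let K = \<iota> ` carrier k in
      SUP V \<in> {V. ring.finite_dimension D K V \<and> \<one>\<^bsub>D\<^esub> \<in> V}.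
      INF r \<in> carrier D - {\<zero>\<^bsub>D\<^esub>}.
        limsup (\<lambda>n. ereal
          (ln (real (ring.dim D K (span_power D K (K <+>\<^bsub>D\<^esub> (V #>\<^bsub>D\<^esub> r)) n))) / ln (real n))))"

section \<open>Free algebras and universal fields of fractions\<close>

text \<open>The free associative algebra over \<open>k\<close> on the alphabet \<open>'x\<close>: an element is the finitely
  supported family of coefficients of the words over \<open>'x\<close>.\<close>

definition free_algebra :: "('k, 'm) ring_scheme \<Rightarrow> ('x list \<Rightarrow> 'k) ring" where
  "free_algebra k =
     \<lparr>carrier = {f. range f \<subseteq> carrier k \<and> finite {w. f w \<noteq> \<zero>\<^bsub>k\<^esub>}},
      monoid.mult = (\<lambda>f g w. \<Oplus>\<^bsub>k\<^esub>i\<in>{..length w}. f (take i w) \<otimes>\<^bsub>k\<^esub> g (drop i w)),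
      one = (\<lambda>w. if w = [] then \<one>\<^bsub>k\<^esub> else \<zero>\<^bsub>k\<^esub>),
      ring.zero = (\<lambda>w. \<zero>\<^bsub>k\<^esub>),
      add = (\<lambda>f g w. f w \<oplus>\<^bsub>k\<^esub> g w)\<rparr>"

definition free_algebra_const :: "('k, 'm) ring_scheme \<Rightarrow> 'k \<Rightarrow> 'x list \<Rightarrow> 'k" where
  "free_algebra_const k c = (\<lambda>w. if w = [] then c else \<zero>\<^bsub>k\<^esub>)"

text \<open>An \<open>m \<times> n\<close> matrix is a function of two indices, of which only the values at
  \<open>i < m\<close>, \<open>j < n\<close> are relevant.\<close>

definition is_matrix ::
    "('a, 'b) ring_scheme \<Rightarrow> nat \<Rightarrow> nat \<Rightarrow> (nat \<Rightarrow> nat \<Rightarrow> 'a) \<Rightarrow> bool" where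
  "is_matrix R m n A \<longleftrightarrow> (\<forall>i<m. \<forall>j<n. A i j \<in> carrier R)"

definition matrix_mult ::
    "('a, 'b) ring_scheme \<Rightarrow> nat \<Rightarrow> (nat \<Rightarrow> nat \<Rightarrow> 'a) \<Rightarrow> (nat \<Rightarrow> nat \<Rightarrow> 'a) \<Rightarrow> nat \<Rightarrow> nat \<Rightarrow> 'a" where
  "matrix_mult R p A B = (\<lambda>i j. \<Oplus>\<^bsub>R\<^esub>l\<in>{..<p}. A i l \<otimes>\<^bsub>R\<^esub> B l j)"

text \<open>For \<open>n = 1\<close> the products of an \<open>n \<times> (n - 1)\<close> and an \<open>(n - 1) \<times> n\<close> matrix are empty sums, so
  a \<open>1 \<times> 1\<close> matrix is full iff it is nonzero.\<close>

definition full_matrix :: "('a, 'b) ring_scheme \<Rightarrow> nat \<Rightarrow> (nat \<Rightarrow> nat \<Rightarrow> 'a) \<Rightarrow> bool" where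
  "full_matrix R n A \<longleftrightarrow> is_matrix R n n A \<and>
     \<not> (\<exists>B C. is_matrix R n (n - 1) B \<and> is_matrix R (n - 1) n C \<and>
          (\<forall>i<n. \<forall>j<n. A i j = matrix_mult R (n - 1) B C i j))"

definition invertible_matrix :: "('a, 'b) ring_scheme \<Rightarrow> nat \<Rightarrow> (nat \<Rightarrow> nat \<Rightarrow> 'a) \<Rightarrow> bool" where
  "invertible_matrix R n A \<longleftrightarrow> is_matrix R n n A \<and>
     (\<exists>B. is_matrix R n n B \<and>
        (\<forall>i<n. \<forall>j<n.
           matrix_mult R n A B i j = (if i = j then \<one>\<^bsub>R\<^esub> else \<zero>\<^bsub>R\<^esub>) \<and>
           matrix_mult R n B A i j = (if i = j then \<one>\<^bsub>R\<^esub> else \<zero>\<^bsub>R\<^esub>)))"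

text \<open>\<open>F\<close> with the embedding \<open>\<phi>\<close> is the universal field of fractions of \<open>R\<close>, characterised (for
  \<open>R\<close> a free algebra, up to isomorphism over \<open>R\<close>) by the inversion of all full matrices.\<close>

locale universal_field_of_fractions = ring R + F: skew_field F
  for R :: "('r, 'm) ring_scheme" and \<phi> :: "'r \<Rightarrow> 'f" and F :: "('f, 'n) ring_scheme" +
  assumes embedding_hom: "\<phi> \<in> ring_hom R F"
    and embedding_inj: "inj_on \<phi> (carrier R)"
    and generated: "\<And>L. sub_skew_field L F \<Longrightarrow> \<phi> ` carrier R \<subseteq> L \<Longrightarrow> L = carrier F"
    and inverts_full:
      "\<And>n A. 1 \<le> n \<Longrightarrow> full_matrix R n A \<Longrightarrow> invertible_matrix F n (\<lambda>i j. \<phi> (A i j))"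

definition complex_field :: "complex ring" where
  "complex_field = ring_of_type_algebra"

text \<open>\<open>F\<close> is a free field of Cohn over \<open>k\<close> with one generator for each letter in \<open>'x\<close>; the
  free field on two generators is the case \<open>'x = bool\<close>. The algebra structure of \<open>F\<close> over \<open>k\<close> is
  \<open>\<phi> \<circ> free_algebra_const k\<close>.\<close>

definition cohn_free_field ::
    "('k, 'm) ring_scheme \<Rightarrow> (('x list \<Rightarrow> 'k) \<Rightarrow> 'f) \<Rightarrow> ('f, 'n) ring_scheme \<Rightarrow> bool" where
  "cohn_free_field k \<phi> F \<longleftrightarrow> universal_field_of_fractions (free_algebra k) \<phi> F"

end

theory Submission
  imports Defs "HOL-Library.Countable"
begin

text \<open>
  (a), (b): if nonzero spaces \<open>V\<^sub>n\<close> have polynomially bounded dimension and \<open>S V\<^sub>n\<close> lies in a space of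
  dimension \<open>dim V\<^sub>n\<^sub>+\<^sub>1\<close>, then \<open>dim (S V\<^sub>n) < (1 + \<epsilon>) dim V\<^sub>n\<close> for some \<open>n\<close>. For (a), \<open>V\<^sub>n\<close> is spanned by the
  products of a finite basis over the center with the monomials of exponents at most \<open>n\<close> in the central
  coefficients of \<open>S\<close>; for (b), \<open>V\<^sub>n = r (k + V r)\<^sup>n\<close>.

  (d): a finite dimensional \<open>V \<subseteq> E\<close> lies in a finite sum of left lines \<open>D v\<^sub>i\<close>. Filtering \<open>V\<close> and \<open>S V\<close> by the
  coordinates, rank-nullity and a mediant argument show that the coefficients in one of the lines form
  a subspace \<open>U \<subseteq> D\<close> for which \<open>dim (S U) / dim U\<close> is at most \<open>dim (S V) / dim V\<close>.

  (c): let \<open>G\<close> be the group of maps \<open>x \<mapsto> 2\<^sup>n x + q\<close> of the rational line. Folner sets make \<open>k[G]\<close> amenable,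
  hence an Ore domain with amenable skew field of fractions, and (d) applies to the sub-skew-field
  generated by the translation \<open>x\<close> and the scaling \<open>t\<close>. As \<open>G\<close> is ordered, leading exponents extend to a
  valuation of the fractions. For every \<open>r \<noteq> 0\<close>, either the pair \<open>r, x r\<close> or the pair \<open>t r, x t r\<close> has
  \<open>2\<^sup>n\<close> products of length \<open>n\<close> with different valuations, so \<open>dim (k + V r)\<^sup>n\<close> is at least \<open>2\<^sup>n\<close>.

  (e): one shows \<open>dim (V + x V + y V) > 2 dim V\<close> for \<open>V \<noteq> 0\<close>. Otherwise a matrix with entries of degree at
  most \<open>1\<close> over the free algebra, with linearly independent rows and at least as many rows as columns,
  kills a vector over \<open>F\<close> with linearly independent entries. A square part of it is singular over \<open>F\<close>,
  hence not full. By the weak algorithm its factorisation can be reduced so that degrees add up, and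
  this produces a smaller matrix and vector with the same properties.
\<close>

text \<open>Left translates \<open>r V\<close> decide on which side everything happens. Fractions
  are \<open>a b^-1\<close>: a denominator \<open>b\<close> common to \<open>S\<close> is absorbed
  by taking \<open>V\<close> inside \<open>b k[G]\<close>. In (b) the leading \<open>r\<close> turns
  \<open>s (r p)\<close> into \<open>(s r) p\<close>, one more factor from \<open>k + V r\<close>.
  The obstacle in (c) is that the infimum picks \<open>r\<close> after \<open>V\<close> is fixed.
  Words in \<open>r\<close> and \<open>x r\<close> are separated when the valuation of
  \<open>r\<close> has nonzero scaling exponent; otherwise that of \<open>t r\<close> has exponent
  one. The example must exist over every field, on lists over that field; hence a countable group
  and a coding of fractions by lists. In (e), three translates of a basis of \<open>V\<close> inside
  dimension at most \<open>2 dim V\<close> leave at least \<open>dim V\<close> independent scalar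
  relations, so rows are at least as many as columns. This survives a factorisation whose inner
  dimension is one smaller: its middle index set contains constant rows, which become the new
  columns, and rows of positive degree, each of which costs at most one row of the system.\<close>

section \<open>Linear algebra over a central subfield\<close>

text \<open>A bare ring rather than a skew field: the same linear algebra serves the group algebra,
  before its fractions exist.\<close>

locale central_algebra = ring R for R (structure) +
  fixes K
  assumes subfield_K: "subfield K R"
    and central_K: "\<And>c x. c \<in> K \<Longrightarrow> x \<in> carrier R \<Longrightarrow> c \<otimes> x = x \<otimes> c"
begin

declare Span.simps [simp del]

lemma Span_Nil [simp]: "Span K [] = {\<zero>}"
  and Span_Cons: "Span K (u # Us) = line_extension K u (Span K Us)"
  by (auto simp: Span.simps)

lemma K_subset: "K \<subseteq> carrier R"
  using subfield_K by (simp add: subfieldE(3))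

lemma subring_K: "subring K R"
  using subfield_K by (simp add: subfieldE(1))

lemma K_zero [simp]: "\<zero> \<in> K" and K_one [simp]: "\<one> \<in> K"
  using subring_K by (auto simp: subringE)

lemma subalgebraI':
  assumes "V \<subseteq> carrier R" "\<zero> \<in> V" "\<And>a b. a \<in> V \<Longrightarrow> b \<in> V \<Longrightarrow> a \<oplus> b \<in> V"
    "\<And>c a. c \<in> K \<Longrightarrow> a \<in> V \<Longrightarrow> c \<otimes> a \<in> V"
  shows "subalgebra K V R"
proof -
  have "\<ominus> a \<in> V" if "a \<in> V" for a
  proof -
    have "(\<ominus> \<one>) \<otimes> a \<in> V" using assms(4) that subringE(5)[OF subring_K] by simp
    then show ?thesis using that assms(1) l_minus by auto
  qed
  then have "subgroup V (add_monoid R)"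
    using assms by (intro add.subgroupI) (auto simp: a_inv_def)
  then show ?thesis
    using assms(4) by (auto simp: subalgebra_def subalgebra_axioms_def)
qed

lemma subalgebraD:
  assumes "subalgebra K V R"
  shows "V \<subseteq> carrier R" "\<zero> \<in> V" "\<And>a b. a \<in> V \<Longrightarrow> b \<in> V \<Longrightarrow> a \<oplus> b \<in> V"
    "\<And>c a. c \<in> K \<Longrightarrow> a \<in> V \<Longrightarrow> c \<otimes> a \<in> V" "\<And>a. a \<in> V \<Longrightarrow> \<ominus> a \<in> V"
proof -
  interpret subalgebra K V R by fact
  show "V \<subseteq> carrier R" "\<zero> \<in> V" "\<And>a b. a \<in> V \<Longrightarrow> b \<in> V \<Longrightarrow> a \<oplus> b \<in> V"
    using subset one_closed m_closed by auto
  show "\<And>c a. c \<in> K \<Longrightarrow> a \<in> V \<Longrightarrow> c \<otimes> a \<in> V" by (rule smult_closed)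
  show "\<And>a. a \<in> V \<Longrightarrow> \<ominus> a \<in> V" using m_inv_closed by (simp add: a_inv_def)
qed

lemma finite_dimension_base:
  assumes "finite_dimension K V"
  obtains Vs where "independent K Vs" "set Vs \<subseteq> carrier R" "length Vs = dim K V" "Span K Vs = V"
  using exists_base[OF subfield_K finite_dimensionE[OF subfield_K assms]]
  by (auto simp: over_def)

lemma dimI': "dimension n K V \<Longrightarrow> dim K V = n"
  using dimI[OF subfield_K] by (simp add: over_def)

lemma dim_Span_indep:
  assumes "independent K Us"
  shows "finite_dimension K (Span K Us)" "dim K (Span K Us) = length Us"
  using dimension_independent[OF assms] dimI' finite_dimensionI by auto

text \<open>Discarding every vector that lies in the span of the later ones leaves a basis of the
  same span, no longer than the list.\<close>

lemma dim_Span_le: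
  assumes "set Us \<subseteq> carrier R"
  shows "finite_dimension K (Span K Us)" "dim K (Span K Us) \<le> length Us"
proof -
  have "\<exists>Vs. independent K Vs \<and> length Vs \<le> length Us \<and> Span K Vs = Span K Us"
    using assms
  proof (induction Us)
    case Nil
    then show ?case by (auto intro: li_Nil)
  next
    case (Cons u Us)
    then obtain Vs where Vs: "independent K Vs" "length Vs \<le> length Us" "Span K Vs = Span K Us" by auto
    show ?case
    proof (cases "u \<in> Span K Us")
      case True
      then have "set (u # Us) \<subseteq> Span K Us" using Span_base_incl[OF subfield_K] Cons.prems by auto
      then have "Span K (u # Us) = Span K Us"
        using mono_Span_subset[OF subfield_K, of "u # Us" Us] mono_Span[OF subfield_K, of Us u] Cons.prems by auto
      then show ?thesis using Vs by (metis le_SucI length_Cons)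
    next
      case False
      then have "independent K (u # Vs)" using Vs Cons.prems by (auto intro: li_Cons)
      then show ?thesis using Vs by (intro exI[of _ "u # Vs"]) (auto simp: Span_Cons)
    qed
  qed
  then show "finite_dimension K (Span K Us)" "dim K (Span K Us) \<le> length Us"
    using dim_Span_indep by metis+
qed

lemma independent_le_dim:
  assumes "finite_dimension K V" "independent K Us" "set Us \<subseteq> V"
  shows "length Us \<le> dim K V"
  using independent_length_le_dimension[OF subfield_K finite_dimensionE[OF subfield_K assms(1)]] assms
  by (simp add: over_def)

lemma dim_mono:
  assumes "subalgebra K V R" "finite_dimension K W" "V \<subseteq> W"
  shows "finite_dimension K V" "dim K V \<le> dim K W"
proof -
  show V: "finite_dimension K V" using subalbegra_incl_imp_finite_dimension[OF subfield_K assms(2,1,3)] .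
  obtain Vs where "independent K Vs" "length Vs = dim K V" "Span K Vs = V" "set Vs \<subseteq> carrier R"
    by (rule finite_dimension_base[OF V])
  then show "dim K V \<le> dim K W" 
    using independent_le_dim[OF assms(2), of Vs] Span_base_incl[OF subfield_K, of Vs] assms(3) by auto
qed

lemma finite_dimension_subalgebra: "finite_dimension K V \<Longrightarrow> subalgebra K V R"
  by (rule finite_dimension_imp_subalgebra[OF subfield_K])

lemma dim_pos:
  assumes "finite_dimension K V" "V \<noteq> {\<zero>}"
  shows "0 < dim K V"
proof (rule ccontr)
  assume "\<not> 0 < dim K V"
  then have "dimension 0 K V" using finite_dimensionE[OF subfield_K assms(1)] by (simp add: over_def)
  then show False using dimension_zero[OF subfield_K] assms(2) by auto
qed

text \<open>Linearity is demanded on \<open>V\<close> only: the coordinate maps met later are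
  obtained by choice and controlled only on one sum of left lines.\<close>

definition linear_on :: "'a set \<Rightarrow> ('a \<Rightarrow> 'a) \<Rightarrow> bool" where
  "linear_on V f \<longleftrightarrow> (\<forall>a\<in>V. f a \<in> carrier R) \<and> (\<forall>a\<in>V. \<forall>b\<in>V. f (a \<oplus> b) = f a \<oplus> f b) \<and>
     (\<forall>c\<in>K. \<forall>a\<in>V. f (c \<otimes> a) = c \<otimes> f a)"

lemma linear_on_subset: "linear_on V f \<Longrightarrow> W \<subseteq> V \<Longrightarrow> linear_on W f"
  unfolding linear_on_def by blast

lemma linear_on_zero:
  assumes "subalgebra K V R" "linear_on V f"
  shows "f \<zero> = \<zero>"
proof -
  have "\<zero> \<in> V" "f \<zero> \<in> carrier R" using subalgebraD[OF assms(1)] assms(2) by (auto simp: linear_on_def)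
  then have "f (\<zero> \<otimes> \<zero>) = \<zero> \<otimes> f \<zero>" using assms(2) K_zero unfolding linear_on_def by blast
  then show ?thesis using \<open>f \<zero> \<in> carrier R\<close> by simp
qed

lemma linear_on_minus:
  assumes "subalgebra K V R" "linear_on V f" "a \<in> V" "b \<in> V"
  shows "f (a \<ominus> b) = f a \<ominus> f b"
proof -
  have ab: "a \<in> carrier R" "b \<in> carrier R" "f a \<in> carrier R" "f b \<in> carrier R"
    using subalgebraD[OF assms(1)] assms by (auto simp: linear_on_def)
  have "\<ominus> \<one> \<in> K" using subringE(5)[OF subring_K] by simp
  then have "f ((\<ominus> \<one>) \<otimes> b) = (\<ominus> \<one>) \<otimes> f b" "(\<ominus> \<one>) \<otimes> b \<in> V"
    using assms subalgebraD(4)[OF assms(1)] by (auto simp: linear_on_def)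
  moreover from this have "f (a \<oplus> (\<ominus> \<one>) \<otimes> b) = f a \<oplus> f ((\<ominus> \<one>) \<otimes> b)"
    using assms by (auto simp: linear_on_def)
  ultimately show ?thesis using ab by (simp add: a_minus_def l_minus)
qed

lemma linear_image_Span:
  assumes "set Us \<subseteq> carrier R" "linear_on (Span K Us) f"
  shows "f ` Span K Us = Span K (map f Us)"
  using assms
proof (induction Us)
  case Nil
  have "subalgebra K {\<zero>} R" using Span_is_subalgebra[OF subfield_K, of "[]"] by simp
  then show ?case using linear_on_zero Nil by simp
next
  case (Cons u Us)
  have sub: "Span K Us \<subseteq> Span K (u # Us)" using mono_Span[OF subfield_K] Cons.prems by simp
  have u: "u \<in> Span K (u # Us)" using Span_base_incl[OF subfield_K, of "u # Us"] Cons.prems by auto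
  have smult: "c \<otimes> u \<in> Span K (u # Us)" if "c \<in> K" for c
    using Span_smult_closed[OF subfield_K Cons.prems(1)] u that by blast
  have IH: "f ` Span K Us = Span K (map f Us)"
    using Cons linear_on_subset[OF _ sub] by auto
  have lin: "f (c \<otimes> u \<oplus> v) = c \<otimes> f u \<oplus> f v" if "c \<in> K" "v \<in> Span K Us" for c v
  proof -
    have "f (c \<otimes> u \<oplus> v) = f (c \<otimes> u) \<oplus> f v" "f (c \<otimes> u) = c \<otimes> f u"
      using Cons.prems(2) smult[OF that(1)] u that sub unfolding linear_on_def by blast+
    then show ?thesis by simp
  qed
  have "f ` Span K (u # Us) = (\<lambda>(c, v). f (c \<otimes> u \<oplus> v)) ` (K \<times> Span K Us)"
    by (force simp: Span_Cons line_extension_mem_iff)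
  also have "\<dots> = (\<lambda>(c, v). c \<otimes> f u \<oplus> f v) ` (K \<times> Span K Us)"
    using lin by (intro image_cong) auto
  also have "\<dots> = line_extension K (f u) (f ` Span K Us)"
    by (force simp: line_extension_mem_iff)
  finally show ?case using IH by (simp add: Span_Cons)
qed

lemma linear_image_finite_dimension:
  assumes "finite_dimension K V" "linear_on V f"
  shows "finite_dimension K (f ` V)"
proof -
  obtain Vs where Vs: "independent K Vs" "Span K Vs = V" "set Vs \<subseteq> carrier R"
    by (rule finite_dimension_base[OF assms(1)])
  have "set Vs \<subseteq> V" using Vs Span_base_incl[OF subfield_K Vs(3)] by simp
  then have "set (map f Vs) \<subseteq> carrier R" using assms(2) by (auto simp: linear_on_def)
  then show ?thesis
    using linear_image_Span[OF Vs(3), of f] Vs(2) assms(2) dim_Span_le(1) by metis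
qed

text \<open>A vector in the span of the later ones would have its image in the span of the later
  images.\<close>

lemma independent_of_image:
  assumes "set Us \<subseteq> carrier R" "linear_on (Span K Us) f" "independent K (map f Us)"
  shows "independent K Us"
  using assms
proof (induction Us)
  case (Cons u Us)
  have sub: "Span K Us \<subseteq> Span K (u # Us)" using mono_Span[OF subfield_K] Cons.prems by simp
  have lin: "linear_on (Span K Us) f" by (rule linear_on_subset[OF Cons.prems(2) sub])
  have 1: "independent K Us" using Cons lin independent_backwards(2) by auto
  have "f u \<notin> Span K (map f Us)" using Cons.prems(3) independent_backwards(1) by auto
  then have "u \<notin> Span K Us" using linear_image_Span[OF _ lin] Cons.prems(1) by auto
  with 1 show ?case using Cons.prems(1) by (auto intro: li_Cons)
qed (simp add: li_Nil)

text \<open>Preimages \<open>Us\<close> of a basis of the image span a complement of the kernel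
  \<open>N\<close> in \<open>V\<close>.\<close>

lemma rank_nullity:
  assumes "finite_dimension K V" "linear_on V f"
  defines "N \<equiv> {v \<in> V. f v = \<zero>}"
  shows "finite_dimension K N" "dim K V = dim K N + dim K (f ` V)"
proof -
  have V: "subalgebra K V R" using finite_dimension_subalgebra assms by blast
  note Vp = subalgebraD[OF V]
  have fV: "finite_dimension K (f ` V)" by (rule linear_image_finite_dimension[OF assms(1,2)])
  have "subalgebra K N R"
    using linear_on_zero[OF V assms(2)] Vp assms(2)
    by (intro subalgebraI') (auto simp: N_def linear_on_def dest!: subsetD[OF K_subset])
  then show N: "finite_dimension K N"
    using dim_mono(1)[OF _ assms(1)] by (auto simp: N_def)
  obtain Ws where Ws: "independent K Ws" "Span K Ws = f ` V" "set Ws \<subseteq> carrier R" "length Ws = dim K (f ` V)"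
    by (rule finite_dimension_base[OF fV])
  have "\<forall>w\<in>set Ws. \<exists>v. v \<in> V \<and> f v = w"
    using Ws Span_base_incl[OF subfield_K Ws(3)] by auto
  then obtain g where g: "\<And>w. w \<in> set Ws \<Longrightarrow> g w \<in> V \<and> f (g w) = w" by metis
  define Us where "Us = map g Ws"
  have fUs: "map f Us = Ws" using g by (simp add: Us_def map_idI)
  have Us: "set Us \<subseteq> V" "set Us \<subseteq> carrier R" using g Vp(1) by (auto simp: Us_def)
  have sub: "Span K Us \<subseteq> V" using subalgebra_Span_incl[OF subfield_K V Us(1)] .
  have lin: "linear_on (Span K Us) f" by (rule linear_on_subset[OF assms(2) sub])
  have ind: "independent K Us" using independent_of_image[OF Us(2) lin] fUs Ws(1) by simp
  have img: "f ` Span K Us = f ` V" using linear_image_Span[OF Us(2) lin] fUs Ws(2) by simp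
  have dimU: "dimension (length Us) K (Span K Us)" using ind by auto
  \<comment> \<open>The coefficients of \<open>v\<close> in \<open>Us\<close> are also coefficients
    of \<open>f v = \<zero>\<close> in the independent list \<open>Ws\<close>, so they
    vanish.\<close>
  have "N \<inter> Span K Us = {\<zero>}"
  proof -
    have "v = \<zero>" if "v \<in> Span K Us" "f v = \<zero>" for v
    proof -
      obtain Ks where Ks: "set Ks \<subseteq> K" "length Ks = length Us" "v = combine Ks Us"
        using Span_mem_iff_length_version[OF subfield_K Us(2)] \<open>v \<in> Span K Us\<close> by auto
      have "f (combine Ks Us) = combine Ks (map f Us)"
        using lin Us(2) Ks(1,2)
      proof (induction Us arbitrary: Ks)
        case Nil
        then show ?case
          using linear_on_zero[of "{\<zero>}" f] Span_is_subalgebra[OF subfield_K, of "[]"] by simp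
      next
        case (Cons u Us)
        obtain c Cs where Ks: "Ks = c # Cs" using Cons.prems by (cases Ks) auto
        have sub: "Span K Us \<subseteq> Span K (u # Us)" using mono_Span[OF subfield_K] Cons.prems by simp
        have cu: "u \<in> Span K (u # Us)" "c \<otimes> u \<in> Span K (u # Us)"
          using Span_base_incl[OF subfield_K, of "u # Us"] Span_smult_closed[OF subfield_K, of "u # Us" c u]
            Cons.prems Ks by auto
        have cc: "combine Cs Us \<in> Span K (u # Us)"
          using Span_mem_iff_length_version[OF subfield_K, of Us] Cons.prems Ks sub by auto
        have "f (combine Cs Us) = combine Cs (map f Us)"
          using Cons Ks linear_on_subset[OF Cons.prems(1) sub] by auto
        then show ?case using Cons.prems Ks cu cc by (auto simp: linear_on_def)
      qed
      then have "combine Ks Ws = \<zero>" using that Ks fUs by simp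
      then have "set (take (length Ws) Ks) \<subseteq> {\<zero>}"
        using independent_imp_trivial_combine[OF subfield_K Ws(1) Ks(1)] by simp
      moreover have "length Ws = length Us" using fUs by auto
      ultimately have "Ks = replicate (length Us) \<zero>"
        using Ks(2) by (intro replicate_eqI) auto
      then show ?thesis using Ks(3) combine_replicate[OF Us(2)] by simp
    qed
    moreover have "\<zero> \<in> N" "\<zero> \<in> Span K Us"
      using linear_on_zero[OF V assms(2)] Vp(2) Span_subgroup_props(2)[OF subfield_K Us(2)] by (auto simp: N_def)
    ultimately show ?thesis by (auto simp: N_def)
  qed
  then have "dimension (dim K N + length Us) K (N <+>\<^bsub>R\<^esub> Span K Us)"
    using dimension_direct_sum_space[OF subfield_K _ dimU] finite_dimensionE[OF subfield_K N] by (simp add: over_def)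
  moreover have "N <+>\<^bsub>R\<^esub> Span K Us = V"
  proof
    show "N <+>\<^bsub>R\<^esub> Span K Us \<subseteq> V" using sub Vp by (auto simp: set_add_def' N_def)
    \<comment> \<open>Every \<open>v\<close> differs by a kernel element from the combination of
      \<open>Us\<close> with the same image.\<close>
    show "V \<subseteq> N <+>\<^bsub>R\<^esub> Span K Us"
    proof
      fix v assume v: "v \<in> V"
      then obtain u where u: "u \<in> Span K Us" "f v = f u" using img by (metis imageE imageI)
      have "u \<in> V" using u sub by auto
      then have "f (v \<ominus> u) = \<zero>" "v \<ominus> u \<in> V"
        using linear_on_minus[OF V assms(2) v] u v Vp assms(2) 
        by (auto simp: linear_on_def a_minus_def r_neg)
      moreover have "v = (v \<ominus> u) \<oplus> u" 
        using subsetD[OF Vp(1) \<open>u \<in> V\<close>] subsetD[OF Vp(1) v] by (simp add: a_minus_def a_assoc l_neg)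
      ultimately show "v \<in> N <+>\<^bsub>R\<^esub> Span K Us" using u by (auto simp: set_add_def' N_def)
    qed
  qed
  ultimately show "dim K V = dim K N + dim K (f ` V)"
    using dimI' Ws(4) by (simp add: Us_def)
qed

lemma dim_image_inj:
  assumes "finite_dimension K V" "linear_on V f" "\<And>v. v \<in> V \<Longrightarrow> f v = \<zero> \<Longrightarrow> v = \<zero>"
  shows "dim K (f ` V) = dim K V"
proof -
  have V: "subalgebra K V R" using finite_dimension_subalgebra assms by blast
  have "{v \<in> V. f v = \<zero>} = {\<zero>}"
    using assms(3) linear_on_zero[OF V assms(2)] subalgebraD(2)[OF V] by auto
  moreover have "dim K {\<zero>} = 0" by (rule dimI'[OF zero_dim])
  ultimately show ?thesis using rank_nullity(2)[OF assms(1,2)] by simp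
qed

text \<open>Centrality of \<open>K\<close> enters here:
  \<open>r (c v) = (r c) v = c (r v)\<close>.\<close>

lemma linear_on_lmult: "V \<subseteq> carrier R \<Longrightarrow> r \<in> carrier R \<Longrightarrow> linear_on V (\<lambda>v. r \<otimes> v)"
  using K_subset by (auto simp: linear_on_def r_distr subset_iff simp flip: m_assoc) (metis central_K)

section \<open>Sums of left translates\<close>

text \<open>The family that is \<open>v\<close> at \<open>s\<close> and zero elsewhere isolates a
  single translate; this is where \<open>\<zero> \<in> V\<close> enters.\<close>

lemma translate_in_sum:
  assumes "finite S" "S \<subseteq> carrier R" "V \<subseteq> carrier R" "\<zero> \<in> V" "s \<in> S" "v \<in> V"
  shows "s \<otimes> v \<in> sum_left_translates R S V"
proof -
  have "(\<Oplus>r\<in>S. r \<otimes> (if r = s then v else \<zero>)) = (\<Oplus>r\<in>S. if s = r then s \<otimes> v else \<zero>)"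
    using assms by (intro add.finprod_cong') (auto simp: subset_iff)
  also have "\<dots> = s \<otimes> v"
    using add.finprod_singleton[of s S "\<lambda>_. s \<otimes> v"] assms by (auto simp: subset_iff)
  finally show ?thesis
    unfolding sum_left_translates_def using assms by (auto intro!: exI[of _ "\<lambda>r. if r = s then v else \<zero>"])
qed

lemma finsum_in_subspace:
  assumes "subalgebra K W R" "finite S" "\<And>s. s \<in> S \<Longrightarrow> f s \<in> W"
  shows "(\<Oplus>s\<in>S. f s) \<in> W"
  using assms(2,3)
proof (induction S)
  case (insert s S)
  then show ?case using subalgebraD[OF assms(1)] by (subst finsum_insert) auto
qed (use subalgebraD[OF assms(1)] in auto)

lemma sum_left_translates_least:
  assumes "subalgebra K W R" "finite S" "\<And>s v. s \<in> S \<Longrightarrow> v \<in> V \<Longrightarrow> s \<otimes> v \<in> W"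
  shows "sum_left_translates R S V \<subseteq> W"
  unfolding sum_left_translates_def using finsum_in_subspace[OF assms(1,2)] assms(3) by (auto simp: Pi_def)

lemma subalgebra_sum_left_translates:
  assumes "finite S" "S \<subseteq> carrier R" "subalgebra K V R"
  shows "subalgebra K (sum_left_translates R S V) R"
proof (rule subalgebraI')
  note Vp = subalgebraD[OF assms(3)]
  have Sc: "s \<in> carrier R" if "s \<in> S" for s using that assms by auto
  have Vc: "s \<in> carrier R" if "s \<in> V" for s using that Vp by auto
  have Kc: "s \<in> carrier R" if "s \<in> K" for s using that K_subset by auto
  show "sum_left_translates R S V \<subseteq> carrier R"
    unfolding sum_left_translates_def using Sc Vc by (auto intro!: finsum_closed simp: Pi_def)
  have "(\<Oplus>s\<in>S. s \<otimes> \<zero>) = \<zero>" using Sc by (intro add.finprod_one_eqI) auto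
  then show "\<zero> \<in> sum_left_translates R S V"
    unfolding sum_left_translates_def using Vp(2) by (auto intro!: exI[of _ "\<lambda>_. \<zero>"])
  show "a \<oplus> b \<in> sum_left_translates R S V"
    if ab: "a \<in> sum_left_translates R S V" "b \<in> sum_left_translates R S V" for a b
  proof -
    obtain u v where uv: "u \<in> S \<rightarrow> V" "v \<in> S \<rightarrow> V" "a = (\<Oplus>s\<in>S. s \<otimes> u s)" "b = (\<Oplus>s\<in>S. s \<otimes> v s)"
      using ab unfolding sum_left_translates_def by auto
    have "a \<oplus> b = (\<Oplus>s\<in>S. s \<otimes> u s \<oplus> s \<otimes> v s)"
      unfolding uv using uv(1,2) Sc Vc by (intro finsum_addf[symmetric]) (auto simp: Pi_def)
    also have "\<dots> = (\<Oplus>s\<in>S. s \<otimes> (u s \<oplus> v s))"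
      using uv(1,2) Sc Vc by (intro finsum_cong') (auto simp: Pi_def r_distr)
    finally show ?thesis unfolding sum_left_translates_def using uv Vp(3)
      by (auto intro!: exI[of _ "\<lambda>s. u s \<oplus> v s"] simp: Pi_def)
  qed
  show "c \<otimes> a \<in> sum_left_translates R S V" if ca: "c \<in> K" "a \<in> sum_left_translates R S V" for c a
  proof -
    obtain u where u: "u \<in> S \<rightarrow> V" "a = (\<Oplus>s\<in>S. s \<otimes> u s)"
      using ca unfolding sum_left_translates_def by auto
    have "c \<otimes> a = (\<Oplus>s\<in>S. c \<otimes> (s \<otimes> u s))"
      unfolding u using u(1) Sc Vc Kc[OF ca(1)] assms(1) by (intro finsum_rdistr) (auto simp: Pi_def)
    also have "\<dots> = (\<Oplus>s\<in>S. s \<otimes> (c \<otimes> u s))"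
    proof (intro finsum_cong')
      fix s assume s: "s \<in> S"
      have "c \<otimes> (s \<otimes> u s) = (c \<otimes> s) \<otimes> u s" using s u(1) Sc Vc Kc[OF ca(1)] by (auto simp: m_assoc Pi_def)
      also have "\<dots> = (s \<otimes> c) \<otimes> u s" using central_K[OF ca(1) Sc[OF s]] by simp
      also have "\<dots> = s \<otimes> (c \<otimes> u s)" using s u(1) Sc Vc Kc[OF ca(1)] by (auto simp: m_assoc Pi_def)
      finally show "c \<otimes> (s \<otimes> u s) = s \<otimes> (c \<otimes> u s)" .
    qed (use u Sc Vc Kc ca in \<open>auto simp: Pi_def\<close>)
    finally show ?thesis unfolding sum_left_translates_def using u Vp(4)[OF ca(1)]
      by (auto intro!: exI[of _ "\<lambda>s. c \<otimes> u s"] simp: Pi_def)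
  qed
qed

lemma finite_dimension_sum_left_translates:
  assumes "finite S" "S \<subseteq> carrier R" "finite_dimension K V"
  shows "finite_dimension K (sum_left_translates R S V)"
proof -
  obtain Vs where Vs: "independent K Vs" "Span K Vs = V" "set Vs \<subseteq> carrier R"
    by (rule finite_dimension_base[OF assms(3)])
  obtain Ss where Ss: "set Ss = S" using finite_list[OF assms(1)] by auto
  define Ws where "Ws = concat (map (\<lambda>s. map (\<lambda>v. s \<otimes> v) Vs) Ss)"
  have Ws: "set Ws \<subseteq> carrier R" using Ss Vs(3) assms(2) by (auto simp: Ws_def)
  have sub: "subalgebra K (Span K Ws) R" by (rule Span_is_subalgebra[OF subfield_K Ws])
  have "sum_left_translates R S V \<subseteq> Span K Ws"
  proof (rule sum_left_translates_least[OF sub assms(1)])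
    fix s v assume s: "s \<in> S" and v: "v \<in> V"
    have sc: "s \<in> carrier R" using s assms by auto
    have Vc: "V \<subseteq> carrier R" using subalgebraD(1)[OF finite_dimension_subalgebra[OF assms(3)]] .
    have "(\<lambda>v. s \<otimes> v) ` V = Span K (map (\<lambda>v. s \<otimes> v) Vs)"
      using linear_image_Span[OF Vs(3), of "\<lambda>v. s \<otimes> v"] Vs(2) linear_on_lmult[OF Vc sc] by simp
    also have "\<dots> \<subseteq> Span K Ws" 
      using s Ss by (intro mono_Span_sublist[OF subfield_K _ Ws]) (auto simp: Ws_def)
    finally show "s \<otimes> v \<in> Span K Ws" using v by auto
  qed
  then show ?thesis
    using dim_mono(1)[OF subalgebra_sum_left_translates[OF assms(1,2) finite_dimension_subalgebra[OF assms(3)]] dim_Span_le(1)[OF Ws]]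
    by simp
qed

end

lemma (in skew_field_extension) central_algebra_image: "central_algebra D (\<iota> ` carrier k)"
proof -
  interpret h: ring_hom_ring k D \<iota>
    using structure_hom ring_axioms A.ring_axioms by (intro ring_hom_ringI2)
  show ?thesis
  proof (intro central_algebra.intro central_algebra_axioms.intro A.ring_axioms)
    show "subfield (\<iota> ` carrier k) D"
      using h.img_is_subfield(2)[OF carrier_is_subfield] skew_field.one_not_zero[OF skew_field_axioms] by simp
  qed (use structure_central in \<open>auto simp: ring_center_def\<close>)
qed

text \<open>Growth by the factor \<open>1 + \<epsilon>\<close> at every step would give
  \<open>n * ln (1 + \<epsilon>) \<le> ln (d n)\<close>, while \<open>(A + c * ln n) / n\<close>
  tends to zero.\<close>

lemma polynomial_growth_ratio:
  fixes d :: "nat \<Rightarrow> nat" and A c \<epsilon> :: real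
  assumes pos: "\<And>n. 0 < d n" and bound: "\<forall>\<^sub>F n in sequentially. ln (real (d n)) \<le> A + c * ln (real n)"
    and "0 < \<epsilon>"
  shows "\<exists>n. real (d (Suc n)) < (1 + \<epsilon>) * real (d n)"
proof (rule ccontr)
  assume "\<not> ?thesis"
  then have step: "(1 + \<epsilon>) * real (d n) \<le> real (d (Suc n))" for n by (simp add: not_less)
  have "(1 + \<epsilon>) ^ n \<le> real (d n)" for n
  proof (induction n)
    case 0
    show ?case using pos[of 0] by simp
  next
    case (Suc n)
    have "(1 + \<epsilon>) ^ Suc n \<le> (1 + \<epsilon>) * real (d n)" using Suc \<open>0 < \<epsilon>\<close> by simp
    with step[of n] show ?case by simp
  qed
  then have "ln ((1 + \<epsilon>) ^ n) \<le> ln (real (d n))" for n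
    using \<open>0 < \<epsilon>\<close> by (intro ln_mono) auto
  then have ln_le: "real n * ln (1 + \<epsilon>) \<le> ln (real (d n))" for n
    using \<open>0 < \<epsilon>\<close> by (simp add: ln_realpow)
  have "(\<lambda>n. A / real n + c * (ln (real n) / real n)) \<longlonglongrightarrow> 0 + c * 0"
    by (intro tendsto_add tendsto_mult tendsto_const lim_const_over_n
        filterlim_compose[OF ln_x_over_x_tendsto_0 filterlim_real_sequentially])
  moreover have "0 < ln (1 + \<epsilon>)" using \<open>0 < \<epsilon>\<close> by simp
  ultimately have "\<forall>\<^sub>F n in sequentially. A / real n + c * (ln (real n) / real n) < ln (1 + \<epsilon>)"
    by (intro order_tendstoD(2)) auto
  with bound have "\<forall>\<^sub>F n in sequentially. False"
    using eventually_gt_at_top[of 0]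
  proof eventually_elim
    case (elim n)
    then have "(A + c * ln (real n)) / real n < ln (1 + \<epsilon>)" by (simp add: add_divide_distrib)
    then have "A + c * ln (real n) < real n * ln (1 + \<epsilon>)" using elim by (simp add: field_simps)
    with elim ln_le[of n] show ?case by linarith
  qed
  then show False by simp
qed

context central_algebra
begin

text \<open>\<open>Y\<close> is kept apart from \<open>V\<close> for the Gelfand--Kirillov case:
  there \<open>S\<close> carries \<open>r P n\<close> into \<open>P (n + 1)\<close>, which is not
  \<open>V (n + 1)\<close> but has the same dimension.\<close>

lemma almost_invariant_of_growth:
  assumes fd: "\<And>n. finite_dimension K (V n)" "\<And>n. V n \<noteq> {\<zero>}" "\<And>n. finite_dimension K (Y n)"
    and dimY: "\<And>n. dim K (Y n) = dim K (V n)"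
    and S: "finite S" "S \<subseteq> carrier R" "\<And>s v n. s \<in> S \<Longrightarrow> v \<in> V n \<Longrightarrow> s \<otimes> v \<in> Y (Suc n)"
    and bound: "\<forall>\<^sub>F n in sequentially. ln (real (dim K (V n))) \<le> A + c * ln (real n)"
    and "0 < \<epsilon>"
  shows "\<exists>W. finite_dimension K W \<and> W \<noteq> {\<zero>} \<and>
    real (dim K (sum_left_translates R S W)) / real (dim K W) < 1 + \<epsilon>"
proof -
  have pos: "0 < dim K (V n)" for n using dim_pos fd by blast
  obtain n where n: "real (dim K (V (Suc n))) < (1 + \<epsilon>) * real (dim K (V n))"
    using polynomial_growth_ratio[of "\<lambda>n. dim K (V n)", OF pos bound \<open>0 < \<epsilon>\<close>] by blast
  have "sum_left_translates R S (V n) \<subseteq> Y (Suc n)"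
    using S by (intro sum_left_translates_least finite_dimension_subalgebra fd) auto
  then have "dim K (sum_left_translates R S (V n)) \<le> dim K (Y (Suc n))"
    using S by (intro dim_mono(2) subalgebra_sum_left_translates finite_dimension_subalgebra fd)
  then have "real (dim K (sum_left_translates R S (V n))) < (1 + \<epsilon>) * real (dim K (V n))"
    using n dimY by (smt (verit) of_nat_mono)
  then show ?thesis using fd pos[of n] by (intro exI[of _ "V n"]) (simp add: divide_less_eq)
qed

end

section \<open>Finite dimension over the center\<close>

context ring
begin

text \<open>Kept as a list, so that its length \<open>(n + 1) ^ length ts\<close> can bound a
  dimension; the degree of this polynomial in \<open>n\<close> depends on \<open>ts\<close>
  alone.\<close>

primrec box_monomials :: "'a list \<Rightarrow> nat \<Rightarrow> 'a list" where
  "box_monomials [] n = [\<one>]"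
| "box_monomials (t # ts) n = concat (map (\<lambda>i. map (\<lambda>m. t [^] i \<otimes> m) (box_monomials ts n)) [0..<Suc n])"

lemma length_box_monomials: "length (box_monomials ts n) = Suc n ^ length ts"
proof (induction ts)
  case (Cons t ts)
  then show ?case by (simp add: length_concat o_def sum_list_triv del: upt_Suc)
qed simp

lemma set_box_monomials_Cons:
  "set (box_monomials (t # ts) n) = {t [^] i \<otimes> m | i m. i \<le> n \<and> m \<in> set (box_monomials ts n)}"
  by (force simp: less_Suc_eq_le simp del: upt_Suc)

lemma one_in_box_monomials: "\<one> \<in> set (box_monomials ts n)"
proof (induction ts)
  case (Cons t ts)
  then show ?case unfolding set_box_monomials_Cons by (auto intro!: exI[of _ "0::nat"] exI[of _ "\<one>"])
qed simp

lemma center_commutes: "z \<in> ring_center R \<Longrightarrow> x \<in> carrier R \<Longrightarrow> z \<otimes> x = x \<otimes> z"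
  unfolding ring_center_def by blast

lemma center_closed:
  "ring_center R \<subseteq> carrier R" "\<one> \<in> ring_center R" "\<zero> \<in> ring_center R"
  "a \<in> ring_center R \<Longrightarrow> b \<in> ring_center R \<Longrightarrow> a \<otimes> b \<in> ring_center R"
  "a \<in> ring_center R \<Longrightarrow> b \<in> ring_center R \<Longrightarrow> a \<oplus> b \<in> ring_center R"
  "a \<in> ring_center R \<Longrightarrow> \<ominus> a \<in> ring_center R"
  "a \<in> ring_center R \<Longrightarrow> a [^] (i::nat) \<in> ring_center R"
proof -
  show 1: "ring_center R \<subseteq> carrier R" "\<one> \<in> ring_center R" "\<zero> \<in> ring_center R"
    by (auto simp: ring_center_def)
  show 2: "a \<otimes> b \<in> ring_center R" if "a \<in> ring_center R" "b \<in> ring_center R" for a b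
  proof -
    have ab: "a \<in> carrier R" "b \<in> carrier R" using that by (auto simp: ring_center_def)
    have "a \<otimes> b \<otimes> x = x \<otimes> (a \<otimes> b)" if x: "x \<in> carrier R" for x
    proof -
      have "a \<otimes> b \<otimes> x = a \<otimes> (x \<otimes> b)"
        using center_commutes[OF \<open>b \<in> ring_center R\<close> x] ab x by (simp add: m_assoc)
      also have "\<dots> = x \<otimes> a \<otimes> b"
        using center_commutes[OF \<open>a \<in> ring_center R\<close> x] ab x by (simp flip: m_assoc)
      finally show ?thesis using ab x by (simp add: m_assoc)
    qed
    then show ?thesis using ab by (auto simp: ring_center_def)
  qed
  show "a \<oplus> b \<in> ring_center R" if "a \<in> ring_center R" "b \<in> ring_center R"
    using that by (auto simp: ring_center_def l_distr r_distr)
  show "\<ominus> a \<in> ring_center R" if "a \<in> ring_center R"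
    using that by (auto simp: ring_center_def l_minus r_minus)
  show "a [^] (i::nat) \<in> ring_center R" if "a \<in> ring_center R"
    using that 1 2 by (induction i) auto
qed

lemma box_monomials_central: "set ts \<subseteq> ring_center R \<Longrightarrow> set (box_monomials ts n) \<subseteq> ring_center R"
  by (induction ts) (auto simp: center_closed)

text \<open>Central elements may be reordered, so \<open>t\<close> joins its own power and raises
  one exponent by one; \<open>mono\<close> accounts for the remaining exponents.\<close>

lemma box_monomials_step:
  assumes "set ts \<subseteq> ring_center R" "t \<in> set ts" "m \<in> set (box_monomials ts n)"
  shows "m \<otimes> t \<in> set (box_monomials ts (Suc n))"
proof -
  have mono: "set (box_monomials ts n) \<subseteq> set (box_monomials ts (Suc n))" for ts
    by (induction ts) (auto simp: set_box_monomials_Cons simp del: box_monomials.simps(2) intro: le_SucI)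
  show ?thesis
    using assms
  proof (induction ts arbitrary: m)
    case (Cons u ts)
    obtain i q where m: "m = u [^] i \<otimes> q" "i \<le> n" "q \<in> set (box_monomials ts n)"
      using Cons.prems(3) unfolding set_box_monomials_Cons by auto
    have c: "u \<in> ring_center R" "t \<in> ring_center R" "q \<in> ring_center R"
      using Cons.prems box_monomials_central[of ts n] m(3) by auto
    then have cc: "u \<in> carrier R" "t \<in> carrier R" "q \<in> carrier R" using center_closed(1) by auto
    show ?case
    proof (cases "t = u")
      case True
      have "m \<otimes> t = u [^] i \<otimes> (q \<otimes> u)" using m(1) cc True by (simp add: m_assoc)
      also have "q \<otimes> u = u \<otimes> q" using center_commutes c(3) cc by blast
      finally have "m \<otimes> t = u [^] Suc i \<otimes> q" using cc by (simp add: m_assoc)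
      then show ?thesis unfolding set_box_monomials_Cons using m mono[of ts] by (intro CollectI exI[of _ "Suc i"] exI[of _ q]) auto
    next
      case False
      then have "q \<otimes> t \<in> set (box_monomials ts (Suc n))" using Cons m by auto
      then show ?thesis unfolding set_box_monomials_Cons using m cc
        by (intro CollectI exI[of _ i] exI[of _ "q \<otimes> t"]) (auto simp: m_assoc)
    qed
  qed simp
qed

end

context skew_field
begin

lemma nonzero_inverse:
  assumes "a \<in> carrier R" "a \<noteq> \<zero>"
  shows "inv a \<in> carrier R" "inv a \<noteq> \<zero>" "a \<otimes> inv a = \<one>" "inv a \<otimes> a = \<one>"
proof -
  have a: "a \<in> Units R" using assms skew_field_Units by simp
  show "inv a \<in> carrier R" "a \<otimes> inv a = \<one>" "inv a \<otimes> a = \<one>" using a by auto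
  show "inv a \<noteq> \<zero>" using Units_inv_Units[OF a] skew_field_Units by auto
qed

lemma no_zero_divisors:
  assumes "a \<in> carrier R" "b \<in> carrier R" "a \<otimes> b = \<zero>"
  shows "a = \<zero> \<or> b = \<zero>"
proof (rule ccontr)
  assume "\<not> ?thesis"
  then have "a \<in> Units R" "b \<in> Units R" using assms skew_field_Units by auto
  then have "a \<otimes> b \<in> Units R" by simp
  then show False using assms(3) skew_field_Units by simp
qed

lemma sub_skew_fieldI:
  assumes "subring L R" "\<And>a. a \<in> L \<Longrightarrow> a \<noteq> \<zero> \<Longrightarrow> inv a \<in> L"
  shows "sub_skew_field L R"
proof -
  let ?L = "R\<lparr>carrier := L\<rparr>"
  interpret L: ring ?L by (rule subring_is_ring[OF assms(1)])
  have sub: "L \<subseteq> carrier R" using subringE(1)[OF assms(1)] .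
  have "Units ?L = L - {\<zero>}"
  proof (intro equalityI subsetI)
    fix a assume a: "a \<in> Units ?L"
    then obtain b where "a \<in> L" "b \<in> L" "a \<otimes> b = \<one>" by (auto simp: Units_def)
    then show "a \<in> L - {\<zero>}" using sub one_not_zero by auto
  next
    fix a assume a: "a \<in> L - {\<zero>}"
    then have "inv a \<in> L" "a \<otimes> inv a = \<one>" "inv a \<otimes> a = \<one>" "a \<in> L"
      using assms(2) nonzero_inverse sub by auto
    then show "a \<in> Units ?L" by (auto simp: Units_def)
  qed
  then have "skew_field ?L"
    using L.ring_axioms one_not_zero by (intro skew_field.intro skew_field_axioms.intro) auto
  then show ?thesis using assms(1) by (simp add: sub_skew_field_def)
qed

lemma subfield_center: "subfield (ring_center R) R"
proof (rule subfieldI)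
  note c = center_closed
  have sub: "subring (ring_center R) R" using c by (intro subringI) auto
  show "subcring (ring_center R) R"
    using sub c(1) center_commutes by (intro subcringI) blast+
  have "inv a \<in> ring_center R" if a: "a \<in> ring_center R" "a \<noteq> \<zero>" for a
  proof -
    have ac: "a \<in> carrier R" using a c by auto
    note i = nonzero_inverse[OF ac a(2)]
    have "inv a \<otimes> x = x \<otimes> inv a" if x: "x \<in> carrier R" for x
    proof -
      have "inv a \<otimes> x = inv a \<otimes> (x \<otimes> a) \<otimes> inv a" using ac i x by (simp add: m_assoc)
      also have "x \<otimes> a = a \<otimes> x" using center_commutes[OF a(1) x] by simp
      also have "inv a \<otimes> (a \<otimes> x) \<otimes> inv a = x \<otimes> inv a" using ac i x by (simp flip: m_assoc)
      finally show ?thesis .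
    qed
    then show ?thesis using i by (auto simp: ring_center_def)
  qed
  from sub_skew_fieldI[OF sub this] show "Units (R\<lparr>carrier := ring_center R\<rparr>) = ring_center R - {\<zero>}"
    by (auto simp: sub_skew_field_def skew_field_def skew_field_axioms_def)
qed

end

locale central_skew_field = central_algebra + skew_field

lemma skew_field_extension_central:
  assumes "skew_field_extension k \<iota> D"
  shows "central_skew_field D (\<iota> ` carrier k)"
  using skew_field_extension.central_algebra_image[OF assms] assms
  by (simp add: central_skew_field_def skew_field_extension_def)

lemma amenable_finite_dimension_center:
  assumes "skew_field_extension k \<iota> D" "ring.finite_dimension D (ring_center D) (carrier D)"
  shows "amenable k \<iota> D"
proof -
  interpret A: central_skew_field D "\<iota> ` carrier k" by (rule skew_field_extension_central[OF assms(1)])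
  let ?K = "\<iota> ` carrier k" and ?Z = "ring_center D"
  have Zsub: "subfield ?Z D" by (rule A.subfield_center)
  obtain Es where Es: "set Es \<subseteq> carrier D" "A.Span ?Z Es = carrier D"
    using assms(2) A.exists_base[OF Zsub] unfolding A.finite_dimension_def by metis
  show ?thesis
    unfolding amenable_def
  proof (intro allI impI, elim conjE)
    fix S and \<epsilon> :: real assume S: "finite S" "S \<subseteq> carrier D" and "0 < \<epsilon>"
    have "\<forall>x\<in>carrier D. \<exists>Ks. set Ks \<subseteq> ?Z \<and> x = A.combine Ks Es"
      using A.Span_eq_combine_set[OF Zsub Es(1)] Es(2) by auto
    then obtain co where co: "\<And>x. x \<in> carrier D \<Longrightarrow> set (co x) \<subseteq> ?Z \<and> x = A.combine (co x) Es" by metis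
    have fin: "finite (\<Union>s\<in>S. \<Union>e\<in>set Es. set (co (s \<otimes>\<^bsub>D\<^esub> e)))" using S by auto
    \<comment> \<open>All central coefficients needed to write the products \<open>s e\<close> in
      terms of \<open>Es\<close>; there are finitely many because \<open>S\<close> and
      \<open>Es\<close> are finite.\<close>
    obtain ts where ts: "set ts = (\<Union>s\<in>S. \<Union>e\<in>set Es. set (co (s \<otimes>\<^bsub>D\<^esub> e)))"
      using finite_list[OF fin] by (elim exE)
    have tsZ: "set ts \<subseteq> ?Z"
    proof -
      have "set (co (s \<otimes>\<^bsub>D\<^esub> e)) \<subseteq> ?Z" if "s \<in> S" "e \<in> set Es" for s e
        using co[of "s \<otimes>\<^bsub>D\<^esub> e"] that S(2) Es(1) by blast
      then show ?thesis unfolding ts by blast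
    qed
    define G where "G n = concat (map (\<lambda>w. map (\<lambda>e. w \<otimes>\<^bsub>D\<^esub> e) Es) (A.box_monomials ts n))" for n
    define V where "V n = A.Span ?K (G n)" for n
    have Gset: "set (G n) = {w \<otimes>\<^bsub>D\<^esub> e | w e. w \<in> set (A.box_monomials ts n) \<and> e \<in> set Es}" for n
      by (auto simp: G_def)
    have boxZ: "set (A.box_monomials ts n) \<subseteq> ?Z" for n by (rule A.box_monomials_central[OF tsZ])
    have boxc: "set (A.box_monomials ts n) \<subseteq> carrier D" for n using boxZ A.center_closed(1) by blast
    have Gc: "set (G n) \<subseteq> carrier D" for n unfolding Gset using boxc Es(1) by blast
    have lenG: "length (G n) = length Es * Suc n ^ length ts" for n
      using A.length_box_monomials[of ts n] by (simp add: G_def length_concat o_def sum_list_triv)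
    have EsG: "set Es \<subseteq> set (G n)" for n
      unfolding Gset using A.one_in_box_monomials Es(1) by (force simp: subset_iff)
    \<comment> \<open>Some generator is nonzero, as the unit lies in the span of \<open>Es\<close>;
      this keeps every \<open>V n\<close> nonzero.\<close>
    obtain e where e: "e \<in> set Es" "e \<noteq> \<zero>\<^bsub>D\<^esub>"
    proof (rule ccontr)
      assume "\<not> thesis"
      then have "set Es \<subseteq> {\<zero>\<^bsub>D\<^esub>}" using that by blast
      moreover have "subalgebra ?Z {\<zero>\<^bsub>D\<^esub>} D" using A.Span_is_subalgebra[OF Zsub, of "[]"] by (simp add: A.Span.simps)
      ultimately have "A.Span ?Z Es \<subseteq> {\<zero>\<^bsub>D\<^esub>}" using A.subalgebra_Span_incl[OF Zsub] by blast
      then show False using Es(2) A.one_not_zero A.one_closed by auto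
    qed
    have fd: "A.finite_dimension ?K (V n)" for n unfolding V_def by (rule A.dim_Span_le(1)[OF Gc])
    have nz: "V n \<noteq> {\<zero>\<^bsub>D\<^esub>}" for n
      using e EsG[of n] A.Span_base_incl[OF A.subfield_K Gc, of n] by (auto simp: V_def)
    \<comment> \<open>The central monomial \<open>w\<close> passes \<open>s\<close>, and
      \<open>s e\<close> expands with coefficients \<open>c\<close> from \<open>ts\<close>; each
      term \<open>(w c) e'\<close> uses a monomial with exponents at most
      \<open>n + 1\<close>.\<close>
    have step: "s \<otimes>\<^bsub>D\<^esub> v \<in> V (Suc n)" if s: "s \<in> S" and v: "v \<in> V n" for s v n
    proof -
      have sc: "s \<in> carrier D" using s S by auto
      have sub: "subalgebra ?K (V (Suc n)) D" using fd by (rule A.finite_dimension_subalgebra)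
      note subp = A.subalgebraD[OF sub]
      have gen: "s \<otimes>\<^bsub>D\<^esub> (w \<otimes>\<^bsub>D\<^esub> e) \<in> V (Suc n)"
        if w: "w \<in> set (A.box_monomials ts n)" and e: "e \<in> set Es" for w e
      proof -
        have wc: "w \<in> carrier D" and ec: "e \<in> carrier D" using w e boxc Es by auto
        have "s \<otimes>\<^bsub>D\<^esub> (w \<otimes>\<^bsub>D\<^esub> e) = (s \<otimes>\<^bsub>D\<^esub> w) \<otimes>\<^bsub>D\<^esub> e" using sc wc ec by (simp add: A.m_assoc)
        also have "s \<otimes>\<^bsub>D\<^esub> w = w \<otimes>\<^bsub>D\<^esub> s" using A.center_commutes[OF subsetD[OF boxZ w] sc] by simp
        also have "(w \<otimes>\<^bsub>D\<^esub> s) \<otimes>\<^bsub>D\<^esub> e = w \<otimes>\<^bsub>D\<^esub> A.combine (co (s \<otimes>\<^bsub>D\<^esub> e)) Es"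
          using sc wc ec co by (simp add: A.m_assoc)
        also have "\<dots> \<in> V (Suc n)"
        proof -
          have "w \<otimes>\<^bsub>D\<^esub> A.combine Ks Fs \<in> V (Suc n)" if "set Ks \<subseteq> set ts" "set Fs \<subseteq> set Es" for Ks Fs
            using that
          proof (induction Ks Fs rule: A.combine.induct)
            case (1 c Ks f Fs)
            have cc: "c \<in> carrier D" "f \<in> carrier D" "set Ks \<subseteq> carrier D" "set Fs \<subseteq> carrier D"
              using 1 tsZ A.center_closed(1) Es(1) by auto
            have "w \<otimes>\<^bsub>D\<^esub> A.combine (c # Ks) (f # Fs)
                = (w \<otimes>\<^bsub>D\<^esub> c) \<otimes>\<^bsub>D\<^esub> f \<oplus>\<^bsub>D\<^esub> w \<otimes>\<^bsub>D\<^esub> A.combine Ks Fs"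
              using wc cc by (simp add: A.r_distr A.m_assoc)
            moreover have "(w \<otimes>\<^bsub>D\<^esub> c) \<otimes>\<^bsub>D\<^esub> f \<in> set (G (Suc n))"
              unfolding Gset using A.box_monomials_step[OF tsZ _ w, of c] 1 by auto
            ultimately show ?case
              using 1 subp(3) A.Span_base_incl[OF A.subfield_K Gc[of "Suc n"]] by (auto simp: V_def)
          qed (use wc subp in auto)
          moreover have "set (co (s \<otimes>\<^bsub>D\<^esub> e)) \<subseteq> set ts" unfolding ts using s e by auto
          ultimately show ?thesis by blast
        qed
        finally show ?thesis .
      qed
      have lin: "A.linear_on (A.Span ?K (G n)) (\<lambda>v. s \<otimes>\<^bsub>D\<^esub> v)"
        by (rule A.linear_on_lmult[OF A.Span_in_carrier[OF A.K_subset Gc] sc])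
      have "(\<lambda>v. s \<otimes>\<^bsub>D\<^esub> v) ` V n = A.Span ?K (map (\<lambda>v. s \<otimes>\<^bsub>D\<^esub> v) (G n))"
        unfolding V_def by (rule A.linear_image_Span[OF Gc lin])
      also have "\<dots> \<subseteq> V (Suc n)"
        using gen by (intro A.subalgebra_Span_incl[OF A.subfield_K sub]) (auto simp: Gset)
      finally show ?thesis using v by auto
    qed
    \<comment> \<open>\<open>Suc n \<le> 2 * n\<close> for positive \<open>n\<close> relaxes the
      dimension bound to \<open>length Es * (2 * n) ^ length ts\<close>, whence the summand with
      \<open>ln 2\<close>.\<close>
    have bound: "\<forall>\<^sub>F n in sequentially. ln (real (A.dim ?K (V n)))
        \<le> (ln (real (length Es)) + real (length ts) * ln 2) + real (length ts) * ln (real n)"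
      using eventually_gt_at_top[of 0]
    proof eventually_elim
      case (elim n)
      have l: "0 < length Es" using e by (cases Es) auto
      have "A.dim ?K (V n) \<le> length Es * Suc n ^ length ts"
        unfolding V_def using A.dim_Span_le(2)[OF Gc] lenG by metis
      also have "\<dots> \<le> length Es * (2 * n) ^ length ts"
        using elim by (intro mult_left_mono power_mono) auto
      finally have "real (A.dim ?K (V n)) \<le> real (length Es * (2 * n) ^ length ts)"
        by (rule of_nat_mono)
      then have "real (A.dim ?K (V n)) \<le> real (length Es) * (2 * real n) ^ length ts"
        by simp
      then have "ln (real (A.dim ?K (V n))) \<le> ln (real (length Es) * (2 * real n) ^ length ts)"
        using A.dim_pos[OF fd nz, of n] by (intro ln_mono) auto
      also have "\<dots> = ln (real (length Es)) + real (length ts) * (ln 2 + ln (real n))"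
        using l elim by (simp add: ln_mult ln_realpow distrib_left)
      finally show ?case by (simp add: algebra_simps)
    qed
    show "\<exists>V. A.finite_dimension ?K V \<and> V \<noteq> {\<zero>\<^bsub>D\<^esub>} \<and>
        real (A.dim ?K (sum_left_translates D S V)) / real (A.dim ?K V) < 1 + \<epsilon>"
      by (rule A.almost_invariant_of_growth[OF fd nz fd refl S step bound \<open>0 < \<epsilon>\<close>])
  qed
qed

section \<open>Powers of subspaces and the Gelfand--Kirillov degree\<close>

context central_algebra
begin

lemma Span_one: "Span K [\<one>] = K"
  using K_subset by (force simp: Span_Cons line_extension_mem_iff)

lemma finite_dimension_K: "finite_dimension K K"
  using dim_Span_le(1)[of "[\<one>]"] Span_one by simp

lemma affine_translate_mem: "c \<in> K \<Longrightarrow> v \<in> V \<Longrightarrow> c \<oplus> v \<otimes> r \<in> K <+>\<^bsub>R\<^esub> (V #> r)"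
  unfolding set_add_def' r_coset_def by blast

lemma finite_dimension_affine_translate:
  assumes "finite_dimension K V" "r \<in> carrier R"
  shows "finite_dimension K (K <+>\<^bsub>R\<^esub> (V #> r))"
proof -
  have Vc: "V \<subseteq> carrier R" using subalgebraD(1)[OF finite_dimension_subalgebra[OF assms(1)]] .
  have "linear_on V (\<lambda>v. v \<otimes> r)"
    using Vc assms(2) K_subset by (auto simp: linear_on_def l_distr m_assoc subset_iff)
  then have "finite_dimension K ((\<lambda>v. v \<otimes> r) ` V)" by (rule linear_image_finite_dimension[OF assms(1)])
  moreover have "(\<lambda>v. v \<otimes> r) ` V = V #> r" by (auto simp: r_coset_def)
  ultimately show ?thesis using sum_space_dim(1)[OF subfield_K finite_dimension_K] by simp
qed

lemma foldr_mult_closed: "set xs \<subseteq> carrier R \<Longrightarrow> foldr (\<otimes>) xs \<one> \<in> carrier R"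
  by (induction xs) auto

lemma subalgebra_span_power:
  assumes "U \<subseteq> carrier R"
  shows "subalgebra K (span_power R K U n) R"
proof (rule subalgebraI')
  let ?P = "{foldr (\<otimes>) xs \<one> | xs. length xs = n \<and> set xs \<subseteq> U}"
  have mem: "a \<in> span_power R K U n \<longleftrightarrow> (\<forall>W. subalgebra K W R \<longrightarrow> ?P \<subseteq> W \<longrightarrow> a \<in> W)" for a
    by (auto simp: span_power_def hull_def)
  have "?P \<subseteq> carrier R" using foldr_mult_closed assms by blast
  then show "span_power R K U n \<subseteq> carrier R"
    using mem carrier_is_subalgebra[OF K_subset] by blast
  show "\<zero> \<in> span_power R K U n" using subalgebraD(2) mem by blast
  show "a \<oplus> b \<in> span_power R K U n" if "a \<in> span_power R K U n" "b \<in> span_power R K U n" for a b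
    using that subalgebraD(3) unfolding mem by blast
  show "c \<otimes> a \<in> span_power R K U n" if "c \<in> K" "a \<in> span_power R K U n" for a c
    using that subalgebraD(4) unfolding mem by blast
qed

lemma product_in_span_power:
  "length xs = n \<Longrightarrow> set xs \<subseteq> U \<Longrightarrow> foldr (\<otimes>) xs \<one> \<in> span_power R K U n"
  unfolding span_power_def by (intro hull_inc) blast

lemma span_power_least:
  assumes "subalgebra K W R" "\<And>xs. length xs = n \<Longrightarrow> set xs \<subseteq> U \<Longrightarrow> foldr (\<otimes>) xs \<one> \<in> W"
  shows "span_power R K U n \<subseteq> W"
  unfolding span_power_def using assms by (intro hull_minimal) auto

text \<open>Since these elements form a subspace, an inclusion of products needs checking on a
  spanning set only; the next lemma does the same for the other factor.\<close>

lemma subalgebra_vimage_lmult: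
  assumes "subalgebra K W R" "u \<in> carrier R"
  shows "subalgebra K {p \<in> carrier R. u \<otimes> p \<in> W} R"
proof (rule subalgebraI')
  note W = subalgebraD[OF assms(1)]
  show "c \<otimes> a \<in> {p \<in> carrier R. u \<otimes> p \<in> W}" if "c \<in> K" "a \<in> {p \<in> carrier R. u \<otimes> p \<in> W}" for c a
  proof -
    have c: "c \<in> carrier R" using that K_subset by auto
    have "u \<otimes> (c \<otimes> a) = (u \<otimes> c) \<otimes> a" using that c assms(2) by (simp add: m_assoc)
    also have "u \<otimes> c = c \<otimes> u" using central_K[OF that(1) assms(2)] by simp
    finally show ?thesis using that c assms(2) W(4) by (auto simp: m_assoc)
  qed
qed (use assms subalgebraD[OF assms(1)] in \<open>auto simp: r_distr\<close>)

lemma subalgebra_vimage_rmult: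
  assumes "subalgebra K W R" "P \<subseteq> carrier R"
  shows "subalgebra K {u \<in> carrier R. \<forall>p\<in>P. u \<otimes> p \<in> W} R"
proof (rule subalgebraI')
  note W = subalgebraD[OF assms(1)]
  show "c \<otimes> a \<in> {u \<in> carrier R. \<forall>p\<in>P. u \<otimes> p \<in> W}" if "c \<in> K" "a \<in> {u \<in> carrier R. \<forall>p\<in>P. u \<otimes> p \<in> W}" for c a
    using that assms(2) W(4) K_subset by (auto simp: m_assoc subset_iff)
qed (use assms subalgebraD[OF assms(1)] in \<open>auto simp: l_distr subset_iff\<close>)

lemma span_power_mult:
  assumes "U \<subseteq> carrier R" "u \<in> U" "p \<in> span_power R K U n"
  shows "u \<otimes> p \<in> span_power R K U (Suc n)"
proof -
  have u: "u \<in> carrier R" using assms by auto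
  have "span_power R K U n \<subseteq> {p \<in> carrier R. u \<otimes> p \<in> span_power R K U (Suc n)}"
  proof (rule span_power_least[OF subalgebra_vimage_lmult[OF subalgebra_span_power[OF assms(1)] u]])
    fix xs assume xs: "length xs = n" "set xs \<subseteq> U"
    then have "foldr (\<otimes>) (u # xs) \<one> \<in> span_power R K U (Suc n)"
      using assms(2) by (intro product_in_span_power) auto
    then show "foldr (\<otimes>) xs \<one> \<in> {p \<in> carrier R. u \<otimes> p \<in> span_power R K U (Suc n)}"
      using foldr_mult_closed xs assms(1) by auto
  qed
  then show ?thesis using assms(3) by auto
qed

text \<open>For a finite basis \<open>Us\<close> of \<open>U\<close>, the power \<open>n + 1\<close>
  lies in the sum of the translates of the power \<open>n\<close> by \<open>Us\<close>.\<close>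

lemma finite_dimension_span_power:
  assumes "finite_dimension K U"
  shows "finite_dimension K (span_power R K U n)"
proof (induction n)
  have U: "subalgebra K U R" by (rule finite_dimension_subalgebra[OF assms])
  note Uc = subalgebraD(1)[OF U]
  case 0
  have "span_power R K U 0 \<subseteq> K"
    using finite_dimension_subalgebra[OF finite_dimension_K] by (intro span_power_least) auto
  then show ?case using dim_mono(1)[OF subalgebra_span_power[OF Uc] finite_dimension_K] by simp
next
  have U: "subalgebra K U R" by (rule finite_dimension_subalgebra[OF assms])
  note Uc = subalgebraD(1)[OF U]
  obtain Us where Us: "set Us \<subseteq> carrier R" "Span K Us = U"
    by (rule finite_dimension_base[OF assms])
  case (Suc n)
  let ?P = "span_power R K U n" and ?W = "sum_left_translates R (set Us) (span_power R K U n)"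
  have Pc: "?P \<subseteq> carrier R" and P0: "\<zero> \<in> ?P" using subalgebraD[OF subalgebra_span_power[OF Uc]] by auto
  have W: "finite_dimension K ?W" using Suc Us(1) by (intro finite_dimension_sum_left_translates) auto
  then have Wsub: "subalgebra K ?W R" by (rule finite_dimension_subalgebra)
  have "Span K Us \<subseteq> {u \<in> carrier R. \<forall>p\<in>?P. u \<otimes> p \<in> ?W}"
    using Us(1) translate_in_sum[OF _ Us(1) Pc P0]
    by (intro subalgebra_Span_incl[OF subfield_K subalgebra_vimage_rmult[OF Wsub Pc]]) auto
  then have UP: "u \<otimes> p \<in> ?W" if "u \<in> U" "p \<in> ?P" for u p using that Us(2) by auto
  have "span_power R K U (Suc n) \<subseteq> ?W"
  proof (rule span_power_least[OF Wsub])
    fix xs assume xs: "length xs = Suc n" "set xs \<subseteq> U"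
    then obtain y ys where "xs = y # ys" by (cases xs) auto
    then show "foldr (\<otimes>) xs \<one> \<in> ?W" using UP product_in_span_power[of ys n U] xs by auto
  qed
  then show ?case using dim_mono(1)[OF subalgebra_span_power[OF Uc] W] by simp
qed

end

lemma amenable_finite_GK_tr_deg:
  assumes "skew_field_extension k \<iota> D" "GK_tr_deg k \<iota> D < \<infinity>"
  shows "amenable k \<iota> D"
proof -
  interpret A: central_skew_field D "\<iota> ` carrier k" by (rule skew_field_extension_central[OF assms(1)])
  let ?K = "\<iota> ` carrier k"
  show ?thesis
    unfolding amenable_def
  proof (intro allI impI, elim conjE)
    fix S and \<epsilon> :: real assume S: "finite S" "S \<subseteq> carrier D" and "0 < \<epsilon>"
    obtain Ss where Ss: "set Ss = S" using finite_list[OF S(1)] by auto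
    define V where "V = A.Span ?K (\<one>\<^bsub>D\<^esub> # Ss)"
    have gc: "set (\<one>\<^bsub>D\<^esub> # Ss) \<subseteq> carrier D" using Ss S by auto
    have V: "A.finite_dimension ?K V" unfolding V_def by (rule A.dim_Span_le(1)[OF gc])
    have SV: "S \<subseteq> V" "\<one>\<^bsub>D\<^esub> \<in> V"
      using A.Span_base_incl[OF A.subfield_K gc] Ss by (auto simp: V_def)
    define P where "P r n = span_power D ?K (?K <+>\<^bsub>D\<^esub> (V #>\<^bsub>D\<^esub> r)) n" for r n
    \<comment> \<open>A finite supremum makes the infimum for this particular \<open>V\<close>
      finite, and a finite infimum is witnessed by a single \<open>r\<close>.\<close>
    have "(INF r \<in> carrier D - {\<zero>\<^bsub>D\<^esub>}. limsup (\<lambda>n. ereal (ln (real (A.dim ?K (P r n))) / ln (real n)))) < \<infinity>"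
      using assms(2) V SV unfolding GK_tr_deg_def Let_def P_def
      by (rule_tac le_less_trans[rotated]) (auto intro!: SUP_upper)
    then obtain r where r: "r \<in> carrier D" "r \<noteq> \<zero>\<^bsub>D\<^esub>"
      and lim: "limsup (\<lambda>n. ereal (ln (real (A.dim ?K (P r n))) / ln (real n))) < \<infinity>"
      unfolding INF_less_iff by blast
    then obtain c :: real where "limsup (\<lambda>n. ereal (ln (real (A.dim ?K (P r n))) / ln (real n))) < ereal c"
      using less_PInf_Ex_of_nat[of "limsup (\<lambda>n. ereal (ln (real (A.dim ?K (P r n))) / ln (real n)))"] by auto
    then have ev: "\<forall>\<^sub>F n in sequentially. ln (real (A.dim ?K (P r n))) / ln (real n) < c"
      using Limsup_lessD by fastforce
    define U where "U = ?K <+>\<^bsub>D\<^esub> (V #>\<^bsub>D\<^esub> r)"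
    have U: "A.finite_dimension ?K U"
      unfolding U_def by (rule A.finite_dimension_affine_translate[OF V r(1)])
    note Uc = A.subalgebraD(1)[OF A.finite_dimension_subalgebra[OF U]]
    have Vc: "V \<subseteq> carrier D" using A.subalgebraD(1)[OF A.finite_dimension_subalgebra[OF V]] .
    have Vr: "v \<otimes>\<^bsub>D\<^esub> r \<in> U" if "v \<in> V" for v
    proof -
      have "\<zero>\<^bsub>D\<^esub> \<oplus>\<^bsub>D\<^esub> v \<otimes>\<^bsub>D\<^esub> r \<in> U"
        unfolding U_def by (rule A.affine_translate_mem[OF A.K_zero that])
      moreover have "v \<otimes>\<^bsub>D\<^esub> r \<in> carrier D" using that Vc r by auto
      ultimately show ?thesis by simp
    qed
    \<comment> \<open>The unit is \<open>1 + 0 r\<close>; hence every \<open>P r n\<close> contains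
      it and is nonzero.\<close>
    have oneU: "\<one>\<^bsub>D\<^esub> \<in> U"
    proof -
      have "\<zero>\<^bsub>D\<^esub> \<in> V" using A.subalgebraD(2)[OF A.finite_dimension_subalgebra[OF V]] .
      then have "\<one>\<^bsub>D\<^esub> \<oplus>\<^bsub>D\<^esub> \<zero>\<^bsub>D\<^esub> \<otimes>\<^bsub>D\<^esub> r \<in> U"
        unfolding U_def by (rule A.affine_translate_mem[OF A.K_one])
      then show ?thesis using r by simp
    qed
    have fdP: "A.finite_dimension ?K (P r n)" for n
      unfolding P_def U_def[symmetric] by (rule A.finite_dimension_span_power[OF U])
    have Pc: "P r n \<subseteq> carrier D" for n
      using A.subalgebraD(1)[OF A.finite_dimension_subalgebra[OF fdP]] .
    have one_P: "\<one>\<^bsub>D\<^esub> \<in> P r n" for n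
    proof -
      have "foldr (\<otimes>\<^bsub>D\<^esub>) (replicate n \<one>\<^bsub>D\<^esub>) \<one>\<^bsub>D\<^esub> = \<one>\<^bsub>D\<^esub>" by (induction n) auto
      then show ?thesis
        using A.product_in_span_power[of "replicate n \<one>\<^bsub>D\<^esub>" n U] oneU
        by (auto simp: P_def U_def[symmetric] set_replicate_conv_if split: if_splits)
    qed
    define W where "W n = (\<lambda>p. r \<otimes>\<^bsub>D\<^esub> p) ` P r n" for n
    have lin: "A.linear_on (P r n) (\<lambda>p. r \<otimes>\<^bsub>D\<^esub> p)" for n by (rule A.linear_on_lmult[OF Pc r(1)])
    have fdW: "A.finite_dimension ?K (W n)" for n
      unfolding W_def by (rule A.linear_image_finite_dimension[OF fdP lin])
    have dimW: "A.dim ?K (P r n) = A.dim ?K (W n)" for n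
      unfolding W_def using A.no_zero_divisors r Pc[of n]
      by (intro A.dim_image_inj[OF fdP lin, symmetric]) auto
    have nzW: "W n \<noteq> {\<zero>\<^bsub>D\<^esub>}" for n
    proof -
      have "r \<otimes>\<^bsub>D\<^esub> \<one>\<^bsub>D\<^esub> \<in> W n" unfolding W_def using one_P by blast
      then show ?thesis using r by auto
    qed
    \<comment> \<open>Moving the bracket turns \<open>s r\<close>, an element of \<open>V r\<close>,
      into one further factor from \<open>U\<close>.\<close>
    have step: "s \<otimes>\<^bsub>D\<^esub> v \<in> P r (Suc n)" if sv: "s \<in> S" "v \<in> W n" for s v n
    proof -
      obtain p where p: "p \<in> P r n" "v = r \<otimes>\<^bsub>D\<^esub> p" using sv by (auto simp: W_def)
      have "s \<otimes>\<^bsub>D\<^esub> v = (s \<otimes>\<^bsub>D\<^esub> r) \<otimes>\<^bsub>D\<^esub> p" using p(2) A.m_assoc[of s r p] subsetD[OF S(2) sv(1)] r(1) subsetD[OF Pc p(1)] by simp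
      also have "\<dots> \<in> P r (Suc n)"
        using Vr[of s] SV sv p A.span_power_mult[OF Uc, of "s \<otimes>\<^bsub>D\<^esub> r" p n] by (auto simp: P_def U_def[symmetric])
      finally show ?thesis .
    qed
    have bound: "\<forall>\<^sub>F n in sequentially. ln (real (A.dim ?K (W n))) \<le> 0 + c * ln (real n)"
      using ev eventually_gt_at_top[of 1]
    proof eventually_elim
      case (elim n)
      then have "0 < ln (real n)" by simp
      then show ?case using elim by (simp add: dimW divide_less_eq)
    qed
    show "\<exists>V. A.finite_dimension ?K V \<and> V \<noteq> {\<zero>\<^bsub>D\<^esub>} \<and>
        real (A.dim ?K (sum_left_translates D S V)) / real (A.dim ?K V) < 1 + \<epsilon>"
      by (rule A.almost_invariant_of_growth[OF fdW nzW fdP dimW S step bound \<open>0 < \<epsilon>\<close>])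
  qed
qed

section \<open>Sub-skew-fields\<close>

lemma (in ring) independent_consistent:
  assumes "subring L R"
  shows "ring.independent (R\<lparr>carrier := L\<rparr>) K Us \<longleftrightarrow> independent K Us \<and> set Us \<subseteq> L"
proof -
  interpret L: ring "R\<lparr>carrier := L\<rparr>" by (rule subring_is_ring[OF assms])
  note Span = Span_consistent[OF assms]
  have "L.independent K Us \<Longrightarrow> independent K Us \<and> set Us \<subseteq> L"
    by (induction rule: L.independent.induct) (use subringE(1)[OF assms] Span in \<open>auto intro: independent.intros\<close>)
  moreover have "independent K Us \<Longrightarrow> set Us \<subseteq> L \<Longrightarrow> L.independent K Us"
    by (induction rule: independent.induct) (use Span in \<open>auto intro: L.independent.intros\<close>)
  ultimately show ?thesis by blast
qed

lemma (in ring) Span_mono_scalars: "K \<subseteq> L \<Longrightarrow> Span K us \<subseteq> Span L us"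
proof (induction us)
  case (Cons u us)
  have "line_extension K u E \<subseteq> line_extension L u E'" if "E \<subseteq> E'" for E E'
    using that Cons.prems unfolding subset_iff line_extension_mem_iff by blast
  with Cons show ?case by simp
qed simp

context central_algebra
begin

text \<open>Amenability and the transcendence degree of a sub-skew-field refer to the restricted
  record, so its dimensions have to be compared with those in \<open>R\<close>.\<close>

lemma dimension_consistent:
  assumes "subring L R" "K \<subseteq> L"
  shows "ring.dimension (R\<lparr>carrier := L\<rparr>) n K V \<longleftrightarrow> dimension n K V \<and> V \<subseteq> L"
proof -
  interpret L: ring "R\<lparr>carrier := L\<rparr>" by (rule subring_is_ring[OF assms(1)])
  note L = subringE[OF assms(1)]
  have "L.dimension n K V \<Longrightarrow> K \<subseteq> L \<Longrightarrow> dimension n K V \<and> V \<subseteq> L"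
  proof (induction rule: L.dimension.induct)
    case zero_dim
    then show ?case using L by (auto intro: dimension.intros)
  next
    case (Suc_dim v E n K)
    then have "L.line_extension K v E \<subseteq> L" using L.line_extension_in_carrier[of K v E] by auto
    then show ?case
      using Suc_dim L(1) line_extension_consistent[OF assms(1)] by (auto intro!: dimension.intros)
  qed
  moreover have "L.dimension n K V" if V: "dimension n K V" "V \<subseteq> L"
  proof -
    obtain Vs where Vs: "set Vs \<subseteq> carrier R" "independent K Vs" "length Vs = n" "Span K Vs = V"
      using exists_base[OF subfield_K V(1)] by blast
    then have "set Vs \<subseteq> L" using V(2) Span_base_incl[OF subfield_K Vs(1)] by auto
    then have "L.independent K Vs" using independent_consistent[OF assms(1)] Vs(2) by simp
    from L.dimension_independent[OF this] show ?thesis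
      using Vs Span_consistent[OF assms(1)] by simp
  qed
  ultimately show ?thesis using assms(2) by blast
qed

lemma finite_dimension_consistent:
  assumes "subring L R" "K \<subseteq> L"
  shows "ring.finite_dimension (R\<lparr>carrier := L\<rparr>) K V \<longleftrightarrow> finite_dimension K V \<and> V \<subseteq> L"
  using dimension_consistent[OF assms] ring.finite_dimension_def[OF subring_is_ring[OF assms(1)]]
  by (auto simp: finite_dimension_def)

lemma dim_consistent:
  assumes "subring L R" "K \<subseteq> L" "V \<subseteq> L"
  shows "ring.dim (R\<lparr>carrier := L\<rparr>) K V = dim K V"
  using dimension_consistent[OF assms(1,2)] ring.dim_def[OF subring_is_ring[OF assms(1)]] assms(3)
  by (simp add: dim_def)

lemma finsum_consistent:
  assumes "subring L R" "finite S" "f \<in> S \<rightarrow> L"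
  shows "finsum (R\<lparr>carrier := L\<rparr>) f S = (\<Oplus>s\<in>S. f s)"
  using assms(2,3)
proof (induction S)
  interpret L: ring "R\<lparr>carrier := L\<rparr>" by (rule subring_is_ring[OF assms(1)])
  note L = subringE[OF assms(1)]
  case empty
  show ?case by simp
next
  interpret L: ring "R\<lparr>carrier := L\<rparr>" by (rule subring_is_ring[OF assms(1)])
  note L = subringE[OF assms(1)]
  case (insert s S)
  have "finsum (R\<lparr>carrier := L\<rparr>) f (insert s S) = f s \<oplus> finsum (R\<lparr>carrier := L\<rparr>) f S"
    using insert by (subst L.finsum_insert) auto
  moreover have "(\<Oplus>s\<in>insert s S. f s) = f s \<oplus> (\<Oplus>s\<in>S. f s)"
    using insert L(1) by (subst finsum_insert) auto
  ultimately show ?case using insert by auto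
qed

lemma sum_left_translates_consistent:
  assumes "subring L R" "finite S" "S \<subseteq> L" "V \<subseteq> L"
  shows "sum_left_translates (R\<lparr>carrier := L\<rparr>) S V = sum_left_translates R S V"
proof -
  have "finsum (R\<lparr>carrier := L\<rparr>) (\<lambda>s. s \<otimes> v s) S = (\<Oplus>s\<in>S. s \<otimes> v s)" if "v \<in> S \<rightarrow> V" for v
    using assms that subringE(6)[OF assms(1)] by (intro finsum_consistent) (auto simp: Pi_def subset_iff)
  then show ?thesis unfolding sum_left_translates_def by auto metis+
qed

text \<open>\<open>L\<close> is noncommutative in the application, so \<open>Span L vs\<close> is
  the left module generated by \<open>vs\<close> rather than a vector space over a subfield.\<close>

lemma left_span_props:
  assumes "subring L R" "set vs \<subseteq> carrier R"
  shows "Span L vs \<subseteq> carrier R \<and> \<zero> \<in> Span L vs \<and>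
    (\<forall>x\<in>Span L vs. \<forall>y\<in>Span L vs. x \<oplus> y \<in> Span L vs) \<and>
    (\<forall>c\<in>L. \<forall>x\<in>Span L vs. c \<otimes> x \<in> Span L vs)"
  using assms(2)
proof (induction vs)
  case Nil
  then show ?case using subringE(1)[OF assms(1)] by (auto simp: Span.simps)
next
  case (Cons v vs)
  note L = subringE[OF assms(1)]
  have v: "v \<in> carrier R" using Cons by auto
  note IH = Cons.IH[OF subset_trans[OF set_subset_Cons Cons.prems]]
  have mem: "x \<in> Span L (v # vs) \<longleftrightarrow> (\<exists>c\<in>L. \<exists>w\<in>Span L vs. x = c \<otimes> v \<oplus> w)" for x
    by (simp add: Span.simps line_extension_mem_iff)
  have Lc: "c \<in> L \<Longrightarrow> c \<in> carrier R" for c using L(1) by auto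
  have Wc: "w \<in> Span L vs \<Longrightarrow> w \<in> carrier R" for w using IH by auto
  have "Span L (v # vs) \<subseteq> carrier R" using mem Lc Wc v by auto
  moreover have "\<zero> \<in> Span L (v # vs)"
    unfolding mem using L(2) IH v by (intro bexI[of _ \<zero>]) auto
  moreover have "x \<oplus> y \<in> Span L (v # vs)" if xy: "x \<in> Span L (v # vs)" "y \<in> Span L (v # vs)" for x y
  proof -
    obtain c w c' w' where *: "c \<in> L" "c' \<in> L" "w \<in> Span L vs" "w' \<in> Span L vs"
      "x = c \<otimes> v \<oplus> w" "y = c' \<otimes> v \<oplus> w'" using xy unfolding mem by blast
    then have "x \<oplus> y = (c \<oplus> c') \<otimes> v \<oplus> (w \<oplus> w')"
      using v Lc Wc by (simp add: l_distr) (simp add: a_ac)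
    then show ?thesis unfolding mem using * IH L(7) by blast
  qed
  moreover have "c \<otimes> x \<in> Span L (v # vs)" if x: "c \<in> L" "x \<in> Span L (v # vs)" for c x
  proof -
    obtain c' w where *: "c' \<in> L" "w \<in> Span L vs" "x = c' \<otimes> v \<oplus> w" using x unfolding mem by blast
    then have "c \<otimes> x = (c \<otimes> c') \<otimes> v \<oplus> c \<otimes> w"
      using v Lc Wc x by (simp add: r_distr m_assoc)
    then show ?thesis unfolding mem using * IH L(6) x by blast
  qed
  ultimately show ?case by blast
qed

end

section \<open>Passing almost invariant subspaces to a sub-skew-field\<close>

text \<open>Cross-multiplied form of \<open>u / d \<le> x / a \<le> c / s\<close>.\<close>

lemma ratio_le_trans:
  fixes a d s u x c :: nat
  assumes "u * a \<le> x * d" "x * s \<le> c * a" "0 < a"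
  shows "u * s \<le> c * d"
proof -
  have "a * (u * s) = (u * a) * s" by (simp only: mult_ac)
  also have "\<dots> \<le> (x * d) * s" by (rule mult_right_mono[OF assms(1)]) simp
  also have "\<dots> = (x * s) * d" by (simp only: mult_ac)
  also have "\<dots> \<le> (c * a) * d" by (rule mult_right_mono[OF assms(2)]) simp
  also have "\<dots> = a * (c * d)" by (simp only: mult_ac)
  finally show ?thesis using assms(3) by simp
qed

text \<open>Induction on the number of left lines. The coordinate \<open>f\<close> along
  \<open>L v\<close> maps \<open>V\<close> into \<open>L\<close>, and its kernel lies in the
  remaining lines; the dimensions of \<open>V\<close> and \<open>S V\<close> split accordingly, so
  the kernel or the image has a ratio no larger than that of \<open>V\<close>.\<close>

lemma (in central_skew_field) almost_invariant_in_sub_skew_field: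
  assumes L: "sub_skew_field L R" "K \<subseteq> L" and S: "finite S" "S \<subseteq> L"
    and V: "finite_dimension K V" "V \<noteq> {\<zero>}" "V \<subseteq> Span L vs" and vs: "set vs \<subseteq> carrier R"
  shows "\<exists>U. finite_dimension K U \<and> U \<noteq> {\<zero>} \<and> U \<subseteq> L \<and>
    dim K (sum_left_translates R S U) * dim K V \<le> dim K (sum_left_translates R S V) * dim K U"
  using V vs
proof (induction vs arbitrary: V)
  case Nil
  then have "V \<subseteq> {\<zero>}" by (simp add: Span.simps)
  then show ?case using subalgebraD(2)[OF finite_dimension_subalgebra[OF Nil(1)]] Nil by auto
next
  case (Cons v vs)
  let ?T = "sum_left_translates R S"
  have subL: "subring L R" using L by (simp add: sub_skew_field_def)
  note Lp = subringE[OF subL]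
  have Lc: "c \<in> L \<Longrightarrow> c \<in> carrier R" for c using Lp(1) by auto
  have Sc: "S \<subseteq> carrier R" using S Lp(1) by auto
  have v: "v \<in> carrier R" and vs: "set vs \<subseteq> carrier R" using Cons.prems by auto
  have props: "Span L vs \<subseteq> carrier R" "\<zero> \<in> Span L vs"
    "\<And>x y. x \<in> Span L vs \<Longrightarrow> y \<in> Span L vs \<Longrightarrow> x \<oplus> y \<in> Span L vs"
    "\<And>c x. c \<in> L \<Longrightarrow> x \<in> Span L vs \<Longrightarrow> c \<otimes> x \<in> Span L vs"
    using left_span_props[OF subL vs] by auto
  have Wc: "w \<in> Span L vs \<Longrightarrow> w \<in> carrier R" for w using props(1) by auto
  have props': "\<And>c x. c \<in> L \<Longrightarrow> x \<in> Span L (v # vs) \<Longrightarrow> c \<otimes> x \<in> Span L (v # vs)"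
    "\<And>x y. x \<in> Span L (v # vs) \<Longrightarrow> y \<in> Span L (v # vs) \<Longrightarrow> x \<oplus> y \<in> Span L (v # vs)"
    "Span L (v # vs) \<subseteq> carrier R"
    using left_span_props[OF subL, of "v # vs"] Cons.prems by auto
  have mem: "x \<in> Span L (v # vs) \<longleftrightarrow> (\<exists>c\<in>L. \<exists>w\<in>Span L vs. x = c \<otimes> v \<oplus> w)" for x
    by (simp add: Span.simps line_extension_mem_iff)
  have minus: "\<ominus> w \<in> Span L vs" if "w \<in> Span L vs" for w
  proof -
    have "(\<ominus> \<one>) \<otimes> w \<in> Span L vs" using props(4) that Lp by auto
    then show ?thesis using Wc[OF that] by (simp add: l_minus)
  qed
  show ?case
  proof (cases "v \<in> Span L vs")
    case True
    have "Span L (v # vs) \<subseteq> Span L vs" using True props unfolding mem subset_iff by blast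
    then show ?thesis using Cons.IH[of V] Cons.prems vs by auto
  next
    case False
    \<comment> \<open>Two coordinates with difference \<open>a \<noteq> \<zero>\<close> would put
      \<open>a v\<close>, and after division by \<open>a\<close> in the skew field \<open>L\<close>
      also \<open>v\<close>, into the span of \<open>vs\<close>.\<close>
    have uniq: "c = c'" if eq: "c \<otimes> v \<oplus> w = c' \<otimes> v \<oplus> w'" and
      cw: "c \<in> L" "c' \<in> L" "w \<in> Span L vs" "w' \<in> Span L vs" for c c' w w'
    proof (rule ccontr)
      assume "c \<noteq> c'"
      define a where "a = c \<ominus> c'"
      have a: "a \<in> L" "a \<noteq> \<zero>" "a \<in> carrier R"
        using cw \<open>c \<noteq> c'\<close> Lp Lc by (auto simp: a_def a_minus_def r_right_minus_eq[unfolded a_minus_def])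
      have "a \<otimes> v = w' \<oplus> (\<ominus> w)"
      proof -
        have "a \<otimes> v = (c \<otimes> v \<oplus> w) \<oplus> (\<ominus> (c' \<otimes> v) \<oplus> \<ominus> w)"
          using cw Lc Wc v by (simp add: a_def a_minus_def l_distr l_minus a_ac r_neg1 r_neg2)
        also have "\<dots> = (c' \<otimes> v \<oplus> w') \<oplus> (\<ominus> (c' \<otimes> v) \<oplus> \<ominus> w)" using eq by simp
        also have "\<dots> = w' \<oplus> (\<ominus> w)"
          using cw Lc Wc v by (simp add: a_ac r_neg r_neg1 r_neg2)
        finally show ?thesis .
      qed
      also have "\<dots> \<in> Span L vs" using cw props minus by auto
      finally have 1: "a \<otimes> v \<in> Span L vs" .
      have "Units (R\<lparr>carrier := L\<rparr>) = L - {\<zero>}"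
        using L(1) by (auto simp: sub_skew_field_def skew_field_def skew_field_axioms_def)
      then have "a \<in> Units (R\<lparr>carrier := L\<rparr>)" using a by auto
      then obtain b where b: "b \<in> L" "b \<otimes> a = \<one>" by (auto simp: Units_def)
      then have "b \<otimes> (a \<otimes> v) \<in> Span L vs" using props(4) 1 by blast
      then show False using False a v b Lc by (simp flip: m_assoc)
    qed
    have "\<forall>x\<in>Span L (v # vs). \<exists>c. c \<in> L \<and> (\<exists>w\<in>Span L vs. x = c \<otimes> v \<oplus> w)" using mem by blast
    then obtain f where f: "\<And>x. x \<in> Span L (v # vs) \<Longrightarrow> f x \<in> L \<and> (\<exists>w\<in>Span L vs. x = f x \<otimes> v \<oplus> w)"
      by metis
    have feq: "f x = c" if "x = c \<otimes> v \<oplus> w" "c \<in> L" "w \<in> Span L vs" for x c w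
    proof -
      have "x \<in> Span L (v # vs)" unfolding mem using that by blast
      then obtain w' where "f x \<in> L" "w' \<in> Span L vs" "x = f x \<otimes> v \<oplus> w'" using f by blast
      then show ?thesis using uniq[of "f x" w' c w] that by simp
    qed
    \<comment> \<open>Left linearity over all of \<open>L\<close>, not just over \<open>K\<close>,
      makes \<open>f\<close> commute with multiplication by elements of \<open>S\<close>.\<close>
    have fL: "f (c \<otimes> x) = c \<otimes> f x" if "c \<in> L" and x: "x \<in> Span L (v # vs)" for c x
    proof -
      obtain w where w: "f x \<in> L" "w \<in> Span L vs" "x = f x \<otimes> v \<oplus> w" using f[OF x] by blast
      have "c \<otimes> x = c \<otimes> (f x \<otimes> v \<oplus> w)" by (rule arg_cong[OF w(3)])
      also have "\<dots> = (c \<otimes> f x) \<otimes> v \<oplus> c \<otimes> w" using that(1) w(1,2) Lc Wc v by (simp add: r_distr m_assoc)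
      finally show ?thesis by (rule feq) (use that(1) w(1,2) props(4) Lp(6) in auto)
    qed
    have fadd: "f (x \<oplus> y) = f x \<oplus> f y" if x: "x \<in> Span L (v # vs)" and y: "y \<in> Span L (v # vs)" for x y
    proof -
      obtain w w' where w: "f x \<in> L" "w \<in> Span L vs" "x = f x \<otimes> v \<oplus> w" "f y \<in> L" "w' \<in> Span L vs" "y = f y \<otimes> v \<oplus> w'"
        using f[OF x] f[OF y] by blast
      have "x \<oplus> y = (f x \<otimes> v \<oplus> w) \<oplus> (f y \<otimes> v \<oplus> w')" by (rule arg_cong2[OF w(3,6)])
      also have "\<dots> = (f x \<oplus> f y) \<otimes> v \<oplus> (w \<oplus> w')" using w(1,2,4,5) Lc Wc v by (simp add: l_distr a_ac)
      finally show ?thesis by (rule feq) (use w(1,2,4,5) props(3) Lp(7) in auto)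
    qed
    have lin: "linear_on (Span L (v # vs)) f"
      unfolding linear_on_def using f fL fadd Lc L(2) by auto
    have Vsub: "V \<subseteq> Span L (v # vs)" by (rule Cons.prems(3))
    have Valg: "subalgebra K V R" by (rule finite_dimension_subalgebra[OF Cons.prems(1)])
    note Vp = subalgebraD[OF Valg]
    have SV: "finite_dimension K (?T V)" by (rule finite_dimension_sum_left_translates[OF S(1) Sc Cons.prems(1)])
    have big: "subalgebra K (Span L (v # vs)) R"
      using left_span_props[OF subL, of "v # vs"] Cons.prems(4) L(2) by (intro subalgebraI') auto
    have small: "subalgebra K (Span L vs) R"
      using props L(2) by (intro subalgebraI') auto
    have SVsub: "?T V \<subseteq> Span L (v # vs)"
      by (rule sum_left_translates_least[OF big S(1)]) (use props'(1) S(2) Vsub in blast)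
    define N where "N = {x \<in> V. f x = \<zero>}"
    have linV: "linear_on V f" by (rule linear_on_subset[OF lin Vsub])
    have linSV: "linear_on (?T V) f" by (rule linear_on_subset[OF lin SVsub])
    note rnV = rank_nullity[OF Cons.prems(1) linV, folded N_def]
    note rnSV = rank_nullity[OF SV linSV]
    have Nsub: "N \<subseteq> Span L vs"
    proof
      fix x assume x: "x \<in> N"
      then have xV: "x \<in> Span L (v # vs)" and fx: "f x = \<zero>" using Vsub unfolding N_def by blast+
      obtain w where w: "w \<in> Span L vs" "x = f x \<otimes> v \<oplus> w" using f[OF xV] by blast
      then have "x = w" using v Wc[OF w(1)] unfolding fx by simp
      then show "x \<in> Span L vs" using w(1) by simp
    qed
    have fV: "finite_dimension K (f ` V)" by (rule linear_image_finite_dimension[OF Cons.prems(1) linV])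
    have fVL: "f ` V \<subseteq> L" using f Vsub by blast
    \<comment> \<open>By \<open>f (s x) = s (f x)\<close>, translates of the kernel stay in the
      kernel of \<open>f\<close> on \<open>S V\<close>; \<open>dims2\<close> is the corresponding
      statement for images.\<close>
    have dims1: "dim K (?T N) \<le> dim K {x \<in> ?T V. f x = \<zero>}"
    proof (rule dim_mono(2))
      show "subalgebra K (?T N) R" by (rule subalgebra_sum_left_translates[OF S(1) Sc finite_dimension_subalgebra[OF rnV(1)]])
      have "s \<otimes> x \<in> {x \<in> ?T V. f x = \<zero>}" if s: "s \<in> S" and x: "x \<in> N" for s x
      proof -
        have "s \<otimes> x \<in> ?T V" using translate_in_sum[OF S(1) Sc Vp(1,2) s] x by (auto simp: N_def)
        moreover have "f (s \<otimes> x) = s \<otimes> f x" using s x S(2) Vsub unfolding N_def by (intro fL) blast+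
        ultimately show ?thesis using x s Sc by (auto simp: N_def)
      qed
      then show "?T N \<subseteq> {x \<in> ?T V. f x = \<zero>}"
        by (rule sum_left_translates_least[OF finite_dimension_subalgebra[OF rnSV(1)] S(1)])
    qed (rule rnSV(1))
    have dims2: "dim K (?T (f ` V)) \<le> dim K (f ` ?T V)"
    proof (rule dim_mono(2))
      show "subalgebra K (?T (f ` V)) R" by (rule subalgebra_sum_left_translates[OF S(1) Sc finite_dimension_subalgebra[OF fV]])
      show fd: "finite_dimension K (f ` ?T V)" by (rule linear_image_finite_dimension[OF SV linSV])
      have "s \<otimes> y \<in> f ` ?T V" if s: "s \<in> S" and y: "y \<in> f ` V" for s y
      proof -
        obtain x where x: "x \<in> V" "y = f x" using y by auto
        have "s \<otimes> x \<in> ?T V" by (rule translate_in_sum[OF S(1) Sc Vp(1,2) s x(1)])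
        moreover have "f (s \<otimes> x) = s \<otimes> y" unfolding x(2) using s x(1) S(2) Vsub by (intro fL) blast+
        ultimately show ?thesis by (metis imageI)
      qed
      then show "?T (f ` V) \<subseteq> f ` ?T V"
        by (rule sum_left_translates_least[OF finite_dimension_subalgebra[OF fd] S(1)])
    qed
    let ?a = "dim K N" and ?b = "dim K (f ` V)" and ?x = "dim K (?T N)" and ?y = "dim K (?T (f ` V))" and ?c = "dim K (?T V)"
    have c: "?x + ?y \<le> ?c" using dims1 dims2 rnSV(2) by linarith
    show ?thesis
    \<comment> \<open>If the image of \<open>V\<close> in \<open>L\<close> is zero or has too large
      a ratio, the kernel must have a small one: \<open>dim (S V)\<close> is at least the sum of the
      two numerators, and \<open>dim V\<close> equals the sum of the denominators.\<close>
    proof (cases "?y * dim K V \<le> ?c * ?b \<and> f ` V \<noteq> {\<zero>}")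
      case True
      then show ?thesis using fV fVL by blast
    next
      case False
      have N0: "N \<noteq> {\<zero>}"
      proof
        assume "N = {\<zero>}"
        then have "?a = 0" using dimI'[OF zero_dim] by simp
        moreover from this have "f ` V \<noteq> {\<zero>}"
          using dimI'[OF zero_dim] rnV(2) dim_pos[OF Cons.prems(1,2)] by auto
        ultimately show False using False c rnV(2) by auto
      qed
      then obtain U where U: "finite_dimension K U" "U \<noteq> {\<zero>}" "U \<subseteq> L"
        "dim K (?T U) * ?a \<le> ?x * dim K U"
        using Cons.IH[OF rnV(1) N0 Nsub vs] by blast
      have "?x * (?a + ?b) \<le> ?c * ?a"
      proof (cases "f ` V = {\<zero>}")
        case True
        then have "?b = 0" using dimI'[OF zero_dim] by simp
        then show ?thesis using c by auto
      next
        case f: False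
        then have "?c * ?b < ?y * (?a + ?b)" using False rnV(2) by auto
        moreover have "(?x + ?y) * ?b \<le> ?c * ?b" using c by simp
        ultimately have "?x * ?b \<le> ?y * ?a" by (simp add: algebra_simps)
        then have "?x * (?a + ?b) \<le> (?x + ?y) * ?a" by (simp add: algebra_simps)
        also have "\<dots> \<le> ?c * ?a" using c by simp
        finally show ?thesis .
      qed
      then have "dim K (?T U) * (?a + ?b) \<le> ?c * dim K U"
        by (rule ratio_le_trans[OF U(4) _ dim_pos[OF rnV(1) N0]])
      then have "dim K (?T U) * dim K V \<le> ?c * dim K U" using rnV(2) by simp
      then show ?thesis using U by blast
    qed
  qed
qed

lemma amenable_sub_skew_field:
  assumes "skew_field_extension k \<iota> E" "sub_skew_field D E" "\<iota> ` carrier k \<subseteq> D" "amenable k \<iota> E"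
  shows "amenable k \<iota> (E\<lparr>carrier := D\<rparr>)"
proof -
  interpret A: central_skew_field E "\<iota> ` carrier k" by (rule skew_field_extension_central[OF assms(1)])
  let ?K = "\<iota> ` carrier k"
  have sub: "subring D E" using assms(2) by (simp add: sub_skew_field_def)
  have Dc: "D \<subseteq> carrier E" using subringE(1)[OF sub] .
  show ?thesis
    unfolding amenable_def
  proof (intro allI impI, elim conjE)
    fix S and \<epsilon> :: real assume S: "finite S" "S \<subseteq> carrier (E\<lparr>carrier := D\<rparr>)" and "0 < \<epsilon>"
    have SD: "S \<subseteq> D" using S by simp
    then obtain V where V: "A.finite_dimension ?K V" "V \<noteq> {\<zero>\<^bsub>E\<^esub>}"
      "real (A.dim ?K (sum_left_translates E S V)) / real (A.dim ?K V) < 1 + \<epsilon>"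
      using assms(4) S(1) \<open>0 < \<epsilon>\<close> Dc unfolding amenable_def by (meson subset_trans)
    obtain vs where vs: "set vs \<subseteq> carrier E" "A.Span ?K vs = V"
      by (rule A.finite_dimension_base[OF V(1)])
    \<comment> \<open>A finite list spanning \<open>V\<close> over \<open>k\<close> generates
      finitely many left lines over \<open>D\<close> whose sum contains \<open>V\<close>.\<close>
    have "A.Span ?K vs \<subseteq> A.Span D vs" by (rule A.Span_mono_scalars[OF assms(3)])
    then obtain U where U: "A.finite_dimension ?K U" "U \<noteq> {\<zero>\<^bsub>E\<^esub>}" "U \<subseteq> D" and
      le: "A.dim ?K (sum_left_translates E S U) * A.dim ?K V \<le> A.dim ?K (sum_left_translates E S V) * A.dim ?K U"
      using A.almost_invariant_in_sub_skew_field[OF assms(2,3) S(1) SD V(1,2) _ vs(1)] vs(2) by auto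
    have pos: "0 < A.dim ?K U" "0 < A.dim ?K V" using A.dim_pos U V by auto
    have "real (A.dim ?K (sum_left_translates E S U)) / real (A.dim ?K U)
        \<le> real (A.dim ?K (sum_left_translates E S V)) / real (A.dim ?K V)"
      using le pos by (simp add: field_simps flip: of_nat_mult)
    also note V(3)
    finally have "real (A.dim ?K (sum_left_translates E S U)) / real (A.dim ?K U) < 1 + \<epsilon>" .
    moreover have "sum_left_translates E S U \<subseteq> D"
    proof -
      have "subalgebra ?K D E" using subringE[OF sub] assms(3) by (intro A.subalgebraI') (auto simp: subset_iff)
      then show ?thesis using subringE(6)[OF sub] SD U(3) by (intro A.sum_left_translates_least S) auto
    qed
    ultimately show "\<exists>V. ring.finite_dimension (E\<lparr>carrier := D\<rparr>) ?K V \<and> V \<noteq> {\<zero>\<^bsub>E\<lparr>carrier := D\<rparr>\<^esub>} \<and>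
        real (ring.dim (E\<lparr>carrier := D\<rparr>) ?K (sum_left_translates (E\<lparr>carrier := D\<rparr>) S V))
          / real (ring.dim (E\<lparr>carrier := D\<rparr>) ?K V) < 1 + \<epsilon>"
      using U A.finite_dimension_consistent[OF sub assms(3)] A.dim_consistent[OF sub assms(3)]
        A.sum_left_translates_consistent[OF sub S(1) SD U(3)]
      by (intro exI[of _ U]) auto
  qed
qed

section \<open>Reduced factorisations over the free algebra\<close>

text \<open>Recursion on the first letter, \<open>\<lambda>v. f (a # v)\<close> being the left
  quotient of \<open>f\<close> by \<open>a\<close>; it makes associativity an induction on the
  word.\<close>

primrec word_mult :: "('x list \<Rightarrow> 'a::field) \<Rightarrow> ('x list \<Rightarrow> 'a) \<Rightarrow> 'x list \<Rightarrow> 'a" where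
  "word_mult f g [] = f [] * g []"
| "word_mult f g (a # w) = f [] * g (a # w) + word_mult (\<lambda>v. f (a # v)) g w"

lemma word_mult_eq_sum: "word_mult f g w = (\<Sum>i\<le>length w. f (take i w) * g (drop i w))"
proof (induction w arbitrary: f)
  case (Cons a w)
  show ?case by (simp add: Cons sum.atMost_Suc_shift del: sum.atMost_Suc)
qed simp

lemma word_mult_add_left: "word_mult (\<lambda>v. f v + f' v) g w = word_mult f g w + word_mult f' g w"
  and word_mult_add_right: "word_mult f (\<lambda>v. g v + g' v) w = word_mult f g w + word_mult f g' w"
  and word_mult_diff_left: "word_mult (\<lambda>v. f v - f' v) g w = word_mult f g w - word_mult f' g w"
  and word_mult_scale_left: "word_mult (\<lambda>v. c * f v) g w = c * word_mult f g w"
  by (simp_all add: word_mult_eq_sum algebra_simps sum.distrib sum_subtractf sum_distrib_left)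

lemma word_mult_zero_left [simp]: "word_mult (\<lambda>v. 0) g w = 0"
  and word_mult_zero_right [simp]: "word_mult f (\<lambda>v. 0) w = 0"
  by (simp_all add: word_mult_eq_sum)

lemma word_mult_sum_left: "word_mult (\<lambda>v. \<Sum>l\<in>L. f' l v) g w = (\<Sum>l\<in>L. word_mult (f' l) g w)"
  and word_mult_sum_right: "word_mult f (\<lambda>v. \<Sum>l\<in>L. g' l v) w = (\<Sum>l\<in>L. word_mult f (g' l) w)"
  by (simp_all add: word_mult_eq_sum sum_distrib_left sum_distrib_right)
    (subst sum.swap, rule refl)+

lemma word_mult_assoc: "word_mult (word_mult f g) h w = word_mult f (word_mult g h) w"
proof (induction w arbitrary: f)
  case (Cons a w)
  have "word_mult (\<lambda>v. word_mult f g (a # v)) h w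
      = f [] * word_mult (\<lambda>v. g (a # v)) h w + word_mult (\<lambda>v. f (a # v)) (word_mult g h) w"
    using Cons by (simp add: word_mult_add_left word_mult_scale_left)
  then show ?case by (simp add: algebra_simps)
qed simp

abbreviation word_const :: "'a \<Rightarrow> 'x list \<Rightarrow> 'a::field" where
  "word_const c \<equiv> (\<lambda>w. if w = [] then c else 0)"

lemma word_mult_const_left: "word_mult (word_const c) g w = c * g w"
  by (cases w) simp_all

lemma word_mult_nonzeroE:
  assumes "word_mult f g w \<noteq> 0"
  obtains i where "i \<le> length w" "f (take i w) \<noteq> 0" "g (drop i w) \<noteq> 0"
proof -
  from assms obtain i where "i \<in> {..length w}" "f (take i w) * g (drop i w) \<noteq> 0"
    unfolding word_mult_eq_sum by (meson sum.not_neutral_contains_not_neutral)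
  then show ?thesis using that by auto
qed

abbreviation finite_support :: "('b \<Rightarrow> 'a::zero) \<Rightarrow> bool" where
  "finite_support f \<equiv> finite {w. f w \<noteq> 0}"

lemma finite_support_subset_sum:
  assumes "finite_support f" "finite_support g" "\<And>w. f w = 0 \<Longrightarrow> g w = 0 \<Longrightarrow> h w = 0"
  shows "finite_support h"
  by (rule finite_subset[OF _ finite_UnI[OF assms(1,2)]]) (use assms(3) in auto)

lemma finite_support_add: "finite_support f \<Longrightarrow> finite_support g \<Longrightarrow> finite_support (\<lambda>w. f w + g w :: 'a::field)"
  by (erule (1) finite_support_subset_sum) simp

lemma finite_support_diff: "finite_support f \<Longrightarrow> finite_support g \<Longrightarrow> finite_support (\<lambda>w. f w - g w :: 'a::field)"
  by (erule (1) finite_support_subset_sum) simp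

lemma finite_support_scale: "finite_support f \<Longrightarrow> finite_support (\<lambda>w. c * f w :: 'a::field)"
  by (erule rev_finite_subset) auto

lemma finite_support_const: "finite_support (word_const c)"
  by (rule finite_subset[of _ "{[]}"]) auto

lemma finite_support_sum:
  "finite L \<Longrightarrow> (\<And>l. l \<in> L \<Longrightarrow> finite_support (f l)) \<Longrightarrow> finite_support (\<lambda>w. \<Sum>l\<in>L. f l w :: 'a::field)"
  by (induction L rule: finite_induct) (auto intro: finite_support_add)

lemma finite_support_word_mult:
  assumes "finite_support f" "finite_support g"
  shows "finite_support (word_mult f g)"
proof (rule finite_subset)
  show "{w. word_mult f g w \<noteq> 0} \<subseteq> (\<lambda>(u, v). u @ v) ` ({w. f w \<noteq> 0} \<times> {w. g w \<noteq> 0})"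
  proof
    fix w assume "w \<in> {w. word_mult f g w \<noteq> 0}"
    then obtain i where "f (take i w) \<noteq> 0" "g (drop i w) \<noteq> 0" by (auto elim: word_mult_nonzeroE)
    then show "w \<in> (\<lambda>(u, v). u @ v) ` ({w. f w \<noteq> 0} \<times> {w. g w \<noteq> 0})"
      by (intro image_eqI[of _ _ "(take i w, drop i w)"]) auto
  qed
qed (use assms in auto)

text \<open>One more than the degree of the row \<open>(d j)\<^bsub>j < n\<^esub>\<close>, and \<open>0\<close> for the zero row.\<close>

definition row_size :: "nat \<Rightarrow> (nat \<Rightarrow> 'x list \<Rightarrow> 'a::field) \<Rightarrow> nat" where
  "row_size n d = (LEAST s. \<forall>j<n. \<forall>w. s \<le> length w \<longrightarrow> d j w = 0)"

lemma finite_support_length_bound: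
  assumes "finite_support (f :: 'x list \<Rightarrow> 'a::field)"
  shows "\<exists>s. \<forall>w. s \<le> length w \<longrightarrow> f w = 0"
proof -
  have "finite (length ` {w. f w \<noteq> 0})" using assms by simp
  then obtain s where "\<forall>x\<in>length ` {w. f w \<noteq> 0}. x < s" using finite_nat_set_iff_bounded by blast
  then show ?thesis by (intro exI[of _ s]) force
qed

lemma row_size_bound_exists:
  fixes d :: "nat \<Rightarrow> 'x list \<Rightarrow> 'a::field"
  assumes "\<And>j. j < n \<Longrightarrow> finite_support (d j)"
  shows "\<exists>s. \<forall>j<n. \<forall>w. s \<le> length w \<longrightarrow> d j w = 0"
proof -
  have "\<forall>j\<in>{..<n}. \<exists>s. \<forall>w. s \<le> length w \<longrightarrow> d j w = 0"
  proof
    fix j assume "j \<in> {..<n}"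
    then have "finite_support (d j)" using assms by simp
    then show "\<exists>s. \<forall>w. s \<le> length w \<longrightarrow> d j w = 0" by (rule finite_support_length_bound)
  qed
  from bchoice[OF this] obtain s where s: "\<And>j w. j < n \<Longrightarrow> s j \<le> length w \<Longrightarrow> d j w = 0" by auto
  have "d j w = 0" if "j < n" "(\<Sum>j<n. s j) \<le> length w" for j w
  proof -
    have "s j \<le> (\<Sum>j<n. s j)" using that by (intro member_le_sum) auto
    then show ?thesis using s that by auto
  qed
  then show ?thesis by blast
qed

lemma row_size_zero:
  assumes "\<And>j. j < n \<Longrightarrow> finite_support (d j)" "j < n" "row_size n d \<le> length w"
  shows "d j w = 0"
proof -
  have "\<forall>j<n. \<forall>w. row_size n d \<le> length w \<longrightarrow> d j w = 0"
    unfolding row_size_def by (rule LeastI_ex[OF row_size_bound_exists[OF assms(1)]])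
  then show ?thesis using assms(2,3) by blast
qed

lemma row_size_le: "(\<And>j w. j < n \<Longrightarrow> s \<le> length w \<Longrightarrow> d j w = 0) \<Longrightarrow> row_size n d \<le> s"
  unfolding row_size_def by (rule Least_le) auto

text \<open>The predictable degree property: in a left combination of degree below \<open>t\<close>,
  every term \<open>c l\<close> times row \<open>l\<close> already has degree below
  \<open>t\<close>, so leading forms cannot cancel. As \<open>row_size\<close> is the degree plus
  one, the bound reads \<open>length w + row_size \<le> t\<close>; zero rows are exempt.\<close>

definition reduced_rows :: "nat \<Rightarrow> nat \<Rightarrow> (nat \<Rightarrow> nat \<Rightarrow> 'x list \<Rightarrow> 'a::field) \<Rightarrow> bool" where
  "reduced_rows m n D \<longleftrightarrow> (\<forall>c t. (\<forall>l<m. finite_support (c l)) \<and>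
      (\<forall>j<n. \<forall>w. t \<le> length w \<longrightarrow> (\<Sum>l<m. word_mult (c l) (D l j) w) = 0) \<longrightarrow>
      (\<forall>l<m. \<forall>w. c l w \<noteq> 0 \<and> row_size n (D l) \<noteq> 0 \<longrightarrow> length w + row_size n (D l) \<le> t))"

text \<open>The weak algorithm: a cancellation among the leading forms of the rows can be divided from
  the left by a word \<open>u\<close> until one of its coefficients becomes a scalar, and then lowers the degree
  of one row.\<close>

lemma not_reduced_rows_imp_smaller:
  fixes D :: "nat \<Rightarrow> nat \<Rightarrow> 'x list \<Rightarrow> 'a::field"
  assumes fsD: "\<And>l j. l < m \<Longrightarrow> j < n \<Longrightarrow> finite_support (D l j)" and "\<not> reduced_rows m n D"
  shows "\<exists>k \<gamma>. k < m \<and> (\<forall>l<m. finite_support (\<gamma> l)) \<and> \<gamma> k = (\<lambda>_. 0) \<and>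
    row_size n (\<lambda>j w. D k j w + (\<Sum>l<m. word_mult (\<gamma> l) (D l j) w)) < row_size n (D k)"
proof -
  let ?s = "\<lambda>l. row_size n (D l)"
  obtain c t where fsc': "\<forall>l<m. finite_support (c l)"
    and van': "\<forall>j<n. \<forall>w. t \<le> length w \<longrightarrow> (\<Sum>l<m. word_mult (c l) (D l j) w) = 0"
    and neg: "\<not> (\<forall>l<m. \<forall>w. c l w \<noteq> 0 \<and> ?s l \<noteq> 0 \<longrightarrow> length w + ?s l \<le> t)"
    using assms(2) unfolding reduced_rows_def by blast
  have fsc: "finite_support (c l)" if "l < m" for l using fsc' that by blast
  have van: "(\<Sum>l<m. word_mult (c l) (D l j) w) = 0" if "j < n" "t \<le> length w" for j w
    using van' that by blast
  obtain l0 w0 where l0: "l0 < m" "c l0 w0 \<noteq> 0" "?s l0 \<noteq> 0" "t < length w0 + ?s l0"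
    using neg by (meson not_le)
  define P where "P = (SIGMA l:{l. l < m \<and> ?s l \<noteq> 0}. {w. c l w \<noteq> 0})"
  have "finite P" unfolding P_def using fsc by (intro finite_SigmaI) auto
  define h where "h = (\<lambda>(l, w::'x list). length w + ?s l)"
  \<comment> \<open>The largest degree of a term, plus one; the violating pair
    \<open>(l0, w0)\<close> shows that it exceeds \<open>t\<close>.\<close>
  define e where "e = Max (h ` P)"
  have P0: "(l0, w0) \<in> P" using l0 by (auto simp: P_def)
  have e_max: "length w + ?s l \<le> e" if "l < m" "?s l \<noteq> 0" "c l w \<noteq> 0" for l w
    unfolding e_def using \<open>finite P\<close> that by (intro Max_ge) (auto simp: P_def h_def image_iff split: prod.splits intro!: bexI[of _ "(l, w)"])
  have "e \<in> h ` P" unfolding e_def using \<open>finite P\<close> P0 by (intro Max_in) auto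
  \<comment> \<open>Among the terms of top degree one with a shortest word \<open>u\<close> is
    chosen, so its row \<open>k\<close> has the largest degree among their rows. Only then can
    multiples of the other rows cancel its leading form.\<close>
  define Q where "Q = {p \<in> P. h p = e}"
  have Q: "finite (length ` snd ` Q)" "Q \<noteq> {}" using \<open>finite P\<close> \<open>e \<in> h ` P\<close> by (auto simp: Q_def)
  then have "Min (length ` snd ` Q) \<in> length ` snd ` Q" by (intro Min_in) auto
  then obtain k u where ku: "(k, u) \<in> Q" "length u = Min (length ` snd ` Q)" by force
  have u_min: "length u \<le> length w" if "(l, w) \<in> Q" for l w
    unfolding ku(2) using Q that by (intro Min_le) force+
  have k: "k < m" "?s k \<noteq> 0" "c k u \<noteq> 0" "length u + ?s k = e"
    using ku(1) by (auto simp: Q_def P_def h_def)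
  define q where "q = ?s k - 1"
  have qk: "?s k = Suc q" using k(2) by (simp add: q_def)
  \<comment> \<open>Left quotients by \<open>u\<close> of the coefficients, normalised by
    \<open>c k u\<close>; the fixed length of \<open>w\<close> keeps only the part that meets the
    leading form of row \<open>l\<close> in degree \<open>q\<close>.\<close>
  define \<gamma> where "\<gamma> = (\<lambda>l w. if l \<noteq> k \<and> ?s l \<noteq> 0 \<and> ?s l \<le> Suc q \<and> length w = Suc q - ?s l
      then c l (u @ w) / c k u else 0)"
  have fs\<gamma>: "finite_support (\<gamma> l)" if "l < m" for l
  proof -
    have "finite ((@) u -` {w. c l w \<noteq> 0})" using fsc[OF that] by (intro finite_vimageI) (auto simp: inj_def)
    then show ?thesis by (rule rev_finite_subset) (auto simp: \<gamma>_def)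
  qed
  have D0: "D l j w = 0" if "l < m" "j < n" "?s l \<le> length w" for l j w
    using row_size_zero[of n "D l" j w] fsD that by auto
  \<comment> \<open>Comparison of coefficients at \<open>u @ v\<close>: in the product for row
    \<open>l\<close> only the splitting after \<open>u @ take i v\<close> with
    \<open>i = Suc q - ?s l\<close> can contribute.\<close>
  have cancel: "c k u * D k j v + (\<Sum>l<m. c k u * word_mult (\<gamma> l) (D l j) v) = 0"
    if v: "length v = q" and j: "j < n" for j v
  proof -
    have termwise: "word_mult (c l) (D l j) (u @ v)
        = (if l = k then c k u * D k j v else c k u * word_mult (\<gamma> l) (D l j) v)" if l: "l < m" for l
    proof (cases "?s l = 0 \<or> ?s l > Suc q")
      case True
      \<comment> \<open>A nonzero contribution of a row longer than row \<open>k\<close> would come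
        from a top-degree term whose word is shorter than \<open>u\<close>.\<close>
      have "word_mult (c l) (D l j) (u @ v) = 0"
      proof (rule ccontr)
        assume "\<not> ?thesis"
        then obtain i where i: "i \<le> length (u @ v)" "c l (take i (u @ v)) \<noteq> 0" "D l j (drop i (u @ v)) \<noteq> 0"
          by (auto elim: word_mult_nonzeroE)
        have lt: "length (drop i (u @ v)) < ?s l" using D0[OF l j] i(3) by (meson not_le)
        then have s: "?s l \<noteq> 0" "Suc q < ?s l" using True by auto
        have le: "length (take i (u @ v)) + ?s l \<le> e" using e_max[OF l s(1) i(2)] .
        have "length (take i (u @ v)) = i" using i(1) by simp
        moreover have "length (drop i (u @ v)) = length u + q - i" using v by simp
        ultimately have "i + ?s l = e" using lt le k(4) qk i(1) v by auto
        then have "(l, take i (u @ v)) \<in> Q" using i s l by (auto simp: Q_def P_def h_def)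
        then have "length u \<le> i" using u_min \<open>length (take i (u @ v)) = i\<close> by fastforce
        then show False using \<open>i + ?s l = e\<close> k(4) qk s(2) by simp
      qed
      moreover have "\<gamma> l = (\<lambda>_. 0)" using True by (auto simp: \<gamma>_def)
      moreover have "l \<noteq> k" using True qk by auto
      ultimately show ?thesis by simp
    next
      case False
      define i where "i = Suc q - ?s l"
      have il: "i \<le> length v" "length (drop i v) + 1 = ?s l" using False v by (auto simp: i_def)
      have "word_mult (c l) (D l j) (u @ v) = (\<Sum>i'\<le>length (u @ v). if i' = length u + i then c l (u @ take i v) * D l j (drop i v) else 0)"
        unfolding word_mult_eq_sum
      proof (intro sum.cong refl)
        fix i' assume i': "i' \<in> {..length (u @ v)}"
        show "c l (take i' (u @ v)) * D l j (drop i' (u @ v))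
          = (if i' = length u + i then c l (u @ take i v) * D l j (drop i v) else 0)"
        proof (cases "i' = length u + i")
          case ne: False
          have "c l (take i' (u @ v)) = 0 \<or> D l j (drop i' (u @ v)) = 0"
          proof (rule ccontr)
            assume nz: "\<not> ?thesis"
            then have "length (drop i' (u @ v)) < ?s l" using D0[OF l j] by (meson not_le)
            moreover have "length (take i' (u @ v)) + ?s l \<le> e" 
            proof (rule e_max[OF l])
              show "?s l \<noteq> 0" using False by simp
              show "c l (take i' (u @ v)) \<noteq> 0" using nz by argo
            qed
            ultimately show False using ne i' il v k(4) qk by auto
          qed
          with ne show ?thesis by auto
        qed simp
      qed
      also have "\<dots> = c l (u @ take i v) * D l j (drop i v)" using il v by (simp add: sum.delta)
      finally have 1: "word_mult (c l) (D l j) (u @ v) = c l (u @ take i v) * D l j (drop i v)" .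
      show ?thesis
      proof (cases "l = k")
        case True
        then have "i = 0" using qk by (simp add: i_def)
        then show ?thesis using 1 True by simp
      next
        case ne: False
        have "word_mult (\<gamma> l) (D l j) v = (\<Sum>i'\<le>length v. if i' = i then \<gamma> l (take i v) * D l j (drop i v) else 0)"
          unfolding word_mult_eq_sum
        proof (intro sum.cong refl)
          fix i' assume "i' \<in> {..length v}"
          then show "\<gamma> l (take i' v) * D l j (drop i' v) = (if i' = i then \<gamma> l (take i v) * D l j (drop i v) else 0)"
            by (auto simp: \<gamma>_def i_def)
        qed
        also have "\<dots> = \<gamma> l (take i v) * D l j (drop i v)" using il by (simp add: sum.delta)
        also have "\<gamma> l (take i v) = c l (u @ take i v) / c k u" using ne False il v by (simp add: \<gamma>_def i_def)
        finally show ?thesis using 1 ne k(3) by simp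
      qed
    qed
    \<comment> \<open>Since \<open>e\<close> exceeds \<open>t\<close>, the word \<open>u @ v\<close>
      of length \<open>e - 1\<close> lies in the range where the whole combination vanishes.\<close>
    have "t \<le> length (u @ v)" using l0 e_max[OF l0(1,3,2)] k(4) qk v by simp
    then have "0 = (\<Sum>l<m. word_mult (c l) (D l j) (u @ v))" using van[OF j] by simp
    also have "\<dots> = (\<Sum>l<m. if l = k then c k u * D k j v else c k u * word_mult (\<gamma> l) (D l j) v)"
      using termwise by (intro sum.cong) auto
    also have "\<dots> = (\<Sum>l<m. (if l = k then c k u * D k j v else 0) + c k u * word_mult (\<gamma> l) (D l j) v)"
    proof (intro sum.cong refl)
      fix l
      have "\<gamma> k = (\<lambda>_. 0)" by (auto simp: \<gamma>_def)
      then show "(if l = k then c k u * D k j v else c k u * word_mult (\<gamma> l) (D l j) v)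
          = (if l = k then c k u * D k j v else 0) + c k u * word_mult (\<gamma> l) (D l j) v" by auto
    qed
    also have "\<dots> = c k u * D k j v + (\<Sum>l<m. c k u * word_mult (\<gamma> l) (D l j) v)"
      using k(1) by (simp add: sum.distrib sum.delta)
    finally show ?thesis by simp
  qed
  have "row_size n (\<lambda>j w. D k j w + (\<Sum>l<m. word_mult (\<gamma> l) (D l j) w)) \<le> q"
  proof (rule row_size_le)
    fix j and v :: "'x list" assume j: "j < n" and v: "q \<le> length v"
    show "D k j v + (\<Sum>l<m. word_mult (\<gamma> l) (D l j) v) = 0"
    proof (cases "length v = q")
      case True
      have "c k u * (D k j v + (\<Sum>l<m. word_mult (\<gamma> l) (D l j) v)) = 0"
        using cancel[OF True j] by (simp add: distrib_left sum_distrib_left)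
      then show ?thesis using k(3) by simp
    next
      case False
      have "word_mult (\<gamma> l) (D l j) v = 0" if l: "l < m" for l
      proof (rule ccontr)
        assume "word_mult (\<gamma> l) (D l j) v \<noteq> 0"
        then obtain i where i: "i \<le> length v" "\<gamma> l (take i v) \<noteq> 0" "D l j (drop i v) \<noteq> 0"
          by (auto elim: word_mult_nonzeroE)
        then have "length (drop i v) < ?s l" using D0[OF l j] by (meson not_le)
        moreover have "i = Suc q - ?s l" "?s l \<le> Suc q" using i by (auto simp: \<gamma>_def split: if_splits)
        ultimately show False using False v i(1) by auto
      qed
      moreover have "D k j v = 0" using D0[OF k(1) j] False v qk by simp
      ultimately show ?thesis by simp
    qed
  qed
  then show ?thesis using k(1) qk fs\<gamma> by (intro exI[of _ k] exI[of _ \<gamma>]) (auto simp: \<gamma>_def)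
qed

text \<open>Adding \<open>\<gamma>\<close> times the other rows to row \<open>k\<close> is an
  elementary operation on \<open>D\<close>, compensated by a column operation on \<open>C\<close>;
  the product is unchanged and the total row size drops.\<close>

lemma reduced_factorization:
  fixes C D :: "nat \<Rightarrow> nat \<Rightarrow> 'x list \<Rightarrow> 'a::field"
  assumes "\<And>i l. i < p \<Longrightarrow> l < m \<Longrightarrow> finite_support (C i l)"
    and "\<And>l j. l < m \<Longrightarrow> j < n \<Longrightarrow> finite_support (D l j)"
  shows "\<exists>C' D'. (\<forall>i<p. \<forall>l<m. finite_support (C' i l)) \<and> (\<forall>l<m. \<forall>j<n. finite_support (D' l j)) \<and>
    reduced_rows m n D' \<and>
    (\<forall>i<p. \<forall>j<n. \<forall>w. (\<Sum>l<m. word_mult (C' i l) (D' l j) w) = (\<Sum>l<m. word_mult (C i l) (D l j) w))"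
  using assms
proof (induction "\<Sum>l<m. row_size n (D l)" arbitrary: C D rule: less_induct)
  case less
  show ?case
  proof (cases "reduced_rows m n D")
    case True
    then show ?thesis using less.prems by blast
  next
    case False
    then obtain k \<gamma> where k: "k < m" and \<gamma>: "\<And>l. l < m \<Longrightarrow> finite_support (\<gamma> l)" "\<gamma> k = (\<lambda>_. 0)"
      and lt: "row_size n (\<lambda>j w. D k j w + (\<Sum>l<m. word_mult (\<gamma> l) (D l j) w)) < row_size n (D k)"
      using not_reduced_rows_imp_smaller[of m n D] less.prems(2) by blast
    define D' where "D' = (\<lambda>l. if l = k then \<lambda>j w. D k j w + (\<Sum>l<m. word_mult (\<gamma> l) (D l j) w) else D l)"
    define C' where "C' = (\<lambda>i l w. C i l w - word_mult (C i k) (\<gamma> l) w)"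
    have "(\<Sum>l<m. row_size n (D' l)) < (\<Sum>l<m. row_size n (D l))"
      using k lt by (intro sum_strict_mono_ex1) (auto simp: D'_def)
    moreover have "finite_support (C' i l)" if "i < p" "l < m" for i l
      unfolding C'_def using that less.prems(1) k \<gamma>
      by (intro finite_support_diff finite_support_word_mult) auto
    moreover have "finite_support (D' l j)" if "l < m" "j < n" for l j
      unfolding D'_def using that less.prems(2) k \<gamma>
      by (auto intro!: finite_support_add finite_support_sum finite_support_word_mult)
    ultimately obtain C'' D'' where *: "\<forall>i<p. \<forall>l<m. finite_support (C'' i l)" "\<forall>l<m. \<forall>j<n. finite_support (D'' l j)"
      "reduced_rows m n D''"
      "\<forall>i<p. \<forall>j<n. \<forall>w. (\<Sum>l<m. word_mult (C'' i l) (D'' l j) w) = (\<Sum>l<m. word_mult (C' i l) (D' l j) w)"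
      using less.hyps[of D' C'] by blast
    have "(\<Sum>l<m. word_mult (C' i l) (D' l j) w) = (\<Sum>l<m. word_mult (C i l) (D l j) w)" for i j w
    proof -
      have C'k: "C' i k = C i k" using \<gamma>(2) by (simp add: C'_def)
      let ?r = "\<Sum>l<m. word_mult (C i k) (word_mult (\<gamma> l) (D l j)) w"
      have "(\<Sum>l<m. word_mult (C' i l) (D' l j) w)
        = (\<Sum>l<m. (word_mult (C i l) (D l j) w - word_mult (C i k) (word_mult (\<gamma> l) (D l j)) w) + (if l = k then ?r else 0))"
      proof (intro sum.cong refl)
        fix l
        show "word_mult (C' i l) (D' l j) w = (word_mult (C i l) (D l j) w - word_mult (C i k) (word_mult (\<gamma> l) (D l j)) w) + (if l = k then ?r else 0)"
        proof (cases "l = k")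
          case True
          have "word_mult (C' i l) (D' l j) w = word_mult (C i k) (D k j) w + ?r"
            using True C'k by (simp add: D'_def word_mult_add_right word_mult_sum_right)
          moreover have "word_mult (C i k) (word_mult (\<gamma> k) (D k j)) w = 0"
          proof -
            have "word_mult (\<gamma> k) (D k j) = (\<lambda>_. 0)" unfolding \<gamma>(2) by (rule ext) simp
            then show ?thesis by simp
          qed
          ultimately show ?thesis using True by simp
        next
          case False
          then show ?thesis by (simp add: C'_def D'_def word_mult_diff_left word_mult_assoc)
        qed
      qed
      also have "\<dots> = (\<Sum>l<m. word_mult (C i l) (D l j) w)"
        using k by (simp add: sum.distrib sum_subtractf sum.delta)
      finally show ?thesis .
    qed
    with * show ?thesis by (intro exI[of _ C''] exI[of _ D'']) auto
  qed
qed

section \<open>Independent solutions of linear systems\<close>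

text \<open>Columns are indexed by an arbitrary set, so that rows of polynomials can be flattened to
  columns indexed by pairs of an entry and a word.\<close>

definition independent_rows :: "'r set \<Rightarrow> 'c set \<Rightarrow> ('r \<Rightarrow> 'c \<Rightarrow> 'a::field) \<Rightarrow> bool" where
  "independent_rows A J u \<longleftrightarrow> (\<forall>c. (\<forall>j\<in>J. (\<Sum>a\<in>A. c a * u a j) = 0) \<longrightarrow> (\<forall>a\<in>A. c a = 0))"

text \<open>Gaussian elimination, one equation at a time: a solution \<open>b\<close> with nonzero
  residue serves to clear the residues of the others and is then dropped, so each equation costs at
  most one solution.\<close>

lemma independent_solutions:
  fixes e :: "'q \<Rightarrow> 'c \<Rightarrow> 'a::field"
  assumes "finite Q" "finite J"
  shows "\<exists>A u. A \<subseteq> J \<and> card J \<le> card A + card Q \<and> independent_rows A J u \<and>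
    (\<forall>a\<in>A. \<forall>q\<in>Q. (\<Sum>j\<in>J. u a j * e q j) = 0)"
  using assms(1)
proof (induction Q rule: finite_induct)
  case empty
  have "(\<Sum>a\<in>J. c a * (if a = j then 1 else 0)) = c j" if "j \<in> J" for c :: "'c \<Rightarrow> 'a" and j
    using assms(2) that by (simp add: if_distrib sum.delta cong: if_cong)
  then show ?case
    by (intro exI[of _ J] exI[of _ "\<lambda>a j. if a = j then 1 else 0"]) (auto simp: independent_rows_def)
next
  case (insert q Q)
  then obtain A u where A: "A \<subseteq> J" "card J \<le> card A + card Q" "independent_rows A J u"
    "\<forall>a\<in>A. \<forall>q\<in>Q. (\<Sum>j\<in>J. u a j * e q j) = 0" by auto
  have finA: "finite A" using A(1) assms(2) finite_subset by blast
  define s where "s a = (\<Sum>j\<in>J. u a j * e q j)" for a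
  show ?case
  proof (cases "\<forall>a\<in>A. s a = 0")
    case True
    then show ?thesis using A insert.hyps by (intro exI[of _ A] exI[of _ u]) (auto simp: s_def)
  next
    case False
    then obtain b where b: "b \<in> A" "s b \<noteq> 0" by auto
    define u' where "u' a j = u a j - s a / s b * u b j" for a j
    have "(\<Sum>j\<in>J. u' a j * f j) = (\<Sum>j\<in>J. u a j * f j) - s a / s b * (\<Sum>j\<in>J. u b j * f j)" for a and f :: "'c \<Rightarrow> 'a"
      by (simp add: u'_def algebra_simps sum_subtractf sum_distrib_left)
    then have "(\<Sum>j\<in>J. u' a j * e q' j) = 0" if "a \<in> A" "q' \<in> insert q Q" for a q'
      using that A(4) b by (auto simp: s_def)
    moreover have "independent_rows (A - {b}) J u'"
      unfolding independent_rows_def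
    proof (intro allI impI)
      fix c :: "'c \<Rightarrow> 'a" assume c: "\<forall>j\<in>J. (\<Sum>a\<in>A - {b}. c a * u' a j) = 0"
      \<comment> \<open>The coefficient at \<open>b\<close> collects the multiples of row
        \<open>b\<close> that were subtracted, so a relation among the new rows becomes one among
        the old rows.\<close>
      define c' where "c' a = (if a = b then - (\<Sum>a\<in>A - {b}. c a * s a / s b) else c a)" for a
      have "(\<Sum>a\<in>A. c' a * u a j) = 0" if j: "j \<in> J" for j
      proof -
        have "(\<Sum>a\<in>A. c' a * u a j) = c' b * u b j + (\<Sum>a\<in>A - {b}. c' a * u a j)"
          using finA b(1) by (rule sum.remove)
        also have "(\<Sum>a\<in>A - {b}. c' a * u a j) = (\<Sum>a\<in>A - {b}. c a * u a j)"
          by (intro sum.cong) (auto simp: c'_def)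
        also have "c' b * u b j + (\<Sum>a\<in>A - {b}. c a * u a j) = (\<Sum>a\<in>A - {b}. c a * u' a j)"
          by (simp add: c'_def u'_def algebra_simps sum_subtractf sum_distrib_left sum_distrib_right sum_negf)
        finally show ?thesis using c j by simp
      qed
      then have "\<forall>a\<in>A. c' a = 0" using A(3) unfolding independent_rows_def by blast
      then have "c' a = 0" if "a \<in> A - {b}" for a using that by blast
      then show "\<forall>a\<in>A - {b}. c a = 0" unfolding c'_def by (metis DiffD2 singletonI)
    qed
    moreover have "card J \<le> card (A - {b}) + card (insert q Q)"
      using A(2) insert.hyps b(1) finA by (simp add: card_Diff_singleton)
    ultimately show ?thesis using A(1) by (intro exI[of _ "A - {b}"] exI[of _ u']) auto
  qed
qed

section \<open>The free field\<close>

lemma finsum_type_algebra: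
  assumes "finite A"
  shows "finsum (ring_of_type_algebra :: 'a::field ring) f A = sum f A"
proof -
  interpret T: field "ring_of_type_algebra :: 'a ring" by (rule field_from_type_algebra)
  show ?thesis using assms
  proof (induction A rule: finite_induct)
    case empty
    show ?case by (subst T.finsum_empty) (simp add: ring_of_type_algebra_def)
  next
    case (insert x A)
    then show ?case by (subst T.finsum_insert) (auto simp: ring_of_type_algebra_def)
  qed
qed

abbreviation free_alg :: "('x list \<Rightarrow> 'a::field) ring" where
  "free_alg \<equiv> free_algebra ring_of_type_algebra"

lemma free_alg_simps:
  "carrier free_alg = {f. finite_support f}"
  "f \<otimes>\<^bsub>free_alg\<^esub> g = word_mult f g"
  "f \<oplus>\<^bsub>free_alg\<^esub> g = (\<lambda>w. f w + g w)"
  "\<zero>\<^bsub>free_alg\<^esub> = (\<lambda>_. 0)"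
  "\<one>\<^bsub>free_alg\<^esub> = word_const 1"
proof -
  show "f \<otimes>\<^bsub>free_alg\<^esub> g = word_mult f g"
    unfolding free_algebra_def monoid.simps
    by (rule ext, subst finsum_type_algebra) (simp_all add: word_mult_eq_sum ring_of_type_algebra_def)
qed (auto simp: free_algebra_def ring_of_type_algebra_def)

text \<open>Associativity of row times matrix times column; the order of the factors is kept, as the
  ring is not commutative.\<close>

lemma (in ring) finsum_mult_swap:
  assumes "finite L" "q \<in> L \<rightarrow> carrier R" "v \<in> J \<rightarrow> carrier R" "\<And>l j. l \<in> L \<Longrightarrow> j \<in> J \<Longrightarrow> b l j \<in> carrier R" "finite J"
  shows "(\<Oplus>j\<in>J. (\<Oplus>l\<in>L. q l \<otimes> b l j) \<otimes> v j) = (\<Oplus>l\<in>L. q l \<otimes> (\<Oplus>j\<in>J. b l j \<otimes> v j))"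
  using assms(1,2,4)
proof (induction L rule: finite_induct)
  case empty
  have "(\<Oplus>j\<in>J. \<zero> \<otimes> v j) = \<zero>" using assms(3) by (intro add.finprod_one_eqI) (auto simp: Pi_def)
  then show ?case by simp
next
  case (insert l L)
  have c: "q l \<in> carrier R" "j \<in> J \<Longrightarrow> v j \<in> carrier R" "j \<in> J \<Longrightarrow> b l j \<in> carrier R"
    "j \<in> J \<Longrightarrow> (\<Oplus>l\<in>L. q l \<otimes> b l j) \<in> carrier R" for j
    using insert.prems assms(3) by (auto intro!: finsum_closed)
  have IH: "(\<Oplus>j\<in>J. (\<Oplus>l\<in>L. q l \<otimes> b l j) \<otimes> v j) = (\<Oplus>l\<in>L. q l \<otimes> (\<Oplus>j\<in>J. b l j \<otimes> v j))"
    using insert by auto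
  have "(\<Oplus>j\<in>J. (\<Oplus>l\<in>insert l L. q l \<otimes> b l j) \<otimes> v j)
      = (\<Oplus>j\<in>J. q l \<otimes> (b l j \<otimes> v j) \<oplus> (\<Oplus>l\<in>L. q l \<otimes> b l j) \<otimes> v j)"
  proof (intro finsum_cong')
    fix j assume j: "j \<in> J"
    have "(\<Oplus>l\<in>insert l L. q l \<otimes> b l j) = q l \<otimes> b l j \<oplus> (\<Oplus>l\<in>L. q l \<otimes> b l j)"
      using insert j by (intro finsum_insert) auto
    then show "(\<Oplus>l\<in>insert l L. q l \<otimes> b l j) \<otimes> v j = q l \<otimes> (b l j \<otimes> v j) \<oplus> (\<Oplus>l\<in>L. q l \<otimes> b l j) \<otimes> v j"
      using c j by (simp add: l_distr m_assoc)
  qed (use c in auto)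
  also have "\<dots> = (\<Oplus>j\<in>J. q l \<otimes> (b l j \<otimes> v j)) \<oplus> (\<Oplus>j\<in>J. (\<Oplus>l\<in>L. q l \<otimes> b l j) \<otimes> v j)"
    using c by (intro finsum_addf) auto
  also have "(\<Oplus>j\<in>J. q l \<otimes> (b l j \<otimes> v j)) = q l \<otimes> (\<Oplus>j\<in>J. b l j \<otimes> v j)"
    using c assms(5) by (intro finsum_rdistr[symmetric]) auto
  also have "\<dots> \<oplus> (\<Oplus>j\<in>J. (\<Oplus>l\<in>L. q l \<otimes> b l j) \<otimes> v j) = (\<Oplus>l\<in>insert l L. q l \<otimes> (\<Oplus>j\<in>J. b l j \<otimes> v j))"
    unfolding IH using insert.hyps insert.prems assms(3)
    by (intro finsum_insert[symmetric]) (auto intro!: m_closed finsum_closed simp: Pi_def)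
  finally show ?case .
qed

text \<open>The structure on which the dimension estimate rests, over any field and any
  alphabet.\<close>

locale inverting_free_algebra =
  free: ring "free_alg :: ('x list \<Rightarrow> 'a::field) ring" + skew_field F
  for \<phi> :: "('x list \<Rightarrow> 'a::field) \<Rightarrow> 'f" and F :: "('f, 'm) ring_scheme" (structure) +
  assumes hom: "\<phi> \<in> ring_hom free_alg F"
    and inverts_full:
      "\<And>n A. 1 \<le> n \<Longrightarrow> full_matrix free_alg n A \<Longrightarrow> invertible_matrix F n (\<lambda>i j. \<phi> (A i j))"
begin

lemma hom_simps:
  "finite_support f \<Longrightarrow> \<phi> f \<in> carrier F"
  "finite_support f \<Longrightarrow> finite_support g \<Longrightarrow> \<phi> (word_mult f g) = \<phi> f \<otimes> \<phi> g"
  "finite_support f \<Longrightarrow> finite_support g \<Longrightarrow> \<phi> (\<lambda>w. f w + g w) = \<phi> f \<oplus> \<phi> g"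
  "\<phi> (word_const 1) = \<one>"
  "\<phi> (\<lambda>_. 0) = \<zero>"
proof -
  interpret h: ring_hom_ring free_alg F \<phi>
    using hom free.ring_axioms ring_axioms by (intro ring_hom_ringI2)
  show "finite_support f \<Longrightarrow> \<phi> f \<in> carrier F" using h.hom_closed[of f] by (simp add: free_alg_simps)
  show "finite_support f \<Longrightarrow> finite_support g \<Longrightarrow> \<phi> (word_mult f g) = \<phi> f \<otimes> \<phi> g"
    using h.hom_mult[of f g] by (simp add: free_alg_simps)
  show "finite_support f \<Longrightarrow> finite_support g \<Longrightarrow> \<phi> (\<lambda>w. f w + g w) = \<phi> f \<oplus> \<phi> g"
    using h.hom_add[of f g] by (simp add: free_alg_simps)
  show "\<phi> (word_const 1) = \<one>" using h.hom_one by (simp add: free_alg_simps)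
  show "\<phi> (\<lambda>_. 0) = \<zero>" using h.hom_zero by (simp add: free_alg_simps)
qed

lemma finsum_free_alg:
  fixes f :: "nat \<Rightarrow> 'x list \<Rightarrow> 'a"
  assumes "finite L" "\<And>l. l \<in> L \<Longrightarrow> finite_support (f l)"
  shows "finsum free_alg f L = (\<lambda>w. \<Sum>l\<in>L. f l w)"
  using assms
proof (induction L rule: finite_induct)
  case (insert l L)
  then show ?case by (subst free.finsum_insert) (auto simp: free_alg_simps)
qed (simp add: free_alg_simps)

lemma hom_sum:
  assumes "finite L" "\<And>l. l \<in> L \<Longrightarrow> finite_support (f l)"
  shows "\<phi> (\<lambda>w. \<Sum>l\<in>L. f l w) = (\<Oplus>l\<in>L. \<phi> (f l))"
  using assms
proof (induction L rule: finite_induct)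
  case (insert l L)
  then have "\<phi> (\<lambda>w. f l w + (\<Sum>l\<in>L. f l w)) = \<phi> (f l) \<oplus> \<phi> (\<lambda>w. \<Sum>l\<in>L. f l w)"
    by (intro hom_simps finite_support_sum) auto
  moreover have "(\<Oplus>l\<in>insert l L. \<phi> (f l)) = \<phi> (f l) \<oplus> (\<Oplus>l\<in>L. \<phi> (f l))"
    using insert by (intro finsum_insert) (auto simp: hom_simps)
  ultimately show ?case using insert by simp
qed (simp add: hom_simps)

definition row_eval :: "nat set \<Rightarrow> (nat \<Rightarrow> 'x list \<Rightarrow> 'a) \<Rightarrow> (nat \<Rightarrow> 'f) \<Rightarrow> 'f" where
  "row_eval J b v = (\<Oplus>j\<in>J. \<phi> (b j) \<otimes> v j)"

lemma row_eval_closed: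
  "(\<And>j. j \<in> J \<Longrightarrow> finite_support (b j)) \<Longrightarrow> v \<in> J \<rightarrow> carrier F \<Longrightarrow> row_eval J b v \<in> carrier F"
  unfolding row_eval_def by (intro finsum_closed) (auto simp: hom_simps Pi_def)

lemma row_eval_cong:
  assumes "\<And>j. j \<in> J \<Longrightarrow> b j = b' j" "\<And>j. j \<in> J \<Longrightarrow> finite_support (b' j)" "v \<in> J \<rightarrow> carrier F"
  shows "row_eval J b v = row_eval J b' v"
  unfolding row_eval_def using assms by (intro finsum_cong') (auto simp: hom_simps Pi_def)

lemma row_eval_combination:
  assumes "finite L" "finite J" "v \<in> J \<rightarrow> carrier F" "\<And>l. l \<in> L \<Longrightarrow> finite_support (r l)"
    "\<And>l j. l \<in> L \<Longrightarrow> j \<in> J \<Longrightarrow> finite_support (d l j)"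
  shows "row_eval J (\<lambda>j w. \<Sum>l\<in>L. word_mult (r l) (d l j) w) v = (\<Oplus>l\<in>L. \<phi> (r l) \<otimes> row_eval J (d l) v)"
proof -
  have "row_eval J (\<lambda>j w. \<Sum>l\<in>L. word_mult (r l) (d l j) w) v = (\<Oplus>j\<in>J. (\<Oplus>l\<in>L. \<phi> (r l) \<otimes> \<phi> (d l j)) \<otimes> v j)"
    unfolding row_eval_def
  proof (intro finsum_cong')
    fix j assume j: "j \<in> J"
    have "\<phi> (\<lambda>w. \<Sum>l\<in>L. word_mult (r l) (d l j) w) = (\<Oplus>l\<in>L. \<phi> (word_mult (r l) (d l j)))"
      using assms j by (intro hom_sum finite_support_word_mult) auto
    also have "\<dots> = (\<Oplus>l\<in>L. \<phi> (r l) \<otimes> \<phi> (d l j))"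
      using assms j by (intro finsum_cong') (auto simp: hom_simps)
    finally show "\<phi> (\<lambda>w. \<Sum>l\<in>L. word_mult (r l) (d l j) w) \<otimes> v j = (\<Oplus>l\<in>L. \<phi> (r l) \<otimes> \<phi> (d l j)) \<otimes> v j" by simp
  qed (use assms in \<open>auto simp: hom_simps Pi_def intro!: m_closed finsum_closed\<close>)
  also have "\<dots> = (\<Oplus>l\<in>L. \<phi> (r l) \<otimes> row_eval J (d l) v)"
    unfolding row_eval_def using assms by (intro finsum_mult_swap) (auto simp: hom_simps)
  finally show ?thesis .
qed

lemma row_eval_reindex:
  assumes "bij_betw f I J" "\<And>j. j \<in> J \<Longrightarrow> finite_support (b j)" "v \<in> J \<rightarrow> carrier F"
  shows "row_eval I (b \<circ> f) (v \<circ> f) = row_eval J b v"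
proof -
  have "row_eval J b v = (\<Oplus>j\<in>f ` I. \<phi> (b j) \<otimes> v j)" using assms(1) by (simp add: row_eval_def bij_betw_def)
  also have "\<dots> = (\<Oplus>i\<in>I. \<phi> (b (f i)) \<otimes> v (f i))"
    using assms by (intro add.finprod_reindex) (auto simp: bij_betw_def hom_simps Pi_def)
  finally show ?thesis by (simp add: row_eval_def)
qed

definition scalar_independent :: "nat set \<Rightarrow> (nat \<Rightarrow> 'f) \<Rightarrow> bool" where
  "scalar_independent J v \<longleftrightarrow> (\<forall>c. row_eval J (\<lambda>j. word_const (c j)) v = \<zero> \<longrightarrow> (\<forall>j\<in>J. c j = 0))"

text \<open>A singular matrix is not full; its reduced factorisation through a smaller matrix yields
  a smaller system of the same kind.\<close>

lemma no_singular_affine_system: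
  fixes I J :: "nat set"
  assumes "finite I" "I \<noteq> {}" "finite J" "card J \<le> card I"
    and fsB: "\<And>i j. i \<in> I \<Longrightarrow> j \<in> J \<Longrightarrow> finite_support (B i j)"
    and affine: "\<And>i j w. i \<in> I \<Longrightarrow> j \<in> J \<Longrightarrow> 2 \<le> length w \<Longrightarrow> B i j w = 0"
    and indep: "independent_rows I (J \<times> UNIV) (\<lambda>i (j, w). B i j w)"
    and v: "v \<in> J \<rightarrow> carrier F" "scalar_independent J v"
    and sing: "\<And>i. i \<in> I \<Longrightarrow> row_eval J (B i) v = \<zero>"
  shows False
  using assms
proof (induction "card J" arbitrary: I J B v rule: less_induct)
  case less
  note [simp] = \<open>finite I\<close> \<open>finite J\<close>
  show False
  proof (cases "J = {}")
    case True
    then have all: "\<forall>c::nat \<Rightarrow> 'a. \<forall>a\<in>I. c a = 0" using less.prems(7) by (auto simp: independent_rows_def)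
    show False using spec[OF all, of "\<lambda>_. 1"] less.prems(2) by auto
  next
    case J: False
    define M where "M = card J"
    have M: "1 \<le> M" using J by (simp add: M_def Suc_le_eq card_gt_0_iff)
    obtain f where f: "bij_betw f {..<M} J" using ex_bij_betw_nat_finite[of J] by (auto simp: M_def atLeast0LessThan)
    \<comment> \<open>A square subsystem, because fullness concerns square matrices.\<close>
    obtain I' where I': "I' \<subseteq> I" "card I' = M" using obtain_subset_with_card_n[of M I] less.prems(4) by (auto simp: M_def)
    have "finite I'" using I'(1) by (rule finite_subset) simp
    then obtain g where g: "bij_betw g {..<M} I'" using ex_bij_betw_nat_finite[of I'] I'(2) by (auto simp: atLeast0LessThan)
    have fJ: "f j \<in> J" if "j < M" for j using f that by (auto simp: bij_betw_def)
    have gI: "g i \<in> I" if "i < M" for i using g I' that by (auto simp: bij_betw_def)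
    define v' where "v' = v \<circ> f"
    have v'a: "v' \<in> {..<M} \<rightarrow> carrier F" using fJ less.prems(8) by (auto simp: v'_def)
    define b where "b = (\<lambda>i j. B (g i) (f j))"
    have fsb: "finite_support (b i j)" if "i < M" "j < M" for i j using that fJ gI less.prems(5) by (simp add: b_def)
    have v'ind: "c j = 0" if c: "row_eval {..<M} (\<lambda>j. word_const (c j)) v' = \<zero>" and j: "j < M" for c j
    proof -
      define c' where "c' = c \<circ> inv_into {..<M} f"
      have c'f: "c' (f j) = c j" if "j < M" for j using f that by (simp add: c'_def bij_betw_def)
      have "row_eval J (\<lambda>j. word_const (c' j)) v = row_eval {..<M} ((\<lambda>j. word_const (c' j)) \<circ> f) v'"
        unfolding v'_def by (rule row_eval_reindex[OF f finite_support_const less.prems(8), symmetric])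
      also have "\<dots> = row_eval {..<M} (\<lambda>j. word_const (c j)) v'"
        by (rule row_eval_cong[OF _ finite_support_const v'a]) (use c'f in auto)
      finally have "c' (f j) = 0" using c less.prems(9) fJ[OF j] by (simp add: scalar_independent_def)
      then show ?thesis using c'f[OF j] by simp
    qed
    have sing': "row_eval {..<M} (b i) v' = \<zero>" if i: "i < M" for i
    proof -
      have "row_eval {..<M} (b i) v' = row_eval {..<M} (B (g i) \<circ> f) (v \<circ> f)" by (simp add: b_def v'_def o_def)
      also have "\<dots> = row_eval J (B (g i)) v"
        using gI[OF i] less.prems(5) by (intro row_eval_reindex[OF f _ less.prems(8)]) auto
      also have "\<dots> = \<zero>" using less.prems(10) gI[OF i] by simp
      finally show ?thesis .
    qed
    have mat: "is_matrix free_alg M M b" using fsb by (simp add: is_matrix_def free_alg_simps)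
    \<comment> \<open>An inverse would force the entry \<open>v' 0\<close> to vanish, against scalar
      independence.\<close>
    have "\<not> invertible_matrix F M (\<lambda>i j. \<phi> (b i j))"
    proof
      assume "invertible_matrix F M (\<lambda>i j. \<phi> (b i j))"
      then obtain q where q: "is_matrix F M M q"
        "\<forall>i<M. \<forall>j<M. matrix_mult F M q (\<lambda>i j. \<phi> (b i j)) i j = (if i = j then \<one> else \<zero>)"
        unfolding invertible_matrix_def by blast
      have qc: "q i j \<in> carrier F" if "i < M" "j < M" for i j using q(1) that by (simp add: is_matrix_def)
      have "v' 0 = (\<Oplus>j\<in>{..<M}. if 0 = j then v' 0 else \<zero>)"
        using M v'a by (intro add.finprod_singleton[symmetric]) auto
      also have "\<dots> = (\<Oplus>j\<in>{..<M}. (\<Oplus>l\<in>{..<M}. q 0 l \<otimes> \<phi> (b l j)) \<otimes> v' j)"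
      proof (intro finsum_cong')
        fix j assume j: "j \<in> {..<M}"
        then have "(\<Oplus>l\<in>{..<M}. q 0 l \<otimes> \<phi> (b l j)) = (if 0 = j then \<one> else \<zero>)"
          using q(2) M by (auto simp: matrix_mult_def)
        then show "(if 0 = j then v' 0 else \<zero>) = (\<Oplus>l\<in>{..<M}. q 0 l \<otimes> \<phi> (b l j)) \<otimes> v' j"
          using v'a j by (auto simp: Pi_def)
      next
        show "(\<lambda>j. (\<Oplus>l\<in>{..<M}. q 0 l \<otimes> \<phi> (b l j)) \<otimes> v' j) \<in> {..<M} \<rightarrow> carrier F"
          using v'a qc M fsb hom_simps(1) by (auto intro!: m_closed finsum_closed simp: Pi_def)
      qed simp
      also have "\<dots> = (\<Oplus>l\<in>{..<M}. q 0 l \<otimes> (\<Oplus>j\<in>{..<M}. \<phi> (b l j) \<otimes> v' j))"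
        using v'a qc M fsb hom_simps(1) by (intro finsum_mult_swap) auto
      also have "\<dots> = \<zero>"
        using sing' qc M by (intro add.finprod_one_eqI) (auto simp: row_eval_def)
      finally have v0: "v' 0 = \<zero>" .
      have "row_eval {..<M} (\<lambda>j. word_const (if j = 0 then 1 else 0)) v' = \<zero>"
        unfolding row_eval_def
      proof (intro add.finprod_one_eqI)
        fix j assume "j \<in> {..<M}"
        then show "\<phi> (word_const (if j = 0 then 1 else 0)) \<otimes> v' j = \<zero>"
          using v0 v'a hom_simps(4,5) by (cases "j = 0") (auto simp: Pi_def cong: if_cong)
      qed
      from v'ind[OF this, of 0] M show False by simp
    qed
    then have "\<not> full_matrix free_alg M b" using inverts_full[OF M] by blast
    then obtain C D where C: "is_matrix free_alg M (M - 1) C" and D: "is_matrix free_alg (M - 1) M D"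
      and CD: "\<And>i j. i < M \<Longrightarrow> j < M \<Longrightarrow> b i j = matrix_mult free_alg (M - 1) C D i j"
      using mat unfolding full_matrix_def by blast
    have fsC: "finite_support (C i l)" if "i < M" "l < M - 1" for i l
      using C that by (simp add: is_matrix_def free_alg_simps)
    have fsD: "finite_support (D l j)" if "l < M - 1" "j < M" for l j
      using D that by (simp add: is_matrix_def free_alg_simps)
    obtain C' D' where fsC': "\<forall>i<M. \<forall>l<M - 1. finite_support (C' i l)"
      and fsD': "\<forall>l<M - 1. \<forall>j<M. finite_support (D' l j)" and red: "reduced_rows (M - 1) M D'"
      and prod': "\<forall>i<M. \<forall>j<M. \<forall>w. (\<Sum>l<M - 1. word_mult (C' i l) (D' l j) w) = (\<Sum>l<M - 1. word_mult (C i l) (D l j) w)"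
      using reduced_factorization[of M "M - 1" C M D, OF fsC fsD] by blast
    have bCD: "b i j w = (\<Sum>l<M - 1. word_mult (C' i l) (D' l j) w)" if "i < M" "j < M" for i j w
    proof -
      have "b i j = (\<lambda>w. \<Sum>l<M - 1. word_mult (C i l) (D l j) w)"
        unfolding CD[OF that] matrix_mult_def free_alg_simps
        using that fsC fsD by (intro finsum_free_alg finite_support_word_mult) auto
      then show ?thesis using prod' that by simp
    qed
    let ?s = "\<lambda>l. row_size M (D' l)"
    \<comment> \<open>Reducedness at \<open>t = 2\<close>, as the entries of \<open>b\<close> have
      degree at most one: coefficients of a nonzero constant row have degree at most one, and those
      of a row of degree one are scalars.\<close>
    have C'deg: "length w + ?s l \<le> 2" if i: "i < M" and l: "l < M - 1" "C' i l w \<noteq> 0" "?s l \<noteq> 0" for i l w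
    proof -
      have "(\<Sum>l<M - 1. word_mult (C' i l) (D' l j) w) = 0" if "j < M" "2 \<le> length w" for j w
        using bCD[OF i that(1), of w] less.prems(6)[OF gI[OF i] fJ[OF that(1)] that(2)] by (simp add: b_def)
      then show ?thesis using red i l fsC' unfolding reduced_rows_def by blast
    qed
    \<comment> \<open>\<open>L\<close> collects the nonzero constant rows, \<open>Q\<close> those of
      positive degree, whose coefficients in \<open>C'\<close> are scalars.\<close>
    define L where "L = {l. l < M - 1 \<and> ?s l = 1}"
    define Q where "Q = {l. l < M - 1 \<and> 2 \<le> ?s l}"
    have fin: "finite L" "finite Q" by (auto simp: L_def Q_def)
    have "card L + card Q = card (L \<union> Q)" by (rule card_Un_disjoint[symmetric]) (auto simp: L_def Q_def)
    also have "\<dots> \<le> card {..<M - 1}" by (rule card_mono) (auto simp: L_def Q_def)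
    finally have cLQ: "card L + card Q \<le> M - 1" by simp
    \<comment> \<open>Scalar combinations of the rows that kill the columns in \<open>Q\<close>.
      There are at least \<open>M - card Q\<close> of them, more than \<open>card L\<close> because
      the inner dimension is only \<open>M - 1\<close>.\<close>
    obtain A u where A: "A \<subseteq> {..<M}" "M \<le> card A + card Q" "independent_rows A {..<M} u"
      and ker: "\<And>a q. a \<in> A \<Longrightarrow> q \<in> Q \<Longrightarrow> (\<Sum>i<M. u a i * C' i q []) = 0"
      using independent_solutions[OF fin(2), of "{..<M}" "\<lambda>q i. C' i q []"] by auto
    have finA: "finite A" using A(1) finite_subset by blast
    have cLA: "card L < card A" using cLQ A(2) M by simp
    define B2 where "B2 = (\<lambda>a l w. \<Sum>i<M. u a i * C' i l w)"
    have fsB2: "finite_support (B2 a l)" if "l < M - 1" for a l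
      unfolding B2_def using that fsC' by (intro finite_support_sum finite_support_scale) auto
    define v2 where "v2 = (\<lambda>l. row_eval {..<M} (D' l) v')"
    \<comment> \<open>Indices outside \<open>L\<close> belong to zero rows of \<open>D'\<close> or
      to columns killed by \<open>u\<close>, so \<open>B2\<close> times the constant rows of
      \<open>D'\<close> is still \<open>u\<close> times \<open>b\<close>.\<close>
    have key: "(\<Sum>l\<in>L. word_mult (B2 a l) (D' l j) w) = (\<Sum>i<M. word_mult (word_const (u a i)) (b i j) w)"
      if a: "a \<in> A" and j: "j < M" for a j w
    proof -
      have "(\<Sum>l\<in>L. word_mult (B2 a l) (D' l j) w) = (\<Sum>l<M - 1. word_mult (B2 a l) (D' l j) w)"
      proof (rule sum.mono_neutral_left)
        show "\<forall>l\<in>{..<M - 1} - L. word_mult (B2 a l) (D' l j) w = 0"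
        proof
          fix l assume l: "l \<in> {..<M - 1} - L"
          show "word_mult (B2 a l) (D' l j) w = 0"
          proof (cases "?s l = 0")
            case True
            then have "D' l j = (\<lambda>_. 0)" using row_size_zero[of M "D' l" j] fsD' l j by auto
            then show ?thesis by simp
          next
            case False
            then have lQ: "l \<in> Q" using l by (auto simp: L_def Q_def)
            have "B2 a l w = 0" for w
            proof (cases "w = []")
              case True
              then show ?thesis using ker[OF a lQ] by (simp add: B2_def)
            next
              case w: False
              have "C' i l w = 0" if "i < M" for i
              proof (rule ccontr)
                assume "C' i l w \<noteq> 0"
                then have "length w + ?s l \<le> 2" using C'deg[OF that] l False by auto
                then show False using w lQ by (cases w) (auto simp: Q_def)
              qed
              then show ?thesis by (simp add: B2_def)
            qed
            then have "B2 a l = (\<lambda>_. 0)" by auto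
            then show ?thesis by simp
          qed
        qed
      qed (auto simp: L_def)
      also have "\<dots> = (\<Sum>l<M - 1. \<Sum>i<M. u a i * word_mult (C' i l) (D' l j) w)"
        by (simp add: B2_def word_mult_sum_left word_mult_scale_left)
      also have "\<dots> = (\<Sum>i<M. u a i * (\<Sum>l<M - 1. word_mult (C' i l) (D' l j) w))"
        by (subst sum.swap) (simp add: sum_distrib_left)
      also have "\<dots> = (\<Sum>i<M. word_mult (word_const (u a i)) (b i j) w)"
        using bCD j by (simp add: word_mult_const_left)
      finally show ?thesis .
    qed
    show False
    proof (rule less.hyps[of L A B2 v2])
      show "card L < card J" using cLQ M by (simp add: M_def)
      show "finite A" "finite L" "card L \<le> card A" using finA fin cLA by auto
      show "A \<noteq> {}" using cLA by auto
      show "finite_support (B2 a l)" if "a \<in> A" "l \<in> L" for a l using fsB2 that by (simp add: L_def)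
      show "B2 a l w = 0" if "a \<in> A" "l \<in> L" "2 \<le> length w" for a l w
      proof -
        have "C' i l w = 0" if "i < M" for i
          using C'deg[OF that, of l w] \<open>l \<in> L\<close> \<open>2 \<le> length w\<close> by (force simp: L_def)
        then show ?thesis by (simp add: B2_def)
      qed
      show "v2 \<in> L \<rightarrow> carrier F"
        unfolding v2_def using fsD' v'a by (auto simp: L_def intro!: row_eval_closed)
      show "row_eval L (B2 a) v2 = \<zero>" if a: "a \<in> A" for a
      proof -
        have "row_eval L (B2 a) v2 = (\<Oplus>l\<in>L. \<phi> (B2 a l) \<otimes> row_eval {..<M} (D' l) v')"
          by (simp add: row_eval_def v2_def)
        also have "\<dots> = row_eval {..<M} (\<lambda>j w. \<Sum>l\<in>L. word_mult (B2 a l) (D' l j) w) v'"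
          using fin v'a fsB2 fsD' by (intro row_eval_combination[symmetric]) (auto simp: L_def)
        also have "\<dots> = row_eval {..<M} (\<lambda>j w. \<Sum>i<M. word_mult (word_const (u a i)) (b i j) w) v'"
          using key[OF a] fsb v'a finite_support_const
          by (intro row_eval_cong finite_support_sum finite_support_word_mult) auto
        also have "\<dots> = (\<Oplus>i\<in>{..<M}. \<phi> (word_const (u a i)) \<otimes> row_eval {..<M} (b i) v')"
          using v'a fsb finite_support_const by (intro row_eval_combination) auto
        also have "\<dots> = \<zero>"
          using sing' hom_simps(1)[OF finite_support_const] by (intro add.finprod_one_eqI) auto
        finally show ?thesis .
      qed
      \<comment> \<open>Rows in \<open>L\<close> have scalar entries, so a relation on
        \<open>v2\<close> is one on \<open>v'\<close> and the combined row vanishes; reducedness at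
        \<open>t = 0\<close> then excludes nonzero coefficients.\<close>
      show "scalar_independent L v2"
        unfolding scalar_independent_def
      proof (intro allI impI)
        fix c :: "nat \<Rightarrow> 'a" assume c: "row_eval L (\<lambda>j. word_const (c j)) v2 = \<zero>"
        have Dconst: "D' l j = word_const (D' l j [])" if "l \<in> L" "j < M" for l j
        proof
          fix w
          show "D' l j w = word_const (D' l j []) w"
            using row_size_zero[of M "D' l" j w] fsD' that by (cases w) (auto simp: L_def)
        qed
        define d where "d j = (\<Sum>l\<in>L. c l * D' l j [])" for j
        have sumd: "(\<Sum>l\<in>L. word_mult (word_const (c l)) (D' l j) w) = word_const (d j) w" if "j < M" for j w
        proof -
          have "(\<Sum>l\<in>L. word_mult (word_const (c l)) (D' l j) w) = (\<Sum>l\<in>L. c l * word_const (D' l j []) w)"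
            using Dconst[OF _ that] by (intro sum.cong refl) (metis word_mult_const_left)
          then show ?thesis by (simp add: d_def)
        qed
        have "\<zero> = (\<Oplus>l\<in>L. \<phi> (word_const (c l)) \<otimes> row_eval {..<M} (D' l) v')"
          using c by (simp add: row_eval_def v2_def)
        also have "\<dots> = row_eval {..<M} (\<lambda>j w. \<Sum>l\<in>L. word_mult (word_const (c l)) (D' l j) w) v'"
          using fin v'a fsD' finite_support_const by (intro row_eval_combination[symmetric]) (auto simp: L_def)
        also have "\<dots> = row_eval {..<M} (\<lambda>j. word_const (d j)) v'"
          using sumd by (intro row_eval_cong[OF _ finite_support_const v'a]) auto
        finally have d0: "d j = 0" if "j < M" for j using v'ind that by simp
        define c' :: "nat \<Rightarrow> 'x list \<Rightarrow> 'a" where "c' l = word_const (if l \<in> L then c l else 0)" for l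
        have "(\<Sum>l<M - 1. word_mult (c' l) (D' l j) w) = 0" if "j < M" for j w
        proof -
          have "(\<Sum>l<M - 1. word_mult (c' l) (D' l j) w) = (\<Sum>l\<in>L. word_mult (c' l) (D' l j) w)"
            by (rule sum.mono_neutral_right) (auto simp: L_def c'_def word_mult_const_left)
          also have "\<dots> = (\<Sum>l\<in>L. word_mult (word_const (c l)) (D' l j) w)"
            by (intro sum.cong) (auto simp: c'_def)
          finally show ?thesis using sumd[OF that] d0[OF that] by simp
        qed
        moreover have "finite_support (c' l)" for l unfolding c'_def by (rule finite_support_const)
        ultimately have red0: "\<forall>l<M - 1. \<forall>w. c' l w \<noteq> 0 \<and> ?s l \<noteq> 0 \<longrightarrow> length w + ?s l \<le> 0"
          using spec[OF spec[OF red[unfolded reduced_rows_def], of c'], of 0] by blast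
        show "\<forall>l\<in>L. c l = 0"
        proof
          fix l assume l: "l \<in> L"
          then have "c' l [] = c l" "?s l = 1" "l < M - 1" by (auto simp: c'_def L_def)
          then show "c l = 0" using red0 by (metis add_is_0 le_zero_eq zero_neq_one)
        qed
      qed
      \<comment> \<open>A relation among the rows of \<open>B2\<close> is one among the rows of
        \<open>u\<close> times \<open>b\<close>, hence among rows of \<open>B\<close>. The resulting
        coefficients \<open>d\<close> vanish, and independence of the rows of \<open>u\<close>
        finishes.\<close>
      show "independent_rows A (L \<times> UNIV) (\<lambda>i (j, w). B2 i j w)"
        unfolding independent_rows_def
      proof (intro allI impI)
        fix c :: "nat \<Rightarrow> 'a" assume "\<forall>jw\<in>L \<times> UNIV. (\<Sum>a\<in>A. c a * (case jw of (j, w) \<Rightarrow> B2 a j w)) = 0"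
        then have c: "(\<Sum>a\<in>A. c a * B2 a l w) = 0" if "l \<in> L" for l w using that by force
        define d where "d i = (\<Sum>a\<in>A. c a * u a i)" for i
        have db: "(\<Sum>i<M. d i * b i j w) = 0" if j: "j < M" for j w
        proof -
          have "(\<Sum>i<M. d i * b i j w) = (\<Sum>a\<in>A. c a * (\<Sum>i<M. u a i * b i j w))"
            by (simp add: d_def sum_distrib_left sum_distrib_right mult.assoc) (rule sum.swap)
          also have "\<dots> = (\<Sum>a\<in>A. c a * (\<Sum>l\<in>L. word_mult (B2 a l) (D' l j) w))"
            using key j by (intro sum.cong) (auto simp: word_mult_const_left)
          also have "\<dots> = (\<Sum>l\<in>L. word_mult (\<lambda>w. \<Sum>a\<in>A. c a * B2 a l w) (D' l j) w)"
            by (simp add: word_mult_sum_left word_mult_scale_left sum_distrib_left) (rule sum.swap)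
          also have "\<dots> = 0" using c by (intro sum.neutral) auto
          finally show ?thesis .
        qed
        define c' where "c' i = (if i \<in> I' then d (inv_into {..<M} g i) else 0)" for i
        have c'g: "c' (g i) = d i" if "i < M" for i
          using g that by (auto simp: c'_def bij_betw_def)
        have "(\<Sum>i\<in>I. c' i * B i j w) = 0" if j: "j \<in> J" for j w
        proof -
          obtain j' where j': "j' < M" "f j' = j" using f j by (auto simp: bij_betw_def)
          have "(\<Sum>i\<in>I. c' i * B i j w) = (\<Sum>i\<in>I'. c' i * B i j w)"
            using I' by (intro sum.mono_neutral_right) (auto simp: c'_def)
          also have "\<dots> = (\<Sum>i<M. c' (g i) * B (g i) j w)"
            using sum.reindex_bij_betw[OF g, of "\<lambda>i. c' i * B i j w"] by simp
          also have "\<dots> = (\<Sum>i<M. d i * b i j' w)" using c'g j' by (simp add: b_def)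
          finally show ?thesis using db[OF j'(1)] by simp
        qed
        then have "\<forall>i\<in>I. c' i = 0" using less.prems(7) unfolding independent_rows_def by auto
        then have "d i = 0" if "i < M" for i using c'g[OF that] gI[OF that] by auto
        then show "\<forall>a\<in>A. c a = 0" using A(3) unfolding independent_rows_def d_def by auto
      qed
    qed
  qed
qed

end

lemma (in ring) combine_eq_finsum:
  assumes "set Ks \<subseteq> carrier R" "set Us \<subseteq> carrier R" "length Ks = length Us"
  shows "combine Ks Us = (\<Oplus>i\<in>{..<length Us}. Ks ! i \<otimes> Us ! i)"
  using assms
proof (induction Us arbitrary: Ks)
  case (Cons u Us)
  obtain c Cs where Ks: "Ks = c # Cs" using Cons.prems by (cases Ks) auto
  have *: "(\<lambda>i. (c # Cs) ! i \<otimes> (u # Us) ! i) \<in> {..<Suc (length Us)} \<rightarrow> carrier R"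
  proof
    fix i assume "i \<in> {..<Suc (length Us)}"
    then have "(c # Cs) ! i \<in> set Ks" "(u # Us) ! i \<in> set (u # Us)"
      using Cons.prems Ks by (auto intro!: nth_mem simp del: nth_Cons_Suc set_simps)
    then show "(c # Cs) ! i \<otimes> (u # Us) ! i \<in> carrier R" using Cons.prems by blast
  qed
  have "(\<Oplus>i\<in>{..<length (u # Us)}. Ks ! i \<otimes> (u # Us) ! i)
      = (\<Oplus>i\<in>insert 0 (Suc ` {..<length Us}). (c # Cs) ! i \<otimes> (u # Us) ! i)"
    by (simp add: Ks lessThan_Suc_eq_insert_0)
  also have "\<dots> = c \<otimes> u \<oplus> (\<Oplus>i\<in>Suc ` {..<length Us}. (c # Cs) ! i \<otimes> (u # Us) ! i)"
    using * Cons.prems Ks by (subst finsum_insert) auto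
  also have "(\<Oplus>i\<in>Suc ` {..<length Us}. (c # Cs) ! i \<otimes> (u # Us) ! i) = (\<Oplus>i\<in>{..<length Us}. Cs ! i \<otimes> Us ! i)"
    using * by (subst add.finprod_reindex) auto
  also have "\<dots> = combine Cs Us" using Cons Ks by auto
  finally show ?case by (simp add: Ks)
qed simp

lemma (in ring) finsum_add_range:
  fixes M N :: nat
  assumes "\<And>n. n < M + N \<Longrightarrow> f n \<in> carrier R"
  shows "(\<Oplus>n\<in>{..<M + N}. f n) = (\<Oplus>n\<in>{..<M}. f n) \<oplus> (\<Oplus>n\<in>{..<N}. f (M + n))"
  using assms
proof (induction N)
  case 0
  then show ?case by (simp add: Pi_def)
next
  case (Suc N)
  have c: "(\<Oplus>n\<in>{..<M}. f n) \<in> carrier R" "(\<Oplus>n\<in>{..<N}. f (M + n)) \<in> carrier R" "f (M + N) \<in> carrier R"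
    using Suc.prems by (auto intro!: finsum_closed)
  have "(\<Oplus>n\<in>{..<M + Suc N}. f n) = f (M + N) \<oplus> (\<Oplus>n\<in>{..<M + N}. f n)"
    using Suc.prems by (simp add: lessThan_Suc Pi_def)
  moreover have "(\<Oplus>n\<in>{..<Suc N}. f (M + n)) = f (M + N) \<oplus> (\<Oplus>n\<in>{..<N}. f (M + n))"
    using Suc.prems by (simp add: lessThan_Suc Pi_def)
  ultimately show ?case using Suc c by (simp add: a_ac)
qed

text \<open>Taken for a scalar, the centralizer contains the image of the free algebra; since that
  generates the free field, scalars are central there.\<close>

lemma (in skew_field) sub_skew_field_centralizer:
  assumes "z \<in> carrier R"
  shows "sub_skew_field {x \<in> carrier R. z \<otimes> x = x \<otimes> z} R"
proof (rule sub_skew_fieldI)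
  show "subring {x \<in> carrier R. z \<otimes> x = x \<otimes> z} R"
  proof (rule subringI)
    fix h1 h2 assume h: "h1 \<in> {x \<in> carrier R. z \<otimes> x = x \<otimes> z}" "h2 \<in> {x \<in> carrier R. z \<otimes> x = x \<otimes> z}"
    then have hc: "h1 \<in> carrier R" "h2 \<in> carrier R" and hz: "z \<otimes> h1 = h1 \<otimes> z" "z \<otimes> h2 = h2 \<otimes> z" by auto
    have "z \<otimes> (h1 \<otimes> h2) = (z \<otimes> h1) \<otimes> h2" using assms hc by (simp add: m_assoc)
    also have "\<dots> = h1 \<otimes> (z \<otimes> h2)" unfolding hz(1) using assms hc by (simp add: m_assoc)
    also have "\<dots> = (h1 \<otimes> h2) \<otimes> z" unfolding hz(2) using assms hc by (simp add: m_assoc)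
    finally show "h1 \<otimes> h2 \<in> {x \<in> carrier R. z \<otimes> x = x \<otimes> z}" using h by simp
    show "h1 \<oplus> h2 \<in> {x \<in> carrier R. z \<otimes> x = x \<otimes> z}" using assms h by (simp add: l_distr r_distr)
  qed (use assms in \<open>auto simp: l_minus r_minus\<close>)
  fix a assume a: "a \<in> {x \<in> carrier R. z \<otimes> x = x \<otimes> z}" "a \<noteq> \<zero>"
  then have i: "inv a \<in> carrier R" "a \<otimes> inv a = \<one>" "inv a \<otimes> a = \<one>" using nonzero_inverse by auto
  have ac: "a \<in> carrier R" and az: "z \<otimes> a = a \<otimes> z" using a by auto
  have "inv a \<otimes> (z \<otimes> a) \<otimes> inv a = inv a \<otimes> z" using ac assms i by (simp add: m_assoc)
  moreover have "inv a \<otimes> (a \<otimes> z) \<otimes> inv a = z \<otimes> inv a" using ac assms i by (simp flip: m_assoc)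
  ultimately show "inv a \<in> {x \<in> carrier R. z \<otimes> x = x \<otimes> z}" using az i by simp
qed

text \<open>With \<open>M = dim V\<close>, the \<open>3 M\<close> products of \<open>\<one>\<close>,
  \<open>ltr a\<close>, \<open>ltr b\<close> with a basis of \<open>V\<close> would otherwise lie in
  a space of dimension at most \<open>2 M\<close> and satisfy at least \<open>M\<close> independent
  scalar relations. Sorted by basis vectors, each relation is a row of degree at most one that kills
  the basis.\<close>

lemma (in inverting_free_algebra) dim_sum_left_translates_ge:
  fixes a b :: 'x
  assumes K: "K = range (\<lambda>c. \<phi> (word_const c))" and "central_algebra F K" and "a \<noteq> b"
    and V: "finite_dimension K V" "V \<noteq> {\<zero>}"
  defines "ltr \<equiv> \<lambda>a. \<phi> (\<lambda>w. if w = [a] then 1 else 0)"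
  shows "2 * dim K V < dim K (sum_left_translates F {\<one>, ltr a, ltr b} V)"
proof (rule ccontr)
  interpret A: central_algebra F K by fact
  let ?var = "\<lambda>a w. if w = [a] then 1 else (0::'a)"
  have fs_var: "finite_support (?var a)" for a :: 'x by (rule finite_subset[of _ "{[a]}"]) auto
  note fs_c = finite_support_const
  have Xc: "ltr a \<in> carrier F" for a unfolding ltr_def by (rule hom_simps(1)[OF fs_var])
  have cc: "\<phi> (word_const c) \<in> carrier F" for c by (rule hom_simps(1)[OF fs_c])
  define S where "S = {\<one>, ltr a, ltr b}"
  have S: "finite S" "S \<subseteq> carrier F" using Xc by (auto simp: S_def)
  define W where "W = sum_left_translates F S V"
  assume "\<not> ?thesis"
  then have le: "dim K W \<le> 2 * dim K V" by (simp add: W_def S_def)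
  obtain vs where vs: "independent K vs" "set vs \<subseteq> carrier F" "length vs = dim K V" "Span K vs = V"
    by (rule A.finite_dimension_base[OF V(1)])
  have W: "finite_dimension K W" unfolding W_def by (rule A.finite_dimension_sum_left_translates[OF S V(1)])
  obtain zs where zs: "set zs \<subseteq> carrier F" "length zs = dim K W" "Span K zs = W"
    by (rule A.finite_dimension_base[OF W])
  define M where "M = length vs"
  define q where "q = length zs"
  have M: "0 < M" "q \<le> 2 * M" using A.dim_pos[OF V] le vs zs by (auto simp: M_def q_def)
  have vc: "vs ! j \<in> carrier F" if "j < M" for j using vs(2) that by (auto simp: M_def)
  have zc: "zs ! j \<in> carrier F" if "j < q" for j using zs(1) that by (auto simp: q_def)
  \<comment> \<open>Three blocks of length \<open>M\<close>; the factor \<open>\<one>\<close> makes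
    the first block a translate by an element of \<open>S\<close> like the others.\<close>
  define G where "G n = (if n < M then \<one> \<otimes> vs ! n else if n < 2 * M then ltr a \<otimes> vs ! (n - M) else ltr b \<otimes> vs ! (n - 2 * M))" for n
  have GW: "G n \<in> W" if "n < 3 * M" for n
  proof -
    have Vc: "V \<subseteq> carrier F" "\<zero> \<in> V" using A.subalgebraD[OF A.finite_dimension_subalgebra[OF V(1)]] by auto
    have SS: "\<one> \<in> S" "ltr a \<in> S" "ltr b \<in> S" by (auto simp: S_def)
    have "vs ! j \<in> V" if "j < M" for j
      using Span_base_incl[OF A.subfield_K vs(2)] vs(4) that by (auto simp: M_def)
    then show ?thesis
      unfolding W_def G_def using that by (auto intro!: A.translate_in_sum[OF S Vc] SS)
  qed
  have "\<forall>n\<in>{..<3 * M}. \<exists>f. G n = (\<Oplus>l\<in>{..<q}. \<phi> (word_const (f l)) \<otimes> zs ! l)"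
  proof
    fix n assume "n \<in> {..<3 * M}"
    then have "G n \<in> Span K zs" using GW zs(3) by auto
    then obtain Ks where Ks: "set Ks \<subseteq> K" "length Ks = q" "G n = combine Ks zs"
      using Span_mem_iff_length_version[OF A.subfield_K zs(1)] by (auto simp: q_def)
    have "\<forall>l\<in>{..<q}. \<exists>c. Ks ! l = \<phi> (word_const c)" using Ks K nth_mem by blast
    then obtain f where f: "\<And>l. l < q \<Longrightarrow> Ks ! l = \<phi> (word_const (f l))" by (metis lessThan_iff)
    have "combine Ks zs = (\<Oplus>l\<in>{..<q}. Ks ! l \<otimes> zs ! l)"
      unfolding q_def using Ks zs(1) A.K_subset by (intro combine_eq_finsum) (auto simp: q_def)
    also have "\<dots> = (\<Oplus>l\<in>{..<q}. \<phi> (word_const (f l)) \<otimes> zs ! l)"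
      using f cc zc by (intro finsum_cong') auto
    finally show "\<exists>f. G n = (\<Oplus>l\<in>{..<q}. \<phi> (word_const (f l)) \<otimes> zs ! l)" using Ks(3) by auto
  qed
  from bchoice[OF this] obtain e where
    e: "\<And>n. n < 3 * M \<Longrightarrow> G n = (\<Oplus>l\<in>{..<q}. \<phi> (word_const (e n l)) \<otimes> zs ! l)" by auto
  \<comment> \<open>Scalar relations among the vectors \<open>G n\<close>, obtained as solutions of
    the \<open>q \<le> 2 * M\<close> equations given by their coordinates \<open>e\<close> in
    \<open>zs\<close>.\<close>
  obtain A u where A: "A \<subseteq> {..<3 * M}" "3 * M \<le> card A + q" "independent_rows A {..<3 * M} u"
    and ker: "\<And>a l. a \<in> A \<Longrightarrow> l < q \<Longrightarrow> (\<Sum>n<3 * M. u a n * e n l) = 0"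
    using independent_solutions[of "{..<q}" "{..<3 * M}" "\<lambda>l n. e n l"] by auto
  have finA: "finite A" using A(1) finite_subset by blast
  have Gc: "G n \<in> carrier F" if "n < 3 * M" for n
    using GW[OF that] A.subalgebraD(1)[OF A.finite_dimension_subalgebra[OF W]] by auto
  have rel: "(\<Oplus>n\<in>{..<3 * M}. \<phi> (word_const (u i n)) \<otimes> G n) = \<zero>" if i: "i \<in> A" for i
  proof -
    have "(\<Oplus>n\<in>{..<3 * M}. \<phi> (word_const (u i n)) \<otimes> G n)
        = (\<Oplus>n\<in>{..<3 * M}. \<phi> (word_const (u i n)) \<otimes> (\<Oplus>l\<in>{..<q}. \<phi> (word_const (e n l)) \<otimes> zs ! l))"
      using e Gc cc by (intro finsum_cong') auto
    also have "\<dots> = (\<Oplus>l\<in>{..<q}. (\<Oplus>n\<in>{..<3 * M}. \<phi> (word_const (u i n)) \<otimes> \<phi> (word_const (e n l))) \<otimes> zs ! l)"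
      using cc zc by (intro finsum_mult_swap[symmetric]) auto
    also have "\<dots> = \<zero>"
    proof (intro add.finprod_one_eqI)
      fix l assume l: "l \<in> {..<q}"
      have "(\<Oplus>n\<in>{..<3 * M}. \<phi> (word_const (u i n)) \<otimes> \<phi> (word_const (e n l)))
          = (\<Oplus>n\<in>{..<3 * M}. \<phi> (word_mult (word_const (u i n)) (word_const (e n l))))"
        using cc hom_simps(2)[OF fs_c fs_c] by (intro finsum_cong') auto
      also have "\<dots> = \<phi> (\<lambda>w. \<Sum>n<3 * M. word_mult (word_const (u i n)) (word_const (e n l)) w)"
        by (intro hom_sum[symmetric] finite_support_word_mult fs_c) auto
      also have "(\<lambda>w::'x list. \<Sum>n<3 * M. word_mult (word_const (u i n)) (word_const (e n l)) w) = (\<lambda>w. 0)"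
      proof
        fix w :: "'x list"
        show "(\<Sum>n<3 * M. word_mult (word_const (u i n)) (word_const (e n l)) w) = 0"
          using ker[OF i, of l] l by (cases "w = []") (auto simp: word_mult_const_left)
      qed
      finally show "(\<Oplus>n\<in>{..<3 * M}. \<phi> (word_const (u i n)) \<otimes> \<phi> (word_const (e n l))) \<otimes> zs ! l = \<zero>"
        using zc l by (simp add: hom_simps)
    qed
    finally show ?thesis .
  qed
  \<comment> \<open>Relation \<open>i\<close> read as a row of polynomials: its three coefficients
    at basis vector \<open>j\<close> become those of the empty word and of the two letters.\<close>
  define B where "B = (\<lambda>i j w. word_const (u i j) w + (word_mult (word_const (u i (M + j))) (?var a) w
      + word_mult (word_const (u i (2 * M + j))) (?var b) w))"
  define v where "v = (\<lambda>j. vs ! j)"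
  have v: "v \<in> {..<M} \<rightarrow> carrier F" using vc by (auto simp: v_def)
  \<comment> \<open>As the letters are distinct, the three blocks of \<open>u\<close> can be read
    off from \<open>B\<close>, and independence of the relations carries over.\<close>
  have B_simps: "B i j [] = u i j" "B i j [a] = u i (M + j)" "B i j [b] = u i (2 * M + j)"
    "2 \<le> length w \<Longrightarrow> B i j w = 0" for i j w
    using \<open>a \<noteq> b\<close> by (auto simp: B_def word_mult_const_left)
  have eval: "row_eval {..<M} (B i) v = \<zero>" if i: "i \<in> A" for i
  proof -
    have "row_eval {..<M} (B i) v = (\<Oplus>j\<in>{..<M}. \<phi> (word_const (u i j)) \<otimes> G j
        \<oplus> (\<phi> (word_const (u i (M + j))) \<otimes> G (M + j) \<oplus> \<phi> (word_const (u i (2 * M + j))) \<otimes> G (2 * M + j)))"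
      unfolding row_eval_def
    proof (intro finsum_cong')
      fix j assume j: "j \<in> {..<M}"
      have "\<phi> (B i j) = \<phi> (word_const (u i j)) \<oplus> (\<phi> (word_const (u i (M + j))) \<otimes> ltr a \<oplus> \<phi> (word_const (u i (2 * M + j))) \<otimes> ltr b)"
      proof -
        note fs = fs_c fs_var finite_support_word_mult finite_support_add
        have "\<phi> (B i j) = \<phi> (word_const (u i j)) \<oplus> \<phi> (\<lambda>w. word_mult (word_const (u i (M + j))) (?var a) w
            + word_mult (word_const (u i (2 * M + j))) (?var b) w)"
          unfolding B_def by (rule hom_simps(3)) (intro fs)+
        also have "\<phi> (\<lambda>w. word_mult (word_const (u i (M + j))) (?var a) w
            + word_mult (word_const (u i (2 * M + j))) (?var b) w)
          = \<phi> (word_mult (word_const (u i (M + j))) (?var a)) \<oplus> \<phi> (word_mult (word_const (u i (2 * M + j))) (?var b))"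
          by (rule hom_simps(3)) (intro fs)+
        finally show ?thesis unfolding ltr_def using hom_simps(2)[OF fs_c fs_var] by simp
      qed
      moreover have "G j = v j" "G (M + j) = ltr a \<otimes> v j" "G (2 * M + j) = ltr b \<otimes> v j"
        using j vc by (auto simp: G_def v_def)
      ultimately show "\<phi> (B i j) \<otimes> v j = \<phi> (word_const (u i j)) \<otimes> G j
        \<oplus> (\<phi> (word_const (u i (M + j))) \<otimes> G (M + j) \<oplus> \<phi> (word_const (u i (2 * M + j))) \<otimes> G (2 * M + j))"
        using cc Xc j vc by (simp add: l_distr m_assoc v_def)
    qed (use cc Gc in auto)
    also have "\<dots> = (\<Oplus>j\<in>{..<M}. \<phi> (word_const (u i j)) \<otimes> G j) \<oplus>
        ((\<Oplus>j\<in>{..<M}. \<phi> (word_const (u i (M + j))) \<otimes> G (M + j)) \<oplus>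
         (\<Oplus>j\<in>{..<M}. \<phi> (word_const (u i (2 * M + j))) \<otimes> G (2 * M + j)))"
      using cc Gc by (subst finsum_addf; (subst finsum_addf)?) auto
    also have "\<dots> = (\<Oplus>n\<in>{..<M + (M + M)}. \<phi> (word_const (u i n)) \<otimes> G n)"
    proof -
      have r: "2 * M + j = M + (M + j)" for j by simp
      show ?thesis
        unfolding r using cc Gc by (subst finsum_add_range, simp, subst finsum_add_range) auto
    qed
    also have "\<dots> = \<zero>" using rel[OF i] by (simp add: numeral_3_eq_3)
    finally show ?thesis .
  qed
  have "scalar_independent {..<M} v"
    unfolding scalar_independent_def
  proof (intro allI impI)
    fix c :: "nat \<Rightarrow> 'a" assume c: "row_eval {..<M} (\<lambda>j. word_const (c j)) v = \<zero>"
    define Ks where "Ks = map (\<lambda>j. \<phi> (word_const (c j))) [0..<M]"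
    have Ks: "set Ks \<subseteq> K" "length Ks = M" by (auto simp: Ks_def K)
    have "combine Ks vs = (\<Oplus>j\<in>{..<M}. Ks ! j \<otimes> vs ! j)"
      unfolding M_def using Ks vs(2) A.K_subset by (intro combine_eq_finsum) (auto simp: M_def)
    also have "\<dots> = row_eval {..<M} (\<lambda>j. word_const (c j)) v"
      unfolding row_eval_def v_def using cc vc by (intro finsum_cong') (auto simp: Ks_def cong: if_cong)
    finally have "combine Ks vs = \<zero>" using c by simp
    from independent_imp_trivial_combine[OF A.subfield_K vs(1) Ks(1) this]
    have Ks0: "set Ks \<subseteq> {\<zero>}" using Ks(2) by (simp add: M_def)
    show "\<forall>j\<in>{..<M}. c j = 0"
    proof (rule ballI, rule ccontr)
      fix j assume j: "j \<in> {..<M}" and nz: "c j \<noteq> 0"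
      have "\<phi> (word_const (c j)) = \<zero>" using Ks0 j by (auto simp: Ks_def image_subset_iff)
      moreover have "word_mult (word_const (1 / c j)) (word_const (c j)) = (word_const 1 :: 'x list \<Rightarrow> 'a)"
        using nz by (auto simp: word_mult_const_left)
      then have "\<phi> (word_const (1 / c j)) \<otimes> \<phi> (word_const (c j)) = \<one>"
        using hom_simps(2)[OF fs_c fs_c, of "1 / c j" "c j"] hom_simps(4) by (simp only:)
      ultimately show False using cc one_not_zero by simp
    qed
  qed
  moreover have "independent_rows A ({..<M} \<times> UNIV) (\<lambda>i (j, w). B i j w)"
    unfolding independent_rows_def
  proof (intro allI impI)
    fix c :: "nat \<Rightarrow> 'a" assume "\<forall>jw\<in>{..<M} \<times> UNIV. (\<Sum>i\<in>A. c i * (case jw of (j, w) \<Rightarrow> B i j w)) = 0"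
    then have c: "(\<Sum>i\<in>A. c i * B i j w) = 0" if "j < M" for j w using that by force
    have "(\<Sum>i\<in>A. c i * u i n) = 0" if "n < 3 * M" for n
    proof -
      consider "n < M" | "M \<le> n" "n < 2 * M" | "2 * M \<le> n" by linarith
      then show ?thesis
      proof cases
        case 1
        then show ?thesis using c[of n "[]"] by (simp add: B_simps)
      next
        case 2
        then show ?thesis using c[of "n - M" "[a]"] by (simp add: B_simps)
      next
        case 3
        then show ?thesis using c[of "n - 2 * M" "[b]"] that by (simp add: B_simps)
      qed
    qed
    then show "\<forall>i\<in>A. c i = 0" using A(3) unfolding independent_rows_def by auto
  qed
  moreover have "finite_support (B i j)" for i j
    unfolding B_def by (intro finite_support_add finite_support_word_mult fs_c fs_var)
  moreover have "M \<le> card A" "A \<noteq> {}" using A(2) M by auto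
  ultimately show False
    using no_singular_affine_system[of A "{..<M}" B v] finA v B_simps(4) eval by auto
qed

lemma cohn_free_field_not_amenable:
  fixes F :: "'f ring" and \<phi> :: "(bool list \<Rightarrow> complex) \<Rightarrow> 'f"
  assumes "cohn_free_field complex_field \<phi> F"
  shows "\<not> amenable complex_field (\<phi> \<circ> free_algebra_const complex_field) F"
proof
  have U: "universal_field_of_fractions (free_algebra complex_field) \<phi> F"
    using assms by (simp add: cohn_free_field_def)
  note generated = universal_field_of_fractions.generated[OF U]
  have "ring (free_algebra complex_field :: (bool list \<Rightarrow> complex) ring)" "skew_field F"
    using U by (auto simp: universal_field_of_fractions_def)
  then interpret inverting_free_algebra \<phi> F
    using universal_field_of_fractions.embedding_hom[OF U] universal_field_of_fractions.inverts_full[OF U]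
    by (intro inverting_free_algebra.intro inverting_free_algebra_axioms.intro) (simp_all add: complex_field_def)
  let ?K = "(\<phi> \<circ> free_algebra_const complex_field) ` carrier complex_field"
  have K: "?K = range (\<lambda>c. \<phi> (word_const c))"
  proof -
    have z: "\<zero>\<^bsub>complex_field\<^esub> = 0" "carrier complex_field = UNIV"
      by (auto simp: complex_field_def ring_of_type_algebra_def)
    show ?thesis unfolding free_algebra_const_def z o_def by simp
  qed
  let ?X = "\<lambda>a. \<phi> (\<lambda>w. if w = [a] then 1 else 0)"
  note cc = hom_simps(1)[OF finite_support_const]
  have cmult: "\<phi> (word_const c) \<otimes>\<^bsub>F\<^esub> \<phi> (word_const d) = \<phi> (word_const (c * d))" for c d
  proof -
    have "word_mult (word_const c) (word_const d) = (word_const (c * d) :: bool list \<Rightarrow> complex)"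
      by (auto simp: word_mult_const_left)
    then show ?thesis using hom_simps(2)[OF finite_support_const finite_support_const, of c d] by simp
  qed
  have cadd: "\<phi> (word_const c) \<oplus>\<^bsub>F\<^esub> \<phi> (word_const d) = \<phi> (word_const (c + d))" for c d
  proof -
    have "(\<lambda>w. word_const c w + word_const d w) = (word_const (c + d) :: bool list \<Rightarrow> complex)" by auto
    then show ?thesis using hom_simps(3)[OF finite_support_const finite_support_const, of c d] by simp
  qed
  have czero: "\<phi> (word_const 0) = \<zero>\<^bsub>F\<^esub>" using hom_simps(5) by simp
  have central: "\<phi> (word_const c) \<otimes>\<^bsub>F\<^esub> x = x \<otimes>\<^bsub>F\<^esub> \<phi> (word_const c)" if "x \<in> carrier F" for c x
  proof -
    let ?L = "{x \<in> carrier F. \<phi> (word_const c) \<otimes>\<^bsub>F\<^esub> x = x \<otimes>\<^bsub>F\<^esub> \<phi> (word_const c)}"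
    have "\<phi> ` carrier (free_algebra complex_field) \<subseteq> ?L"
    proof
      fix y assume "y \<in> \<phi> ` carrier (free_algebra complex_field)"
      then obtain f where f: "finite_support f" "y = \<phi> f"
        by (auto simp: complex_field_def free_alg_simps)
      have "word_mult f (word_const c) w = c * f w" for w
        by (induction w arbitrary: f) (auto simp: mult.commute)
      then have "word_mult f (word_const c) = word_mult (word_const c) f"
        by (auto simp: word_mult_const_left)
      then have "\<phi> (word_const c) \<otimes>\<^bsub>F\<^esub> \<phi> f = \<phi> f \<otimes>\<^bsub>F\<^esub> \<phi> (word_const c)"
        using hom_simps(2)[OF f(1) finite_support_const] hom_simps(2)[OF finite_support_const f(1)] by metis
      then show "y \<in> ?L" using f hom_simps(1) by auto
    qed
    then have "?L = carrier F" by (rule generated[OF sub_skew_field_centralizer[OF cc]])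
    then show ?thesis using that by auto
  qed
  have ca: "central_algebra F ?K"
  proof (intro central_algebra.intro central_algebra_axioms.intro ring_axioms)
    show "subfield ?K F"
    proof (rule subfieldI)
      have "subring ?K F"
      proof (rule subringI)
        show "?K \<subseteq> carrier F" unfolding K using cc by auto
        show "\<one>\<^bsub>F\<^esub> \<in> ?K" unfolding K using hom_simps(4) by (metis rangeI)
        show "\<ominus>\<^bsub>F\<^esub> h \<in> ?K" if hK: "h \<in> ?K" for h
        proof -
          obtain c where h: "h = \<phi> (word_const c)" using hK unfolding K by auto
          have "\<phi> (word_const (- c)) \<oplus>\<^bsub>F\<^esub> h = \<zero>\<^bsub>F\<^esub>" unfolding h cadd using czero by (simp cong: if_cong)
          then have "\<ominus>\<^bsub>F\<^esub> h = \<phi> (word_const (- c))" using cc h minus_equality by simp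
          then show ?thesis unfolding K by auto
        qed
        show "h1 \<otimes>\<^bsub>F\<^esub> h2 \<in> ?K" "h1 \<oplus>\<^bsub>F\<^esub> h2 \<in> ?K" if "h1 \<in> ?K" "h2 \<in> ?K" for h1 h2
          using that unfolding K by (auto simp: cmult cadd)
      qed
      then show "subcring ?K F" unfolding K using cmult
        by (intro subcringI) (auto simp: mult.commute cong: if_cong)
      show "Units (F\<lparr>carrier := ?K\<rparr>) = ?K - {\<zero>\<^bsub>F\<^esub>}"
      proof (intro equalityI subsetI)
        fix h assume "h \<in> Units (F\<lparr>carrier := ?K\<rparr>)"
        then obtain h' where h: "h \<in> ?K" "h' \<in> ?K" "h \<otimes>\<^bsub>F\<^esub> h' = \<one>\<^bsub>F\<^esub>" by (auto simp: Units_def)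
        then have "h' \<in> carrier F" unfolding K using cc by auto
        then show "h \<in> ?K - {\<zero>\<^bsub>F\<^esub>}" using h one_not_zero by auto
      next
        fix h assume h: "h \<in> ?K - {\<zero>\<^bsub>F\<^esub>}"
        then obtain c where "h = \<phi> (word_const c)" unfolding K by auto
        moreover from this have "c \<noteq> 0" using h czero by blast
        ultimately have c: "h = \<phi> (word_const c)" "c \<noteq> 0" by auto
        then have "h \<otimes>\<^bsub>F\<^esub> \<phi> (word_const (1 / c)) = \<one>\<^bsub>F\<^esub>" "\<phi> (word_const (1 / c)) \<otimes>\<^bsub>F\<^esub> h = \<one>\<^bsub>F\<^esub>"
          by (simp_all add: cmult hom_simps cong: if_cong) (simp_all only: hom_simps(4))?
        then show "h \<in> Units (F\<lparr>carrier := ?K\<rparr>)" using h unfolding Units_def K by auto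
      qed
    qed
    show "c \<otimes>\<^bsub>F\<^esub> x = x \<otimes>\<^bsub>F\<^esub> c" if "c \<in> ?K" "x \<in> carrier F" for c x
      using that central unfolding K by auto
  qed
  have main: "2 * dim ?K V < dim ?K (sum_left_translates F {\<one>\<^bsub>F\<^esub>, ?X True, ?X False} V)"
    if "finite_dimension ?K V" "V \<noteq> {\<zero>\<^bsub>F\<^esub>}" for V
    using dim_sum_left_translates_ge[OF K ca _ that, of True False] by simp
  have "finite_support (\<lambda>w. if w = [x] then 1 else 0 :: complex)" for x :: bool
    by (rule finite_subset[of _ "{[x]}"]) auto
  then have S: "finite {\<one>\<^bsub>F\<^esub>, ?X True, ?X False}" "{\<one>\<^bsub>F\<^esub>, ?X True, ?X False} \<subseteq> carrier F"
    using hom_simps(1) by auto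
  assume "amenable complex_field (\<phi> \<circ> free_algebra_const complex_field) F"
  \<comment> \<open>Amenability with \<open>\<epsilon> = 1\<close> yields a ratio below two, against
    \<open>main\<close>.\<close>
  then obtain V where V: "finite_dimension ?K V" "V \<noteq> {\<zero>\<^bsub>F\<^esub>}"
    "real (dim ?K (sum_left_translates F {\<one>\<^bsub>F\<^esub>, ?X True, ?X False} V)) / real (dim ?K V) < 1 + 1"
    using S unfolding amenable_def by (meson zero_less_one)
  then have "real (dim ?K (sum_left_translates F {\<one>\<^bsub>F\<^esub>, ?X True, ?X False} V)) \<le> 2 * real (dim ?K V)"
    using central_algebra.dim_pos[OF ca V(1,2)] by (simp add: divide_less_eq)
  then show False using main[OF V(1,2)] by linarith
qed

section \<open>Group algebras of ordered groups\<close>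

text \<open>Additive notation for a group that may be noncommutative. Invariance on both sides is
  what makes leading exponents add up in products.\<close>

class bi_ordered_group = group_add + linorder +
  assumes add_less_left: "a < b \<Longrightarrow> c + a < c + b"
    and add_less_right: "a < b \<Longrightarrow> a + c < b + c"

definition group_algebra :: "('k, 'm) ring_scheme \<Rightarrow> ('g::group_add \<Rightarrow> 'k) ring" where
  "group_algebra k =
     \<lparr>carrier = {f. range f \<subseteq> carrier k \<and> finite {x. f x \<noteq> \<zero>\<^bsub>k\<^esub>}},
      monoid.mult = (\<lambda>f g z. \<Oplus>\<^bsub>k\<^esub>x\<in>{x. f x \<noteq> \<zero>\<^bsub>k\<^esub>}. f x \<otimes>\<^bsub>k\<^esub> g (- x + z)),
      one = (\<lambda>z. if z = 0 then \<one>\<^bsub>k\<^esub> else \<zero>\<^bsub>k\<^esub>),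
      ring.zero = (\<lambda>_. \<zero>\<^bsub>k\<^esub>),
      add = (\<lambda>f g z. f z \<oplus>\<^bsub>k\<^esub> g z)\<rparr>"

context field
begin

abbreviation GA :: "('g::group_add \<Rightarrow> 'a) ring" where "GA \<equiv> group_algebra R"

abbreviation supp :: "('g \<Rightarrow> 'a) \<Rightarrow> 'g set" where "supp f \<equiv> {x. f x \<noteq> \<zero>}"

text \<open>The monomial with coefficient \<open>c\<close> at \<open>g\<close>;
  \<open>point 0\<close> is the embedding of the scalars.\<close>

definition point :: "'g \<Rightarrow> 'a \<Rightarrow> 'g \<Rightarrow> 'a" where
  "point g c = (\<lambda>z. if z = g then c else \<zero>)"

lemma GA_simps:
  "f \<in> carrier GA \<longleftrightarrow> (\<forall>x. f x \<in> carrier R) \<and> finite (supp f)"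
  "(f \<oplus>\<^bsub>GA\<^esub> g) z = f z \<oplus> g z"
  "\<zero>\<^bsub>GA\<^esub> = (\<lambda>_. \<zero>)"
  "\<one>\<^bsub>GA\<^esub> = point 0 \<one>"
  by (auto simp: group_algebra_def point_def)

text \<open>The index set may be enlarged beyond the support, so that several products can be summed
  over a common set.\<close>

lemma GA_mult:
  assumes "f \<in> carrier GA" "g \<in> carrier GA" "finite A" "supp f \<subseteq> A"
  shows "(f \<otimes>\<^bsub>GA\<^esub> g) z = (\<Oplus>x\<in>A. f x \<otimes> g (- x + z))"
proof -
  have "(f \<otimes>\<^bsub>GA\<^esub> g) z = (\<Oplus>x\<in>supp f. f x \<otimes> g (- x + z))" by (simp add: group_algebra_def)
  also have "\<dots> = (\<Oplus>x\<in>A. f x \<otimes> g (- x + z))"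
    using assms by (intro add.finprod_mono_neutral_cong_left) (auto simp: GA_simps)
  finally show ?thesis .
qed

lemma point_closed: "c \<in> carrier R \<Longrightarrow> point g c \<in> carrier GA"
  by (auto simp: GA_simps point_def intro: finite_subset[of _ "{g}"])

lemma supp_mult_subset:
  assumes "f \<in> carrier GA" "g \<in> carrier GA"
  shows "supp (f \<otimes>\<^bsub>GA\<^esub> g) \<subseteq> (\<lambda>(x, y). x + y) ` (supp f \<times> supp g)"
proof
  fix z assume z: "z \<in> supp (f \<otimes>\<^bsub>GA\<^esub> g)"
  have "(f \<otimes>\<^bsub>GA\<^esub> g) z = (\<Oplus>x\<in>supp f. f x \<otimes> g (- x + z))"
    using assms by (intro GA_mult) (auto simp: GA_simps)
  with z have "(\<Oplus>x\<in>supp f. f x \<otimes> g (- x + z)) \<noteq> \<zero>" by simp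
  then obtain x where x: "x \<in> supp f" "f x \<otimes> g (- x + z) \<noteq> \<zero>"
    using add.finprod_one_eqI[of "supp f" "\<lambda>x. f x \<otimes> g (- x + z)"] by auto
  have "f x \<in> carrier R" using assms(1) by (simp add: GA_simps)
  then have "g (- x + z) \<noteq> \<zero>" using x by auto
  then show "z \<in> (\<lambda>(x, y). x + y) ` (supp f \<times> supp g)"
    using x by (intro image_eqI[of _ _ "(x, - x + z)"]) (auto simp flip: add.assoc)
qed

lemma GA_mult_closed:
  assumes f: "f \<in> carrier GA" and g: "g \<in> carrier GA"
  shows "f \<otimes>\<^bsub>GA\<^esub> g \<in> carrier GA"
proof -
  have "finite (supp (f \<otimes>\<^bsub>GA\<^esub> g))"
    using f g by (intro finite_subset[OF supp_mult_subset[OF f g]]) (auto simp: GA_simps)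
  moreover have "(f \<otimes>\<^bsub>GA\<^esub> g) z \<in> carrier R" for z
    using f g by (subst GA_mult[OF f g, of "supp f"]) (auto simp: GA_simps intro!: finsum_closed)
  ultimately show ?thesis by (simp add: GA_simps)
qed

lemma GA_mult_assoc:
  assumes f: "f \<in> carrier GA" and g: "g \<in> carrier GA" and h: "h \<in> carrier GA"
  shows "(f \<otimes>\<^bsub>GA\<^esub> g) \<otimes>\<^bsub>GA\<^esub> h = f \<otimes>\<^bsub>GA\<^esub> (g \<otimes>\<^bsub>GA\<^esub> h)"
proof
  fix z
  have c: "f x \<in> carrier R" "g x \<in> carrier R" "h x \<in> carrier R" for x using f g h by (auto simp: GA_simps)
  have fin: "finite (supp f)" "finite (supp g)" using f g by (auto simp: GA_simps)
  define P where "P = (\<lambda>(x, y). x + y) ` (supp f \<times> supp g)"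
  have P: "finite P" "supp (f \<otimes>\<^bsub>GA\<^esub> g) \<subseteq> P" using fin supp_mult_subset[OF f g] by (auto simp: P_def)
  have "((f \<otimes>\<^bsub>GA\<^esub> g) \<otimes>\<^bsub>GA\<^esub> h) z = (\<Oplus>y\<in>P. (f \<otimes>\<^bsub>GA\<^esub> g) y \<otimes> h (- y + z))"
    by (rule GA_mult[OF GA_mult_closed[OF f g] h P])
  also have "\<dots> = (\<Oplus>y\<in>P. (\<Oplus>x\<in>supp f. f x \<otimes> g (- x + y)) \<otimes> h (- y + z))"
    using GA_mult[OF f g fin(1)] c by (intro finsum_cong') (auto intro!: finsum_closed m_closed)
  also have "\<dots> = (\<Oplus>x\<in>supp f. f x \<otimes> (\<Oplus>y\<in>P. g (- x + y) \<otimes> h (- y + z)))"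
    using c fin P by (intro finsum_mult_swap) auto
  also have "\<dots> = (\<Oplus>x\<in>supp f. f x \<otimes> (g \<otimes>\<^bsub>GA\<^esub> h) (- x + z))"
  proof (intro finsum_cong')
    fix x assume x: "x \<in> supp f"
    \<comment> \<open>Preparation for the substitution \<open>y = x + w\<close>: terms with
      \<open>- x + y\<close> outside the support of \<open>g\<close> vanish.\<close>
    have "(\<Oplus>y\<in>P. g (- x + y) \<otimes> h (- y + z)) = (\<Oplus>y\<in>(+) x ` supp g. g (- x + y) \<otimes> h (- y + z))"
    proof (rule add.finprod_mono_neutral_cong_right[OF P(1)])
      show "(+) x ` supp g \<subseteq> P" using x by (auto simp: P_def)
      fix i assume "i \<in> P - (+) x ` supp g"
      then have "g (- x + i) = \<zero>" by (auto simp: image_iff simp flip: add.assoc)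
      then show "g (- x + i) \<otimes> h (- i + z) = \<zero>" using c by simp
    qed (use c in auto)
    also have "\<dots> = (\<Oplus>w\<in>supp g. g w \<otimes> h (- w + (- x + z)))"
    proof -
      have 1: "- (x + w) + z = - w + (- x + z)" for w by (simp only: group_add_class.minus_add add.assoc)
      have 2: "- x + (x + w) = w" for w by (simp flip: add.assoc)
      have "(\<Oplus>y\<in>(+) x ` supp g. g (- x + y) \<otimes> h (- y + z))
          = (\<Oplus>w\<in>supp g. g (- x + (x + w)) \<otimes> h (- (x + w) + z))"
        using c by (intro add.finprod_reindex) auto
      then show ?thesis by (simp only: 1 2)
    qed
    also have "\<dots> = (g \<otimes>\<^bsub>GA\<^esub> h) (- x + z)" by (rule GA_mult[OF g h fin(2), symmetric]) simp
    finally show "f x \<otimes> (\<Oplus>y\<in>P. g (- x + y) \<otimes> h (- y + z)) = f x \<otimes> (g \<otimes>\<^bsub>GA\<^esub> h) (- x + z)" by simp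
  qed (use c GA_mult_closed[OF g h] in \<open>auto simp: GA_simps\<close>)
  also have "\<dots> = (f \<otimes>\<^bsub>GA\<^esub> (g \<otimes>\<^bsub>GA\<^esub> h)) z"
    by (rule GA_mult[OF f GA_mult_closed[OF g h] fin(1), symmetric]) simp
  finally show "((f \<otimes>\<^bsub>GA\<^esub> g) \<otimes>\<^bsub>GA\<^esub> h) z = (f \<otimes>\<^bsub>GA\<^esub> (g \<otimes>\<^bsub>GA\<^esub> h)) z" .
qed

lemma point_mult:
  assumes "c \<in> carrier R" "f \<in> carrier GA"
  shows "(point g c \<otimes>\<^bsub>GA\<^esub> f) z = c \<otimes> f (- g + z)"
proof -
  have "(point g c \<otimes>\<^bsub>GA\<^esub> f) z = (\<Oplus>x\<in>{g}. point g c x \<otimes> f (- x + z))"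
    using assms point_closed by (intro GA_mult) (auto simp: point_def)
  then show ?thesis using assms by (simp add: point_def GA_simps)
qed

lemma mult_point:
  assumes "c \<in> carrier R" "f \<in> carrier GA"
  shows "(f \<otimes>\<^bsub>GA\<^esub> point g c) z = f (z - g) \<otimes> c"
proof -
  have fc: "f x \<in> carrier R" for x using assms by (simp add: GA_simps)
  have "(f \<otimes>\<^bsub>GA\<^esub> point g c) z = (\<Oplus>x\<in>insert (z - g) (supp f). f x \<otimes> point g c (- x + z))"
    using assms point_closed by (intro GA_mult) (auto simp: GA_simps)
  also have "\<dots> = (\<Oplus>x\<in>insert (z - g) (supp f). if z - g = x then f x \<otimes> c else \<zero>)"
  proof (intro finsum_cong')
    fix x
    have "- x + z = g \<longleftrightarrow> z - g = x"
      by (metis add.assoc add_diff_cancel diff_add_cancel minus_add_cancel add_minus_cancel)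
    then show "f x \<otimes> point g c (- x + z) = (if z - g = x then f x \<otimes> c else \<zero>)"
      using fc by (auto simp: point_def)
  qed (use fc assms in auto)
  also have "\<dots> = f (z - g) \<otimes> c"
    using fc assms by (intro add.finprod_singleton) (auto simp: GA_simps)
  finally show ?thesis .
qed

lemma ring_GA: "ring (GA :: ('g::group_add \<Rightarrow> 'a) ring)"
proof (intro ringI abelian_groupI monoidI)
  fix f g h :: "'g \<Rightarrow> 'a"
  assume f: "f \<in> carrier GA" and g: "g \<in> carrier GA"
  show "f \<oplus>\<^bsub>GA\<^esub> g \<in> carrier GA"
    using f g by (auto simp: GA_simps intro: finite_subset[of _ "supp f \<union> supp g"])
  show "f \<oplus>\<^bsub>GA\<^esub> g = g \<oplus>\<^bsub>GA\<^esub> f" using f g by (intro ext) (auto simp: GA_simps a_comm)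
  show "f \<otimes>\<^bsub>GA\<^esub> g \<in> carrier GA" by (rule GA_mult_closed[OF f g])
  show "\<zero>\<^bsub>GA\<^esub> \<oplus>\<^bsub>GA\<^esub> f = f" using f by (intro ext) (auto simp: GA_simps)
  show "\<one>\<^bsub>GA\<^esub> \<otimes>\<^bsub>GA\<^esub> f = f" using f by (intro ext) (simp add: GA_simps(4) point_mult, simp add: GA_simps)
  show "f \<otimes>\<^bsub>GA\<^esub> \<one>\<^bsub>GA\<^esub> = f" using f by (intro ext) (simp add: GA_simps(4) mult_point, simp add: GA_simps)
  show "\<exists>g\<in>carrier GA. g \<oplus>\<^bsub>GA\<^esub> f = \<zero>\<^bsub>GA\<^esub>"
    using f by (intro bexI[of _ "\<lambda>z. \<ominus> f z"] ext) (auto simp: GA_simps l_neg intro: finite_subset[of _ "supp f"])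
  assume h: "h \<in> carrier GA"
  show "f \<oplus>\<^bsub>GA\<^esub> g \<oplus>\<^bsub>GA\<^esub> h = f \<oplus>\<^bsub>GA\<^esub> (g \<oplus>\<^bsub>GA\<^esub> h)" using f g h by (intro ext) (auto simp: GA_simps a_assoc)
  show "f \<otimes>\<^bsub>GA\<^esub> g \<otimes>\<^bsub>GA\<^esub> h = f \<otimes>\<^bsub>GA\<^esub> (g \<otimes>\<^bsub>GA\<^esub> h)" by (rule GA_mult_assoc[OF f g h])
  have c: "f x \<in> carrier R" "g x \<in> carrier R" "h x \<in> carrier R" for x using f g h by (auto simp: GA_simps)
  have fin: "finite (supp f)" "finite (supp g)" "finite (supp h)" using f g h by (auto simp: GA_simps)
  have fg: "f \<oplus>\<^bsub>GA\<^esub> g \<in> carrier GA"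
    using f g by (auto simp: GA_simps intro: finite_subset[of _ "supp f \<union> supp g"])
  let ?A = "supp f \<union> supp g"
  show "(f \<oplus>\<^bsub>GA\<^esub> g) \<otimes>\<^bsub>GA\<^esub> h = f \<otimes>\<^bsub>GA\<^esub> h \<oplus>\<^bsub>GA\<^esub> g \<otimes>\<^bsub>GA\<^esub> h"
  proof
    fix z
    have A: "finite ?A" "supp f \<subseteq> ?A" "supp g \<subseteq> ?A" "supp (f \<oplus>\<^bsub>GA\<^esub> g) \<subseteq> ?A" using fin by (auto simp: GA_simps)
    have "((f \<oplus>\<^bsub>GA\<^esub> g) \<otimes>\<^bsub>GA\<^esub> h) z = (\<Oplus>x\<in>?A. f x \<otimes> h (- x + z) \<oplus> g x \<otimes> h (- x + z))"
      using c by (subst GA_mult[OF fg h A(1,4)]) (auto simp: GA_simps l_distr intro!: finsum_cong')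
    also have "\<dots> = (\<Oplus>x\<in>?A. f x \<otimes> h (- x + z)) \<oplus> (\<Oplus>x\<in>?A. g x \<otimes> h (- x + z))"
      using c by (intro finsum_addf) auto
    finally show "((f \<oplus>\<^bsub>GA\<^esub> g) \<otimes>\<^bsub>GA\<^esub> h) z = (f \<otimes>\<^bsub>GA\<^esub> h \<oplus>\<^bsub>GA\<^esub> g \<otimes>\<^bsub>GA\<^esub> h) z"
      by (simp add: GA_simps GA_mult[OF f h A(1,2)] GA_mult[OF g h A(1,3)])
  qed
  show "h \<otimes>\<^bsub>GA\<^esub> (f \<oplus>\<^bsub>GA\<^esub> g) = h \<otimes>\<^bsub>GA\<^esub> f \<oplus>\<^bsub>GA\<^esub> h \<otimes>\<^bsub>GA\<^esub> g"
  proof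
    fix z
    have "(h \<otimes>\<^bsub>GA\<^esub> (f \<oplus>\<^bsub>GA\<^esub> g)) z = (\<Oplus>x\<in>supp h. h x \<otimes> f (- x + z) \<oplus> h x \<otimes> g (- x + z))"
      using c by (subst GA_mult[OF h fg fin(3) subset_refl]) (auto simp: GA_simps r_distr intro!: finsum_cong')
    also have "\<dots> = (\<Oplus>x\<in>supp h. h x \<otimes> f (- x + z)) \<oplus> (\<Oplus>x\<in>supp h. h x \<otimes> g (- x + z))"
      using c by (intro finsum_addf) auto
    finally show "(h \<otimes>\<^bsub>GA\<^esub> (f \<oplus>\<^bsub>GA\<^esub> g)) z = (h \<otimes>\<^bsub>GA\<^esub> f \<oplus>\<^bsub>GA\<^esub> h \<otimes>\<^bsub>GA\<^esub> g) z"
      by (simp add: GA_simps GA_mult[OF h f fin(3) subset_refl] GA_mult[OF h g fin(3) subset_refl])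
  qed
qed (use point_closed in \<open>auto simp: GA_simps\<close>)

lemma point_zero_hom: "point 0 \<in> ring_hom R (GA :: ('g::group_add \<Rightarrow> 'a) ring)"
proof (intro ring_hom_memI)
  fix c d assume cd: "c \<in> carrier R" "d \<in> carrier R"
  show "point 0 c \<in> carrier GA" using point_closed cd by blast
  show "point 0 (c \<otimes> d) = point 0 c \<otimes>\<^bsub>GA\<^esub> point 0 d"
    using cd by (intro ext, subst point_mult[OF cd(1) point_closed[OF cd(2)]]) (auto simp: point_def)
  show "point 0 (c \<oplus> d) = point 0 c \<oplus>\<^bsub>GA\<^esub> point 0 d"
    using cd by (intro ext) (auto simp: point_def GA_simps)
qed (simp add: GA_simps)

lemma scalar_mult_GA: "c \<in> carrier R \<Longrightarrow> f \<in> carrier GA \<Longrightarrow> (point 0 c \<otimes>\<^bsub>GA\<^esub> f) z = c \<otimes> f z"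
  by (simp add: point_mult)

lemma central_algebra_GA: "central_algebra (GA :: ('g::group_add \<Rightarrow> 'a) ring) (point 0 ` carrier R)"
proof -
  interpret G: ring "GA :: ('g \<Rightarrow> 'a) ring" by (rule ring_GA)
  interpret h: ring_hom_ring R "GA :: ('g \<Rightarrow> 'a) ring" "point 0"
    using point_zero_hom ring_axioms G.ring_axioms by (intro ring_hom_ringI2)
  show ?thesis
  proof (intro central_algebra.intro central_algebra_axioms.intro G.ring_axioms)
    have "\<one>\<^bsub>GA\<^esub> \<noteq> (\<zero>\<^bsub>GA\<^esub> :: 'g \<Rightarrow> 'a)" by (auto simp: GA_simps point_def fun_eq_iff)
    then show "subfield (point 0 ` carrier R) (GA :: ('g \<Rightarrow> 'a) ring)"
      using h.img_is_subfield(2)[OF carrier_is_subfield] by simp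
    fix c f :: "'g \<Rightarrow> 'a" assume "c \<in> point 0 ` carrier R" and f: "f \<in> carrier GA"
    then obtain d where d: "d \<in> carrier R" "c = point 0 d" by auto
    have "f z \<in> carrier R" for z using f by (simp add: GA_simps)
    then show "c \<otimes>\<^bsub>GA\<^esub> f = f \<otimes>\<^bsub>GA\<^esub> c"
      using d f by (intro ext) (auto simp: point_mult mult_point m_comm)
  qed
qed

definition supported :: "'g::group_add set \<Rightarrow> ('g \<Rightarrow> 'a) set" where
  "supported P = {f \<in> carrier GA. supp f \<subseteq> P}"

text \<open>The monomials \<open>point g \<one>\<close> with \<open>g\<close> in \<open>P\<close>
  form a basis: each further element of \<open>P\<close> extends the space by one line.\<close>

lemma supported_dimension:
  assumes "finite (P :: 'g::group_add set)"
  shows "ring.dimension GA (card P) (point 0 ` carrier R) (supported P)"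
  using assms
proof (induction P rule: finite_induct)
  case empty
  interpret G: ring "GA :: ('g \<Rightarrow> 'a) ring" by (rule ring_GA)
  have "supported {} = {\<zero>\<^bsub>GA\<^esub> :: 'g \<Rightarrow> 'a}"
    using G.zero_closed by (auto simp: supported_def GA_simps(3))
  then show ?case using G.zero_dim by simp
next
  case (insert g P)
  interpret G: ring "GA :: ('g \<Rightarrow> 'a) ring" by (rule ring_GA)
  let ?K = "point 0 ` carrier R :: ('g \<Rightarrow> 'a) set"
  have p1: "point g \<one> \<in> carrier GA" by (simp add: point_closed)
  have "point g \<one> \<notin> supported P" using insert.hyps by (auto simp: supported_def point_def)
  then have "G.dimension (Suc (card P)) ?K (G.line_extension ?K (point g \<one>) (supported P))"
    using insert.IH p1 by (intro G.Suc_dim)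
  moreover have "G.line_extension ?K (point g \<one>) (supported P) = supported (insert g P)"
  proof (intro equalityI subsetI)
    fix f assume "f \<in> G.line_extension ?K (point g \<one>) (supported P)"
    then obtain c f' where *: "c \<in> carrier R" "f' \<in> supported P" "f = point 0 c \<otimes>\<^bsub>GA\<^esub> point g \<one> \<oplus>\<^bsub>GA\<^esub> f'"
      by (auto simp: G.line_extension_mem_iff)
    have "f z = c \<otimes> point g \<one> z \<oplus> f' z" for z using * by (simp add: GA_simps(2) scalar_mult_GA p1)
    moreover have "f' z = \<zero>" if "z \<notin> P" for z using *(2) that by (auto simp: supported_def)
    ultimately have "f z = \<zero>" if "z \<notin> insert g P" for z using that *(1) by (simp add: point_def)
    then have "supp f \<subseteq> insert g P" by blast
    moreover have "f \<in> carrier GA" using * p1 point_closed by (auto simp: supported_def)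
    ultimately show "f \<in> supported (insert g P)" by (simp add: supported_def)
  next
    fix f assume f: "f \<in> supported (insert g P)"
    then have fc: "f z \<in> carrier R" for z by (simp add: supported_def GA_simps)
    define f' where "f' = f(g := \<zero>)"
    have "f' \<in> supported P" using f by (auto simp: supported_def f'_def GA_simps intro: finite_subset[of _ "supp f"])
    moreover have "f = point 0 (f g) \<otimes>\<^bsub>GA\<^esub> point g \<one> \<oplus>\<^bsub>GA\<^esub> f'"
      using fc by (intro ext, unfold GA_simps(2) scalar_mult_GA[OF fc p1]) (auto simp: point_def f'_def)
    ultimately show "f \<in> G.line_extension ?K (point g \<one>) (supported P)"
      using fc unfolding G.line_extension_mem_iff by blast
  qed
  ultimately show ?case using insert.hyps by simp
qed

definition lead :: "('g::linorder \<Rightarrow> 'a) \<Rightarrow> 'g" where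
  "lead f = Max (supp f)"

lemma lead_props:
  assumes "f \<in> carrier GA" "f \<noteq> \<zero>\<^bsub>GA\<^esub>"
  shows "f (lead f) \<noteq> \<zero>" "\<And>z. lead f < z \<Longrightarrow> f z = \<zero>"
proof -
  have fin: "finite (supp f)" "supp f \<noteq> {}" using assms by (auto simp: GA_simps)
  show "f (lead f) \<noteq> \<zero>" using Max_in[OF fin] by (simp add: lead_def)
  show "f z = \<zero>" if "lead f < z" for z
    using that Max_ge[OF fin(1), of z] unfolding lead_def by (meson mem_Collect_eq not_le)
qed

lemma lead_unique:
  assumes "f \<in> carrier GA" "f g \<noteq> \<zero>" "\<And>z. g < z \<Longrightarrow> f z = \<zero>"
  shows "lead f = g"
  unfolding lead_def using assms by (intro Max_eqI) (auto simp: GA_simps, meson not_le)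

text \<open>By invariance of the order, \<open>lead f + lead h\<close> arises in one way only as a
  sum of support elements and exceeds all other sums; its coefficient is a product of two nonzero
  scalars.\<close>

lemma lead_mult:
  fixes f h :: "'g::bi_ordered_group \<Rightarrow> 'a"
  assumes f: "f \<in> carrier GA" "f \<noteq> \<zero>\<^bsub>GA\<^esub>" and h: "h \<in> carrier GA" "h \<noteq> \<zero>\<^bsub>GA\<^esub>"
  shows "f \<otimes>\<^bsub>GA\<^esub> h \<noteq> \<zero>\<^bsub>GA\<^esub>" "lead (f \<otimes>\<^bsub>GA\<^esub> h) = lead f + lead h"
proof -
  note lf = lead_props[OF f] and lh = lead_props[OF h]
  have c: "f x \<in> carrier R" "h x \<in> carrier R" for x using f h by (auto simp: GA_simps)
  have fin: "finite (supp f)" using f by (simp add: GA_simps)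
  have val: "(f \<otimes>\<^bsub>GA\<^esub> h) z = (\<Oplus>x\<in>supp f. f x \<otimes> h (- x + z))" for z
    by (rule GA_mult[OF f(1) h(1) fin]) simp
  have small: "x \<le> lead f" if "x \<in> supp f" for x using lf(2)[of x] that by (meson mem_Collect_eq not_le)
  have big: "lead h < - x + z" if "lead f + lead h < z" "x \<in> supp f" for x z
  proof -
    have "x + lead h \<le> lead f + lead h"
      using small[OF that(2)] less_imp_le[OF add_less_right[of x "lead f" "lead h"]] by (cases "x = lead f") auto
    then have "x + lead h < z" using that by simp
    from add_less_left[OF this, of "- x"] show ?thesis by (simp flip: add.assoc)
  qed
  have zero: "(f \<otimes>\<^bsub>GA\<^esub> h) z = \<zero>" if "lead f + lead h < z" for z
    unfolding val using lh(2)[OF big[OF that]] c by (intro add.finprod_one_eqI) auto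
  have "(f \<otimes>\<^bsub>GA\<^esub> h) (lead f + lead h) = (\<Oplus>x\<in>supp f. if lead f = x then f x \<otimes> h (lead h) else \<zero>)"
    unfolding val
  proof (intro finsum_cong')
    fix x assume x: "x \<in> supp f"
    show "f x \<otimes> h (- x + (lead f + lead h)) = (if lead f = x then f x \<otimes> h (lead h) else \<zero>)"
    proof (cases "lead f = x")
      case True
      then show ?thesis by (simp flip: add.assoc)
    next
      case False
      then have "x < lead f" using small[OF x] by simp
      from add_less_right[OF add_less_left[OF this, of "- x"], of "lead h"]
      have "lead h < - x + (lead f + lead h)" by (simp add: add.assoc)
      then show ?thesis using False lh(2) c by simp
    qed
  qed (use c in auto)
  also have "\<dots> = f (lead f) \<otimes> h (lead h)" using lf(1) fin c by (intro add.finprod_singleton) auto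
  also have "\<dots> \<noteq> \<zero>" using lf lh c integral by blast
  finally have nz: "(f \<otimes>\<^bsub>GA\<^esub> h) (lead f + lead h) \<noteq> \<zero>" .
  then show "f \<otimes>\<^bsub>GA\<^esub> h \<noteq> \<zero>\<^bsub>GA\<^esub>" by (auto simp: GA_simps(3) fun_eq_iff)
  show "lead (f \<otimes>\<^bsub>GA\<^esub> h) = lead f + lead h"
    by (rule lead_unique[OF GA_mult_closed[OF f(1) h(1)] nz zero])
qed

lemma lead_add_less:
  fixes f h :: "'g::bi_ordered_group \<Rightarrow> 'a"
  assumes "f \<in> carrier GA" "h \<in> carrier GA" "f \<oplus>\<^bsub>GA\<^esub> h \<noteq> \<zero>\<^bsub>GA\<^esub>"
    "f \<noteq> \<zero>\<^bsub>GA\<^esub> \<Longrightarrow> lead f < g" "h \<noteq> \<zero>\<^bsub>GA\<^esub> \<Longrightarrow> lead h < g"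
  shows "lead (f \<oplus>\<^bsub>GA\<^esub> h) < g"
proof (rule ccontr)
  interpret G: ring "GA :: ('g \<Rightarrow> 'a) ring" by (rule ring_GA)
  assume "\<not> ?thesis"
  then have le: "g \<le> lead (f \<oplus>\<^bsub>GA\<^esub> h)" by simp
  have van: "u (lead (f \<oplus>\<^bsub>GA\<^esub> h)) = \<zero>" if "u \<in> carrier GA" "u \<noteq> \<zero>\<^bsub>GA\<^esub> \<Longrightarrow> lead u < g" for u
    using lead_props(2)[of u] that le by (cases "u = \<zero>\<^bsub>GA\<^esub>") (auto simp: GA_simps(3))
  have "(f \<oplus>\<^bsub>GA\<^esub> h) (lead (f \<oplus>\<^bsub>GA\<^esub> h)) = \<zero>"
    using van[of f] van[of h] assms by (simp add: GA_simps(2))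
  then show False using lead_props(1)[of "f \<oplus>\<^bsub>GA\<^esub> h"] assms by blast
qed

text \<open>Two nonzero elements without common right multiple would double the dimension of every
  \<open>supported F\<close>.\<close>

lemma right_Ore_GA:
  fixes a b :: "'g::bi_ordered_group \<Rightarrow> 'a"
  assumes folner: "\<And>A :: 'g set. finite A \<Longrightarrow> \<exists>F. finite F \<and> F \<noteq> {} \<and> card ((\<lambda>(x, y). x + y) ` (A \<times> F)) < 2 * card F"
    and a: "a \<in> carrier GA" "a \<noteq> \<zero>\<^bsub>GA\<^esub>" and b: "b \<in> carrier GA" "b \<noteq> \<zero>\<^bsub>GA\<^esub>"
  shows "\<exists>u\<in>carrier GA. \<exists>v\<in>carrier GA. u \<noteq> \<zero>\<^bsub>GA\<^esub> \<and> v \<noteq> \<zero>\<^bsub>GA\<^esub> \<and> a \<otimes>\<^bsub>GA\<^esub> u = b \<otimes>\<^bsub>GA\<^esub> v"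
proof (rule ccontr)
  assume no: "\<not> ?thesis"
  let ?K = "point 0 ` carrier R :: ('g \<Rightarrow> 'a) set"
  interpret G: central_algebra "GA :: ('g \<Rightarrow> 'a) ring" ?K by (rule central_algebra_GA)
  define A where "A = supp a \<union> supp b"
  have finA: "finite A" using a b by (auto simp: A_def GA_simps)
  obtain F where F: "finite F" "F \<noteq> {}" "card ((\<lambda>(x, y). x + y) ` (A \<times> F)) < 2 * card F"
    using folner[OF finA] by blast
  define P where "P = (\<lambda>(x, y). x + y) ` (A \<times> F)"
  have finP: "finite P" using finA F by (simp add: P_def)
  have Wc: "supported Q \<subseteq> carrier GA" for Q :: "'g set" by (auto simp: supported_def)
  have fdW: "G.finite_dimension ?K (supported Q)" and dimW: "G.dim ?K (supported Q) = card Q" if "finite Q" for Q :: "'g set"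
    using supported_dimension[OF that] G.finite_dimensionI G.dimI' by auto
  have img: "(\<lambda>w. c \<otimes>\<^bsub>GA\<^esub> w) ` supported F \<subseteq> supported P" if "c \<in> carrier GA" "supp c \<subseteq> A" for c
  proof
    fix y assume "y \<in> (\<lambda>w. c \<otimes>\<^bsub>GA\<^esub> w) ` supported F"
    then obtain w where w: "w \<in> carrier GA" "supp w \<subseteq> F" "y = c \<otimes>\<^bsub>GA\<^esub> w" by (auto simp: supported_def)
    have "(\<lambda>(x, y). x + y) ` (supp c \<times> supp w) \<subseteq> P" unfolding P_def using that(2) w(2) by (intro image_mono Sigma_mono) auto
    then show "y \<in> supported P"
      using supp_mult_subset[OF that(1) w(1)] GA_mult_closed[OF that(1) w(1)] w(3) unfolding supported_def by blast
  qed
  \<comment> \<open>Left multiplication by a nonzero \<open>c\<close> is injective by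
    \<open>lead_mult\<close>, so it preserves dimension.\<close>
  have dims: "G.dimension (card F) ?K ((\<lambda>w. c \<otimes>\<^bsub>GA\<^esub> w) ` supported F)" if "c \<in> carrier GA" "c \<noteq> \<zero>\<^bsub>GA\<^esub>" for c
  proof -
    have lin: "G.linear_on (supported F) (\<lambda>w. c \<otimes>\<^bsub>GA\<^esub> w)" by (rule G.linear_on_lmult[OF Wc that(1)])
    have "w = \<zero>\<^bsub>GA\<^esub>" if "w \<in> supported F" "c \<otimes>\<^bsub>GA\<^esub> w = \<zero>\<^bsub>GA\<^esub>" for w
      using lead_mult(1)[OF \<open>c \<in> carrier GA\<close> \<open>c \<noteq> \<zero>\<^bsub>GA\<^esub>\<close> subsetD[OF Wc that(1)]] that(2) by blast
    then have "G.dim ?K ((\<lambda>w. c \<otimes>\<^bsub>GA\<^esub> w) ` supported F) = card F"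
      using G.dim_image_inj[OF fdW[OF F(1)] lin] dimW[OF F(1)] by simp
    then show ?thesis
      using G.finite_dimensionE[OF G.subfield_K G.linear_image_finite_dimension[OF fdW[OF F(1)] lin]] by (simp add: over_def)
  qed
  let ?aW = "(\<lambda>w. a \<otimes>\<^bsub>GA\<^esub> w) ` supported F" and ?bW = "(\<lambda>w. b \<otimes>\<^bsub>GA\<^esub> w) ` supported F"
  have "?aW \<inter> ?bW \<subseteq> {\<zero>\<^bsub>GA\<^esub>}"
  proof
    fix y assume "y \<in> ?aW \<inter> ?bW"
    then obtain u v where uv: "u \<in> carrier GA" "v \<in> carrier GA" "y = a \<otimes>\<^bsub>GA\<^esub> u" "y = b \<otimes>\<^bsub>GA\<^esub> v" using Wc by blast
    then have "u = \<zero>\<^bsub>GA\<^esub> \<or> v = \<zero>\<^bsub>GA\<^esub>" using no by metis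
    then show "y \<in> {\<zero>\<^bsub>GA\<^esub>}" using uv a b by auto
  qed
  moreover have "\<zero>\<^bsub>GA\<^esub> \<in> ?aW \<inter> ?bW"
    using G.subalgebraD(2)[OF G.finite_dimension_subalgebra[OF G.finite_dimensionI[OF dims[OF a]]]]
      G.subalgebraD(2)[OF G.finite_dimension_subalgebra[OF G.finite_dimensionI[OF dims[OF b]]]] by blast
  ultimately have "?aW \<inter> ?bW = {\<zero>\<^bsub>GA\<^esub>}" by blast
  \<comment> \<open>The two images meet only in zero, so their sum has dimension
    \<open>2 * card F\<close>; yet it lies in \<open>supported P\<close>, whose dimension is
    smaller.\<close>
  then have sum: "G.dimension (card F + card F) ?K (?aW <+>\<^bsub>GA\<^esub> ?bW)"
    using G.dimension_direct_sum_space[OF G.subfield_K dims[OF a] dims[OF b]] by simp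
  have "?aW <+>\<^bsub>GA\<^esub> ?bW \<subseteq> supported P"
    using img[OF a(1)] img[OF b(1)] G.subalgebraD(3)[OF G.finite_dimension_subalgebra[OF fdW[OF finP]]]
    unfolding A_def set_add_def' by blast
  then have "G.dim ?K (?aW <+>\<^bsub>GA\<^esub> ?bW) \<le> G.dim ?K (supported P)"
    using G.finite_dimension_subalgebra[OF G.finite_dimensionI[OF sum]] by (intro G.dim_mono(2) fdW finP)
  then show False using G.dimI'[OF sum] dimW[OF finP] F(3) by (simp add: P_def)
qed

end

section \<open>Ore localisation\<close>

locale right_Ore_domain = ring +
  assumes nontrivial: "\<one> \<noteq> \<zero>"
    and no_zero_div: "a \<in> carrier R \<Longrightarrow> b \<in> carrier R \<Longrightarrow> a \<otimes> b = \<zero> \<Longrightarrow> a = \<zero> \<or> b = \<zero>"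
    and Ore: "a \<in> carrier R \<Longrightarrow> b \<in> carrier R \<Longrightarrow> a \<noteq> \<zero> \<Longrightarrow> b \<noteq> \<zero> \<Longrightarrow>
      \<exists>u\<in>carrier R. \<exists>v\<in>carrier R. u \<noteq> \<zero> \<and> v \<noteq> \<zero> \<and> a \<otimes> u = b \<otimes> v"
begin

definition nz :: "'a set" where "nz = carrier R - {\<zero>}"

lemma nzD: "x \<in> nz \<Longrightarrow> x \<in> carrier R"
  and one_nz: "\<one> \<in> nz"
  and mult_nz: "x \<in> nz \<Longrightarrow> y \<in> nz \<Longrightarrow> x \<otimes> y \<in> nz"
  using nontrivial no_zero_div by (auto simp: nz_def)

lemma Ore_nz: "a \<in> nz \<Longrightarrow> b \<in> nz \<Longrightarrow> \<exists>u\<in>nz. \<exists>v\<in>nz. a \<otimes> u = b \<otimes> v"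
  using Ore[of a b] by (auto simp: nz_def)

text \<open>Extends the common multiple property to a possibly zero \<open>x\<close>; only the
  multiplier \<open>s\<close> is then guaranteed to be nonzero.\<close>

lemma Ore_num:
  assumes "x \<in> carrier R" "b \<in> nz"
  shows "\<exists>s\<in>nz. \<exists>r\<in>carrier R. x \<otimes> s = b \<otimes> r"
proof (cases "x = \<zero>")
  case True
  then show ?thesis using one_nz assms nzD by (intro bexI[of _ \<one>] bexI[of _ \<zero>]) auto
next
  case False
  then show ?thesis using Ore_nz[of x b] assms nzD by (auto simp: nz_def)
qed

lemma l_cancel: "b \<in> nz \<Longrightarrow> x \<in> carrier R \<Longrightarrow> y \<in> carrier R \<Longrightarrow> b \<otimes> x = b \<otimes> y \<Longrightarrow> x = y"
proof -
  assume a: "b \<in> nz" "x \<in> carrier R" "y \<in> carrier R" "b \<otimes> x = b \<otimes> y"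
  then have bc: "b \<in> carrier R" by (simp add: nzD)
  have "b \<otimes> (x \<ominus> y) = b \<otimes> x \<ominus> b \<otimes> y" using a bc by (simp add: a_minus_def r_distr r_minus)
  also have "\<dots> = \<zero>" using a bc by (simp add: a_minus_def r_neg)
  finally have "x \<ominus> y = \<zero>" using no_zero_div[of b "x \<ominus> y"] a bc by (auto simp: nz_def)
  then show "x = y" using a by simp
qed

lemma r_cancel: "b \<in> nz \<Longrightarrow> x \<in> carrier R \<Longrightarrow> y \<in> carrier R \<Longrightarrow> x \<otimes> b = y \<otimes> b \<Longrightarrow> x = y"
proof -
  assume a: "b \<in> nz" "x \<in> carrier R" "y \<in> carrier R" "x \<otimes> b = y \<otimes> b"
  then have bc: "b \<in> carrier R" by (simp add: nzD)
  have "(x \<ominus> y) \<otimes> b = x \<otimes> b \<ominus> y \<otimes> b" using a bc by (simp add: a_minus_def l_distr l_minus)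
  also have "\<dots> = \<zero>" using a bc by (simp add: a_minus_def r_neg)
  finally have "x \<ominus> y = \<zero>" using no_zero_div[of "x \<ominus> y" b] a bc by (auto simp: nz_def)
  then show "x = y" using a by simp
qed

text \<open>The fraction \<open>a b\<^sup>-\<^sup>1\<close> is encoded as the graph of left multiplication by it on \<open>R\<close>; a graph is
  determined by any of its pairs with nonzero first component.\<close>

definition frac :: "'a \<Rightarrow> 'a \<Rightarrow> ('a \<times> 'a) set" where
  "frac a b = {(x, y). x \<in> carrier R \<and> y \<in> carrier R \<and>
     (\<exists>s\<in>nz. \<exists>r\<in>carrier R. x \<otimes> s = b \<otimes> r \<and> y \<otimes> s = a \<otimes> r)}"

definition fracs :: "('a \<times> 'a) set set" where
  "fracs = {frac a b | a b. a \<in> carrier R \<and> b \<in> nz}"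

lemma frac_mem: "a \<in> carrier R \<Longrightarrow> b \<in> nz \<Longrightarrow> (b, a) \<in> frac a b"
  using one_nz nzD by (auto simp: frac_def intro!: bexI[of _ \<one>])

lemma frac_in_fracs: "a \<in> carrier R \<Longrightarrow> b \<in> nz \<Longrightarrow> frac a b \<in> fracs"
  by (auto simp: fracs_def)

lemma frac_subset:
  assumes ab: "a \<in> carrier R" "b \<in> nz" and xy: "(x, y) \<in> frac a b" and x: "x \<in> nz"
  shows "frac y x \<subseteq> frac a b"
proof
  fix p assume "p \<in> frac y x"
  then obtain z w s' r' where p: "p = (z, w)" "z \<in> carrier R" "w \<in> carrier R" "s' \<in> nz" "r' \<in> carrier R"
    "z \<otimes> s' = x \<otimes> r'" "w \<otimes> s' = y \<otimes> r'" by (auto simp: frac_def)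
  obtain s r where s: "s \<in> nz" "r \<in> carrier R" "x \<otimes> s = b \<otimes> r" "y \<otimes> s = a \<otimes> r" "y \<in> carrier R"
    using xy by (auto simp: frac_def)
  obtain t q where t: "t \<in> nz" "q \<in> carrier R" "r' \<otimes> t = s \<otimes> q" using Ore_num[OF p(5) s(1)] by auto
  note c = nzD[OF ab(2)] nzD[OF x] nzD[OF s(1)] nzD[OF t(1)] nzD[OF p(4)]
  have "z \<otimes> (s' \<otimes> t) = z \<otimes> s' \<otimes> t" using p(2,5) c by (simp add: m_assoc)
  also have "\<dots> = x \<otimes> (r' \<otimes> t)" unfolding p(6) using p(2,5) c by (simp add: m_assoc)
  also have "\<dots> = x \<otimes> s \<otimes> q" unfolding t(3) using c s(2,5) t(2) by (simp add: m_assoc)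
  also have "\<dots> = b \<otimes> (r \<otimes> q)" unfolding s(3) using c s(2,5) t(2) by (simp add: m_assoc)
  finally have 1: "z \<otimes> (s' \<otimes> t) = b \<otimes> (r \<otimes> q)" .
  have "w \<otimes> (s' \<otimes> t) = w \<otimes> s' \<otimes> t" using p(3,5) c by (simp add: m_assoc)
  also have "\<dots> = y \<otimes> (r' \<otimes> t)" unfolding p(7) using p(5) c s(5) by (simp add: m_assoc)
  also have "\<dots> = y \<otimes> s \<otimes> q" unfolding t(3) using c s(2,5) t(2) by (simp add: m_assoc)
  also have "\<dots> = a \<otimes> (r \<otimes> q)" unfolding s(4) using c s(2,5) t(2) ab(1) by (simp add: m_assoc)
  finally have 2: "w \<otimes> (s' \<otimes> t) = a \<otimes> (r \<otimes> q)" .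
  have "r \<otimes> q \<in> carrier R" using s t by simp
  with 1 2 show "p \<in> frac a b" unfolding frac_def using p mult_nz[OF p(4) t(1)] by blast
qed

lemma frac_eq:
  assumes ab: "a \<in> carrier R" "b \<in> nz" and xy: "(x, y) \<in> frac a b" and x: "x \<in> nz"
  shows "frac y x = frac a b"
proof
  show "frac y x \<subseteq> frac a b" by (rule frac_subset[OF assms])
  obtain s r where s: "s \<in> nz" "r \<in> carrier R" "x \<otimes> s = b \<otimes> r" "y \<otimes> s = a \<otimes> r" "y \<in> carrier R"
    using xy by (auto simp: frac_def)
  have "b \<otimes> r \<noteq> \<zero>" using mult_nz[OF x s(1)] s(3) by (simp add: nz_def)
  then have r: "r \<in> nz" using s(2) nzD[OF ab(2)] by (auto simp: nz_def)
  \<comment> \<open>The witnesses \<open>s\<close> and \<open>r\<close> exchange their roles;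
    \<open>r\<close> is nonzero because \<open>b \<otimes> r = x \<otimes> s\<close> is.\<close>
  have "(b, a) \<in> frac y x"
    unfolding frac_def mem_Collect_eq prod.case
    by (intro conjI bexI[of _ r] bexI[of _ s] nzD[OF s(1)] nzD[OF ab(2)] ab(1) s(3,4)[symmetric] r)
  then show "frac a b \<subseteq> frac y x" by (rule frac_subset[OF s(5) x _ ab(2)])
qed

lemma fracs_carrier: "\<Gamma> \<in> fracs \<Longrightarrow> (x, y) \<in> \<Gamma> \<Longrightarrow> x \<in> carrier R \<and> y \<in> carrier R"
  by (auto simp: fracs_def frac_def)

lemma fracs_eq_frac: "\<Gamma> \<in> fracs \<Longrightarrow> (x, y) \<in> \<Gamma> \<Longrightarrow> x \<in> nz \<Longrightarrow> \<Gamma> = frac y x"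
  unfolding fracs_def using frac_eq[symmetric] by blast

lemma fracs_eqI: "\<Gamma> \<in> fracs \<Longrightarrow> \<Delta> \<in> fracs \<Longrightarrow> (x, y) \<in> \<Gamma> \<Longrightarrow> (x, y) \<in> \<Delta> \<Longrightarrow> x \<in> nz \<Longrightarrow> \<Gamma> = \<Delta>"
  using fracs_eq_frac by blast

text \<open>Together with \<open>fracs_add\<close>, this makes each graph a right submodule of
  pairs: left multiplication by a fraction commutes with right multiplication by
  \<open>r\<close>.\<close>

lemma fracs_smult:
  assumes "\<Gamma> \<in> fracs" "(x, y) \<in> \<Gamma>" "r \<in> carrier R"
  shows "(x \<otimes> r, y \<otimes> r) \<in> \<Gamma>"
proof -
  obtain a b where ab: "a \<in> carrier R" "b \<in> nz" "\<Gamma> = frac a b" using assms(1) by (auto simp: fracs_def)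
  then obtain s r0 where s: "s \<in> nz" "r0 \<in> carrier R" "x \<otimes> s = b \<otimes> r0" "y \<otimes> s = a \<otimes> r0" "x \<in> carrier R" "y \<in> carrier R"
    using assms(2) by (auto simp: frac_def)
  obtain t q where t: "t \<in> nz" "q \<in> carrier R" "r \<otimes> t = s \<otimes> q" using Ore_num[OF assms(3) s(1)] by auto
  note c = nzD[OF ab(2)] nzD[OF s(1)] nzD[OF t(1)]
  have "x \<otimes> r \<otimes> t = x \<otimes> (s \<otimes> q)" using c s t assms(3) by (simp add: m_assoc)
  also have "\<dots> = b \<otimes> (r0 \<otimes> q)" using c s t by (simp flip: m_assoc)
  finally have 1: "x \<otimes> r \<otimes> t = b \<otimes> (r0 \<otimes> q)" .
  have "y \<otimes> r \<otimes> t = y \<otimes> (s \<otimes> q)" using c s t assms(3) by (simp add: m_assoc)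
  also have "\<dots> = a \<otimes> (r0 \<otimes> q)" using c s t ab by (simp flip: m_assoc)
  finally have 2: "y \<otimes> r \<otimes> t = a \<otimes> (r0 \<otimes> q)" .
  have "r0 \<otimes> q \<in> carrier R" "x \<otimes> r \<in> carrier R" "y \<otimes> r \<in> carrier R" using s t assms(3) by auto
  with 1 2 t(1) show ?thesis unfolding ab(3) frac_def by blast
qed

lemma fracs_total:
  assumes "\<Gamma> \<in> fracs" "x \<in> carrier R"
  shows "\<exists>s\<in>nz. \<exists>y\<in>carrier R. (x \<otimes> s, y) \<in> \<Gamma>"
proof -
  obtain a b where ab: "a \<in> carrier R" "b \<in> nz" "\<Gamma> = frac a b" using assms(1) by (auto simp: fracs_def)
  obtain s r where s: "s \<in> nz" "r \<in> carrier R" "x \<otimes> s = b \<otimes> r" using Ore_num[OF assms(2) ab(2)] by auto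
  then have "(x \<otimes> s, a \<otimes> r) \<in> \<Gamma>"
    using fracs_smult[OF assms(1), of b a r] frac_mem[OF ab(1,2)] ab(3) by simp
  then show ?thesis using s ab by blast
qed

text \<open>The two witnesses are brought to a common right multiple, after which \<open>b\<close>
  is cancelled on the left and the multiple on the right.\<close>

lemma fracs_functional:
  assumes "\<Gamma> \<in> fracs" "(x, y) \<in> \<Gamma>" "(x, y') \<in> \<Gamma>"
  shows "y = y'"
proof -
  obtain a b where ab: "a \<in> carrier R" "b \<in> nz" "\<Gamma> = frac a b" using assms(1) by (auto simp: fracs_def)
  obtain s r where s: "s \<in> nz" "r \<in> carrier R" "x \<otimes> s = b \<otimes> r" "y \<otimes> s = a \<otimes> r" "x \<in> carrier R" "y \<in> carrier R"
    using assms(2) ab by (auto simp: frac_def)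
  obtain s' r' where s': "s' \<in> nz" "r' \<in> carrier R" "x \<otimes> s' = b \<otimes> r'" "y' \<otimes> s' = a \<otimes> r'" "y' \<in> carrier R"
    using assms(3) ab by (auto simp: frac_def)
  obtain p p' where p: "p \<in> nz" "p' \<in> nz" "s \<otimes> p = s' \<otimes> p'" using Ore_nz[OF s(1) s'(1)] by auto
  note c = nzD[OF ab(2)] nzD[OF s(1)] nzD[OF s'(1)] nzD[OF p(1)] nzD[OF p(2)]
  have "b \<otimes> (r \<otimes> p) = x \<otimes> (s \<otimes> p)" using c s by (simp flip: m_assoc)
  also have "\<dots> = b \<otimes> (r' \<otimes> p')" unfolding p(3) using c s s' by (simp flip: m_assoc)
  finally have rp: "r \<otimes> p = r' \<otimes> p'" using l_cancel[OF ab(2)] s s' c by simp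
  have "y \<otimes> (s \<otimes> p) = a \<otimes> (r \<otimes> p)" using c s ab by (simp flip: m_assoc)
  also have "\<dots> = y' \<otimes> (s' \<otimes> p')" unfolding rp using c s s' ab by (simp flip: m_assoc)
  finally have "y \<otimes> (s \<otimes> p) = y' \<otimes> (s \<otimes> p)" using p(3) by simp
  then show ?thesis using r_cancel[OF mult_nz[OF s(1) p(1)]] s s' by simp
qed

lemma fracs_add:
  assumes "\<Gamma> \<in> fracs" "(x, y) \<in> \<Gamma>" "(x', y') \<in> \<Gamma>"
  shows "(x \<oplus> x', y \<oplus> y') \<in> \<Gamma>"
proof -
  obtain a b where ab: "a \<in> carrier R" "b \<in> nz" "\<Gamma> = frac a b" using assms(1) by (auto simp: fracs_def)
  obtain s r where s: "s \<in> nz" "r \<in> carrier R" "x \<otimes> s = b \<otimes> r" "y \<otimes> s = a \<otimes> r" "x \<in> carrier R" "y \<in> carrier R"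
    using assms(2) ab by (auto simp: frac_def)
  obtain s' r' where s': "s' \<in> nz" "r' \<in> carrier R" "x' \<otimes> s' = b \<otimes> r'" "y' \<otimes> s' = a \<otimes> r'" "x' \<in> carrier R" "y' \<in> carrier R"
    using assms(3) ab by (auto simp: frac_def)
  obtain p p' where p: "p \<in> nz" "p' \<in> nz" "s \<otimes> p = s' \<otimes> p'" using Ore_nz[OF s(1) s'(1)] by auto
  note c = nzD[OF ab(2)] nzD[OF s(1)] nzD[OF s'(1)] nzD[OF p(1)] nzD[OF p(2)]
  have "(x \<oplus> x') \<otimes> (s \<otimes> p) = x \<otimes> (s \<otimes> p) \<oplus> x' \<otimes> (s' \<otimes> p')" using c s s' p(3) by (simp add: l_distr)
  also have "\<dots> = b \<otimes> (r \<otimes> p \<oplus> r' \<otimes> p')" using c s s' by (simp add: r_distr flip: m_assoc)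
  finally have 1: "(x \<oplus> x') \<otimes> (s \<otimes> p) = b \<otimes> (r \<otimes> p \<oplus> r' \<otimes> p')" .
  have "(y \<oplus> y') \<otimes> (s \<otimes> p) = y \<otimes> (s \<otimes> p) \<oplus> y' \<otimes> (s' \<otimes> p')" using c s s' p(3) by (simp add: l_distr)
  also have "\<dots> = a \<otimes> (r \<otimes> p \<oplus> r' \<otimes> p')" using c s s' ab by (simp add: r_distr flip: m_assoc)
  finally have 2: "(y \<oplus> y') \<otimes> (s \<otimes> p) = a \<otimes> (r \<otimes> p \<oplus> r' \<otimes> p')" .
  have "r \<otimes> p \<oplus> r' \<otimes> p' \<in> carrier R" using s s' c by simp
  with 1 2 mult_nz[OF s(1) p(1)] s s' show ?thesis unfolding ab(3) frac_def by blast
qed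

text \<open>Pointwise sum of the two graphs at some common argument \<open>x\<close>;
  \<open>fadd_eq\<close> shows that the choice does not matter.\<close>

definition fadd :: "('a \<times> 'a) set \<Rightarrow> ('a \<times> 'a) set \<Rightarrow> ('a \<times> 'a) set" where
  "fadd \<Gamma> \<Delta> = (SOME \<Lambda>. \<exists>x u v. x \<in> nz \<and> (x, u) \<in> \<Gamma> \<and> (x, v) \<in> \<Delta> \<and> \<Lambda> = frac (u \<oplus> v) x)"

text \<open>Composition of the two partial maps, \<open>\<Delta>\<close> being applied
  first.\<close>

definition fmult :: "('a \<times> 'a) set \<Rightarrow> ('a \<times> 'a) set \<Rightarrow> ('a \<times> 'a) set" where
  "fmult \<Gamma> \<Delta> = (SOME \<Lambda>. \<exists>x y z. x \<in> nz \<and> (x, y) \<in> \<Delta> \<and> (y, z) \<in> \<Gamma> \<and> \<Lambda> = frac z x)"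

text \<open>Two admissible arguments have a common right multiple \<open>x p = x' p'\<close>, at
  which both candidate fractions take the same value; one such value determines a fraction.\<close>

lemma fadd_eq:
  assumes G: "\<Gamma> \<in> fracs" and D: "\<Delta> \<in> fracs" and x: "x \<in> nz" "(x, u) \<in> \<Gamma>" "(x, v) \<in> \<Delta>"
  shows "fadd \<Gamma> \<Delta> = frac (u \<oplus> v) x"
proof -
  obtain x' u' v' where *: "x' \<in> nz" "(x', u') \<in> \<Gamma>" "(x', v') \<in> \<Delta>" "fadd \<Gamma> \<Delta> = frac (u' \<oplus> v') x'"
    using someI[of "\<lambda>\<Lambda>. \<exists>x u v. x \<in> nz \<and> (x, u) \<in> \<Gamma> \<and> (x, v) \<in> \<Delta> \<and> \<Lambda> = frac (u \<oplus> v) x" "frac (u \<oplus> v) x"] x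
    unfolding fadd_def by blast
  obtain p p' where p: "p \<in> nz" "p' \<in> nz" "x \<otimes> p = x' \<otimes> p'" using Ore_nz[OF x(1) *(1)] by auto
  note c = nzD[OF p(1)] nzD[OF p(2)] fracs_carrier[OF G x(2)] fracs_carrier[OF D x(3)] fracs_carrier[OF G *(2)] fracs_carrier[OF D *(3)]
  have "u \<otimes> p = u' \<otimes> p'" "v \<otimes> p = v' \<otimes> p'"
    using fracs_functional[OF G fracs_smult[OF G x(2) nzD[OF p(1)]]] fracs_smult[OF G *(2) nzD[OF p(2)]]
      fracs_functional[OF D fracs_smult[OF D x(3) nzD[OF p(1)]]] fracs_smult[OF D *(3) nzD[OF p(2)]] p(3) by auto
  then have eq: "(u \<oplus> v) \<otimes> p = (u' \<oplus> v') \<otimes> p'" using c by (simp add: l_distr)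
  have F: "frac (u \<oplus> v) x \<in> fracs" "frac (u' \<oplus> v') x' \<in> fracs" using c x * by (auto intro: frac_in_fracs)
  have "(x \<otimes> p, (u \<oplus> v) \<otimes> p) \<in> frac (u \<oplus> v) x" "(x' \<otimes> p', (u' \<oplus> v') \<otimes> p') \<in> frac (u' \<oplus> v') x'"
    using c x * F by (auto intro!: fracs_smult frac_mem)
  then have "frac (u \<oplus> v) x = frac (u' \<oplus> v') x'"
    using fracs_eqI[OF F, of "x \<otimes> p" "(u \<oplus> v) \<otimes> p"] p(3) eq mult_nz[OF x(1) p(1)] by simp
  then show ?thesis using *(4) by simp
qed

lemma fmult_eq:
  assumes G: "\<Gamma> \<in> fracs" and D: "\<Delta> \<in> fracs" and x: "x \<in> nz" "(x, y) \<in> \<Delta>" "(y, z) \<in> \<Gamma>"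
  shows "fmult \<Gamma> \<Delta> = frac z x"
proof -
  obtain x' y' z' where *: "x' \<in> nz" "(x', y') \<in> \<Delta>" "(y', z') \<in> \<Gamma>" "fmult \<Gamma> \<Delta> = frac z' x'"
    using someI[of "\<lambda>\<Lambda>. \<exists>x y z. x \<in> nz \<and> (x, y) \<in> \<Delta> \<and> (y, z) \<in> \<Gamma> \<and> \<Lambda> = frac z x" "frac z x"] x
    unfolding fmult_def by blast
  obtain p p' where p: "p \<in> nz" "p' \<in> nz" "x \<otimes> p = x' \<otimes> p'" using Ore_nz[OF x(1) *(1)] by auto
  note c = nzD[OF p(1)] nzD[OF p(2)] fracs_carrier[OF D x(2)] fracs_carrier[OF G x(3)] fracs_carrier[OF D *(2)] fracs_carrier[OF G *(3)]
  have y: "y \<otimes> p = y' \<otimes> p'"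
    using fracs_functional[OF D fracs_smult[OF D x(2) nzD[OF p(1)]]] fracs_smult[OF D *(2) nzD[OF p(2)]] p(3) by auto
  have z: "z \<otimes> p = z' \<otimes> p'"
    using fracs_functional[OF G fracs_smult[OF G x(3) nzD[OF p(1)]]] fracs_smult[OF G *(3) nzD[OF p(2)]] y by auto
  have F: "frac z x \<in> fracs" "frac z' x' \<in> fracs" using c x * by (auto intro: frac_in_fracs)
  have "(x \<otimes> p, z \<otimes> p) \<in> frac z x" "(x' \<otimes> p', z' \<otimes> p') \<in> frac z' x'"
    using c x * F by (auto intro!: fracs_smult frac_mem)
  then have "frac z x = frac z' x'"
    using fracs_eqI[OF F, of "x \<otimes> p" "z \<otimes> p"] p(3) z mult_nz[OF x(1) p(1)] by simp
  then show ?thesis using *(4) by simp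
qed

lemma fracs_nonempty: "\<Gamma> \<in> fracs \<Longrightarrow> \<exists>x\<in>nz. \<exists>y\<in>carrier R. (x, y) \<in> \<Gamma>"
  unfolding fracs_def using frac_mem by blast

lemma fracs_refine:
  assumes "\<Gamma> \<in> fracs" "x \<in> nz"
  shows "\<exists>s\<in>nz. \<exists>y\<in>carrier R. (x \<otimes> s, y) \<in> \<Gamma> \<and> x \<otimes> s \<in> nz"
  using fracs_total[OF assms(1) nzD[OF assms(2)]] mult_nz[OF assms(2)] by blast

lemma fracs_common2:
  assumes "\<Gamma> \<in> fracs" "\<Delta> \<in> fracs"
  shows "\<exists>x\<in>nz. \<exists>u\<in>carrier R. \<exists>v\<in>carrier R. (x, u) \<in> \<Gamma> \<and> (x, v) \<in> \<Delta>"
proof -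
  obtain x u where x: "x \<in> nz" "(x, u) \<in> \<Gamma>" using fracs_nonempty[OF assms(1)] by auto
  obtain s v where s: "s \<in> nz" "v \<in> carrier R" "(x \<otimes> s, v) \<in> \<Delta>" "x \<otimes> s \<in> nz" using fracs_refine[OF assms(2) x(1)] by auto
  have "(x \<otimes> s, u \<otimes> s) \<in> \<Gamma>" by (rule fracs_smult[OF assms(1) x(2) nzD[OF s(1)]])
  then show ?thesis using s fracs_carrier[OF assms(1)] by blast
qed

lemma fracs_chain2:
  assumes "\<Gamma> \<in> fracs" "\<Delta> \<in> fracs"
  shows "\<exists>x\<in>nz. \<exists>y\<in>carrier R. \<exists>z\<in>carrier R. (x, y) \<in> \<Delta> \<and> (y, z) \<in> \<Gamma>"
proof -
  obtain x y where x: "x \<in> nz" "y \<in> carrier R" "(x, y) \<in> \<Delta>" using fracs_nonempty[OF assms(2)] by auto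
  obtain s z where s: "s \<in> nz" "z \<in> carrier R" "(y \<otimes> s, z) \<in> \<Gamma>" using fracs_total[OF assms(1) x(2)] by auto
  have "(x \<otimes> s, y \<otimes> s) \<in> \<Delta>" by (rule fracs_smult[OF assms(2) x(3) nzD[OF s(1)]])
  then show ?thesis using s x mult_nz[OF x(1) s(1)] nzD[OF s(1)] by blast
qed

lemma fadd_mem: "\<Gamma> \<in> fracs \<Longrightarrow> \<Delta> \<in> fracs \<Longrightarrow> x \<in> nz \<Longrightarrow> (x, u) \<in> \<Gamma> \<Longrightarrow> (x, v) \<in> \<Delta> \<Longrightarrow> (x, u \<oplus> v) \<in> fadd \<Gamma> \<Delta>"
  using fadd_eq frac_mem fracs_carrier by simp

lemma fmult_mem: "\<Gamma> \<in> fracs \<Longrightarrow> \<Delta> \<in> fracs \<Longrightarrow> x \<in> nz \<Longrightarrow> (x, y) \<in> \<Delta> \<Longrightarrow> (y, z) \<in> \<Gamma> \<Longrightarrow> (x, z) \<in> fmult \<Gamma> \<Delta>"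
  using fmult_eq frac_mem fracs_carrier by simp

lemma fadd_closed: "\<Gamma> \<in> fracs \<Longrightarrow> \<Delta> \<in> fracs \<Longrightarrow> fadd \<Gamma> \<Delta> \<in> fracs"
  using fracs_common2[of \<Gamma> \<Delta>] fadd_eq frac_in_fracs by fastforce

lemma fmult_closed: "\<Gamma> \<in> fracs \<Longrightarrow> \<Delta> \<in> fracs \<Longrightarrow> fmult \<Gamma> \<Delta> \<in> fracs"
  using fracs_chain2[of \<Gamma> \<Delta>] fmult_eq frac_in_fracs by fastforce

definition ore_field :: "('a \<times> 'a) set ring" where
  "ore_field = \<lparr>carrier = fracs, monoid.mult = fmult, one = frac \<one> \<one>, ring.zero = frac \<zero> \<one>, add = fadd\<rparr>"

lemma frac_one_mem: "a \<in> carrier R \<Longrightarrow> x \<in> carrier R \<Longrightarrow> (x, a \<otimes> x) \<in> frac a \<one>"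
  using fracs_smult[OF frac_in_fracs[OF _ one_nz] frac_mem[OF _ one_nz], of a x] by simp

text \<open>Identities are tested at a single nonzero argument, chosen so that all fractions
  involved can be evaluated there; by \<open>fracs_eqI\<close> one common pair suffices.\<close>

lemma ring_ore_field: "ring ore_field"
proof (intro ringI abelian_groupI monoidI, simp_all add: ore_field_def fadd_closed fmult_closed frac_in_fracs one_nz)
  fix \<Gamma> \<Delta> \<Lambda> assume G: "\<Gamma> \<in> fracs" and D: "\<Delta> \<in> fracs" and L: "\<Lambda> \<in> fracs"
  show "fadd (fadd \<Gamma> \<Delta>) \<Lambda> = fadd \<Gamma> (fadd \<Delta> \<Lambda>)"
  proof -
    obtain x u v where x: "x \<in> nz" "(x, u) \<in> \<Gamma>" "(x, v) \<in> \<Delta>" using fracs_common2[OF G D] by auto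
    obtain s w where s: "s \<in> nz" "(x \<otimes> s, w) \<in> \<Lambda>" "x \<otimes> s \<in> nz" using fracs_refine[OF L x(1)] by auto
    have m: "(x \<otimes> s, u \<otimes> s) \<in> \<Gamma>" "(x \<otimes> s, v \<otimes> s) \<in> \<Delta>"
      using fracs_smult[OF G x(2) nzD[OF s(1)]] fracs_smult[OF D x(3) nzD[OF s(1)]] by auto
    have "(x \<otimes> s, (u \<otimes> s \<oplus> v \<otimes> s) \<oplus> w) \<in> fadd (fadd \<Gamma> \<Delta>) \<Lambda>"
      "(x \<otimes> s, u \<otimes> s \<oplus> (v \<otimes> s \<oplus> w)) \<in> fadd \<Gamma> (fadd \<Delta> \<Lambda>)"
      using G D L s m by (auto intro!: fadd_mem fadd_closed)
    moreover have "(u \<otimes> s \<oplus> v \<otimes> s) \<oplus> w = u \<otimes> s \<oplus> (v \<otimes> s \<oplus> w)"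
      using fracs_carrier[OF G m(1)] fracs_carrier[OF D m(2)] fracs_carrier[OF L s(2)] by (simp add: a_assoc)
    ultimately show ?thesis using s(3) G D L by (intro fracs_eqI[where x = "x \<otimes> s"]) (auto intro: fadd_closed)
  qed
  show "fmult (fmult \<Gamma> \<Delta>) \<Lambda> = fmult \<Gamma> (fmult \<Delta> \<Lambda>)"
  proof -
    obtain x y z where x: "x \<in> nz" "(x, y) \<in> \<Lambda>" "(y, z) \<in> \<Delta>" "z \<in> carrier R" using fracs_chain2[OF D L] by auto
    obtain s w where s: "s \<in> nz" "(z \<otimes> s, w) \<in> \<Gamma>" using fracs_total[OF G x(4)] by auto
    have m: "(x \<otimes> s, y \<otimes> s) \<in> \<Lambda>" "(y \<otimes> s, z \<otimes> s) \<in> \<Delta>" "x \<otimes> s \<in> nz"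
      using fracs_smult[OF L x(2) nzD[OF s(1)]] fracs_smult[OF D x(3) nzD[OF s(1)]] mult_nz x s by auto
    have "(x \<otimes> s, w) \<in> fmult \<Gamma> (fmult \<Delta> \<Lambda>)"
      by (rule fmult_mem[OF G fmult_closed[OF D L] m(3) fmult_mem[OF D L m(3,1,2)] s(2)])
    moreover have "(x \<otimes> s, w) \<in> fmult (fmult \<Gamma> \<Delta>) \<Lambda>"
    \<comment> \<open>\<open>fmult_mem\<close> asks for a nonzero argument, but the intermediate
      value may vanish; then all later values vanish too, and every graph contains
      \<open>(\<zero>, \<zero>)\<close>.\<close>
    proof (cases "y \<otimes> s = \<zero>")
      case False
      then have "y \<otimes> s \<in> nz" using fracs_carrier[OF D m(2)] by (simp add: nz_def)
      then show ?thesis by (intro fmult_mem[OF fmult_closed[OF G D] L m(3,1)] fmult_mem[OF G D _ m(2) s(2)])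
    next
      case True
      have zeroG: "(\<zero>, \<zero>) \<in> \<Theta>" if T: "\<Theta> \<in> fracs" for \<Theta>
      proof -
        obtain x y where "x \<in> carrier R" "y \<in> carrier R" "(x, y) \<in> \<Theta>" using fracs_nonempty[OF T] nzD by blast
        then show ?thesis using fracs_smult[OF T, of x y \<zero>] by simp
      qed
      have "z \<otimes> s = \<zero>" using fracs_functional[OF D _ zeroG[OF D], of "z \<otimes> s"] m(2) True by simp
      then have "w = \<zero>" using fracs_functional[OF G _ zeroG[OF G], of w] s(2) by simp
      then show ?thesis
        using fmult_mem[OF fmult_closed[OF G D] L m(3,1)] zeroG[OF fmult_closed[OF G D]] True by simp
    qed
    ultimately show ?thesis using m(3) G D L by (intro fracs_eqI[where x = "x \<otimes> s"]) (auto intro: fmult_closed)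
  qed
  obtain x u v where x: "x \<in> nz" "(x, u) \<in> \<Gamma>" "(x, v) \<in> \<Delta>" using fracs_common2[OF G D] by auto
  note xc = fracs_carrier[OF G x(2)] fracs_carrier[OF D x(3)]
  show "fadd \<Gamma> \<Delta> = fadd \<Delta> \<Gamma>"
    using fadd_eq[OF G D x] fadd_eq[OF D G x(1,3,2)] xc by (simp add: a_comm)
  have zero_mem: "(x, \<zero>) \<in> frac \<zero> \<one>" using frac_one_mem[of \<zero> x] xc by simp
  show "fadd (frac \<zero> \<one>) \<Gamma> = \<Gamma>"
    using fadd_eq[OF frac_in_fracs[OF zero_closed one_nz] G x(1) zero_mem x(2)] fracs_eq_frac[OF G x(2,1)] xc by simp
  show "\<exists>y\<in>fracs. fadd y \<Gamma> = frac \<zero> \<one>"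
  proof (intro bexI)
    show "frac (\<ominus> u) x \<in> fracs" using frac_in_fracs x(1) xc by simp
    then show "fadd (frac (\<ominus> u) x) \<Gamma> = frac \<zero> \<one>"
      using fadd_eq[OF _ G x(1) frac_mem[OF _ x(1)] x(2), of "\<ominus> u"] xc
        fracs_eq_frac[OF frac_in_fracs[OF zero_closed one_nz] zero_mem x(1)] by (simp add: l_neg)
  qed
  have one_mem: "(y, y) \<in> frac \<one> \<one>" if "y \<in> carrier R" for y using frac_one_mem[of \<one> y] that by simp
  show "fmult (frac \<one> \<one>) \<Gamma> = \<Gamma>"
    using fmult_eq[OF frac_in_fracs[OF one_closed one_nz] G x(1,2) one_mem] fracs_eq_frac[OF G x(2,1)] xc by simp
  show "fmult \<Gamma> (frac \<one> \<one>) = \<Gamma>"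
    using fmult_eq[OF G frac_in_fracs[OF one_closed one_nz] x(1) one_mem x(2)] fracs_eq_frac[OF G x(2,1)] xc by simp
  show "fmult (fadd \<Gamma> \<Delta>) \<Lambda> = fadd (fmult \<Gamma> \<Lambda>) (fmult \<Delta> \<Lambda>)"
  proof -
    obtain x y where x: "x \<in> nz" "y \<in> carrier R" "(x, y) \<in> \<Lambda>" using fracs_nonempty[OF L] by auto
    obtain s u where s: "s \<in> nz" "(y \<otimes> s, u) \<in> \<Gamma>" using fracs_total[OF G x(2)] by auto
    have ys: "y \<otimes> s \<in> carrier R" using x s nzD by simp
    obtain t v where t: "t \<in> nz" "(y \<otimes> s \<otimes> t, v) \<in> \<Delta>" using fracs_total[OF D ys] by auto
    define xst Y U where "xst = x \<otimes> s \<otimes> t" and "Y = y \<otimes> s \<otimes> t" and "U = u \<otimes> t"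
    have m: "(xst, Y) \<in> \<Lambda>" "(Y, U) \<in> \<Gamma>" "(Y, v) \<in> \<Delta>" "xst \<in> nz"
      using fracs_smult[OF L fracs_smult[OF L x(3) nzD[OF s(1)]] nzD[OF t(1)]] fracs_smult[OF G s(2) nzD[OF t(1)]] t(2)
        mult_nz[OF mult_nz[OF x(1) s(1)] t(1)] by (auto simp: xst_def Y_def U_def)
    have r: "(xst, U \<oplus> v) \<in> fadd (fmult \<Gamma> \<Lambda>) (fmult \<Delta> \<Lambda>)"
      using G D L m by (auto intro!: fadd_mem fmult_mem[where y = Y] fmult_closed)
    have "(Y, U \<oplus> v) \<in> fadd \<Gamma> \<Delta>"
    proof -
      obtain x0 u0 v0 where 0: "x0 \<in> nz" "(x0, u0) \<in> \<Gamma>" "(x0, v0) \<in> \<Delta>" using fracs_common2[OF G D] by auto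
      show ?thesis
      \<comment> \<open>Again the intermediate argument may be zero; then \<open>U\<close> and
        \<open>v\<close> vanish and the pair is \<open>(\<zero>, \<zero>)\<close>.\<close>
      proof (cases "Y = \<zero>")
        case False
        then show ?thesis using fadd_mem[OF G D _ m(2,3)] fracs_carrier[OF G m(2)] by (simp add: nz_def)
      next
        case True
        have "(x0 \<oplus> Y, (u0 \<oplus> U) \<oplus> (v0 \<oplus> v)) \<in> fadd \<Gamma> \<Delta>"
          using fracs_add[OF G 0(2) m(2)] fracs_add[OF D 0(3) m(3)] 0(1) True nzD[OF 0(1)] by (intro fadd_mem G D) auto
        moreover have c: "u0 \<in> carrier R" "v0 \<in> carrier R" "U \<in> carrier R" "v \<in> carrier R"
          using fracs_carrier[OF G 0(2)] fracs_carrier[OF D 0(3)] fracs_carrier[OF G m(2)] fracs_carrier[OF D m(3)] by auto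
        have "(x0 \<otimes> \<zero>, u0 \<otimes> \<zero>) \<in> \<Gamma>" "(x0 \<otimes> \<zero>, v0 \<otimes> \<zero>) \<in> \<Delta>"
          using fracs_smult[OF G 0(2) zero_closed] fracs_smult[OF D 0(3) zero_closed] by auto
        then have "U = \<zero>" "v = \<zero>"
          using fracs_functional[OF G m(2)] fracs_functional[OF D m(3)] True c nzD[OF 0(1)] by auto
        moreover have "(\<zero>, \<zero>) \<in> fadd \<Gamma> \<Delta>"
          using fracs_smult[OF fadd_closed[OF G D] fadd_mem[OF G D 0] zero_closed] c nzD[OF 0(1)] by simp
        ultimately show ?thesis using True by simp
      qed
    qed
    then have l: "(xst, U \<oplus> v) \<in> fmult (fadd \<Gamma> \<Delta>) \<Lambda>"
      using fmult_mem[OF fadd_closed[OF G D] L m(4,1)] by blast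
    show ?thesis by (rule fracs_eqI[OF _ _ l r m(4)]) (use G D L in \<open>auto intro: fadd_closed fmult_closed\<close>)
  qed
  show "fmult \<Lambda> (fadd \<Gamma> \<Delta>) = fadd (fmult \<Lambda> \<Gamma>) (fmult \<Lambda> \<Delta>)"
  proof -
    obtain s w where s: "s \<in> nz" "(u \<otimes> s, w) \<in> \<Lambda>" using fracs_total[OF L, of u] xc by auto
    have vs: "v \<otimes> s \<in> carrier R" using xc nzD[OF s(1)] by simp
    obtain t z where t: "t \<in> nz" "(v \<otimes> s \<otimes> t, z) \<in> \<Lambda>" using fracs_total[OF L vs] by auto
    define xst U V W where "xst = x \<otimes> s \<otimes> t" and "U = u \<otimes> s \<otimes> t" and "V = v \<otimes> s \<otimes> t" and "W = w \<otimes> t"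
    have m: "(xst, U) \<in> \<Gamma>" "(xst, V) \<in> \<Delta>" "(U, W) \<in> \<Lambda>" "(V, z) \<in> \<Lambda>" "xst \<in> nz"
      using fracs_smult[OF G fracs_smult[OF G x(2) nzD[OF s(1)]] nzD[OF t(1)]]
        fracs_smult[OF D fracs_smult[OF D x(3) nzD[OF s(1)]] nzD[OF t(1)]]
        fracs_smult[OF L s(2) nzD[OF t(1)]] t(2) mult_nz[OF mult_nz[OF x(1) s(1)] t(1)]
      by (auto simp: xst_def U_def V_def W_def)
    have r: "(xst, W \<oplus> z) \<in> fadd (fmult \<Lambda> \<Gamma>) (fmult \<Lambda> \<Delta>)"
      by (intro fadd_mem fmult_mem[OF L G m(5,1,3)] fmult_mem[OF L D m(5,2,4)] fmult_closed L G D m(5))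
    have l: "(xst, W \<oplus> z) \<in> fmult \<Lambda> (fadd \<Gamma> \<Delta>)"
      by (rule fmult_mem[OF L fadd_closed[OF G D] m(5) fadd_mem[OF G D m(5,1,2)] fracs_add[OF L m(3,4)]])
    show ?thesis by (rule fracs_eqI[OF _ _ l r m(5)]) (use G D L in \<open>auto intro: fadd_closed fmult_closed\<close>)
  qed
qed

lemma frac_one_eq_zero_iff: "a \<in> carrier R \<Longrightarrow> b \<in> nz \<Longrightarrow> frac a b = frac \<zero> \<one> \<Longrightarrow> a = \<zero>"
  using fracs_functional[OF frac_in_fracs[OF zero_closed one_nz], of b a \<zero>] frac_mem[of a b] frac_one_mem[of \<zero> b] nzD
  by simp

text \<open>The inverse of \<open>a b^-1\<close> is \<open>b a^-1\<close>.\<close>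

lemma skew_field_ore_field: "skew_field ore_field"
proof -
  interpret Q: ring ore_field by (rule ring_ore_field)
  have one_ne: "\<one>\<^bsub>ore_field\<^esub> \<noteq> \<zero>\<^bsub>ore_field\<^esub>"
    using frac_one_eq_zero_iff[OF one_closed one_nz] nontrivial by (auto simp: ore_field_def)
  have "Units ore_field = carrier ore_field - {\<zero>\<^bsub>ore_field\<^esub>}"
  proof (intro equalityI subsetI)
    fix \<Gamma> assume "\<Gamma> \<in> Units ore_field"
    then show "\<Gamma> \<in> carrier ore_field - {\<zero>\<^bsub>ore_field\<^esub>}"
      using one_ne unfolding Units_def by auto
  next
    fix \<Gamma> assume G: "\<Gamma> \<in> carrier ore_field - {\<zero>\<^bsub>ore_field\<^esub>}"
    then obtain a b where ab: "a \<in> carrier R" "b \<in> nz" "\<Gamma> = frac a b" by (auto simp: ore_field_def fracs_def)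
    have "a \<noteq> \<zero>"
    proof
      assume "a = \<zero>"
      moreover have "(b, \<zero>) \<in> frac \<zero> \<one>" using frac_one_mem[of \<zero> b] nzD[OF ab(2)] by simp
      ultimately have "\<Gamma> = frac \<zero> \<one>"
        using fracs_eq_frac[OF frac_in_fracs[OF zero_closed one_nz] _ ab(2)] ab(3) by simp
      then show False using G by (simp add: ore_field_def)
    qed
    then have a: "a \<in> nz" using ab by (simp add: nz_def)
    have F: "frac a b \<in> fracs" "frac b a \<in> fracs" using a ab nzD by (auto intro: frac_in_fracs)
    have one: "frac x x = frac \<one> \<one>" if "x \<in> nz" for x
      using fracs_eq_frac[OF frac_in_fracs[OF one_closed one_nz] _ that] frac_one_mem[of \<one> x] nzD[OF that] by simp
    have "fmult (frac a b) (frac b a) = frac \<one> \<one>" "fmult (frac b a) (frac a b) = frac \<one> \<one>"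
      using fmult_eq[OF F a frac_mem[OF nzD[OF ab(2)] a] frac_mem[OF ab(1,2)]]
        fmult_eq[OF F(2,1) ab(2) frac_mem[OF ab(1,2)] frac_mem[OF nzD[OF ab(2)] a]] one a ab by auto
    then show "\<Gamma> \<in> Units ore_field" using F ab(3) by (auto simp: Units_def ore_field_def)
  qed
  then show ?thesis using Q.ring_axioms one_ne by (intro skew_field.intro skew_field_axioms.intro)
qed

lemma frac_one_hom: "(\<lambda>a. frac a \<one>) \<in> ring_hom R ore_field"
proof (intro ring_hom_memI)
  fix a b assume ab: "a \<in> carrier R" "b \<in> carrier R"
  note F = frac_in_fracs[OF ab(1) one_nz] frac_in_fracs[OF ab(2) one_nz]
  note m = frac_mem[OF ab(1) one_nz] frac_mem[OF ab(2) one_nz]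
  show "frac a \<one> \<in> carrier ore_field" using F by (simp add: ore_field_def)
  show "frac (a \<otimes> b) \<one> = frac a \<one> \<otimes>\<^bsub>ore_field\<^esub> frac b \<one>"
    using fmult_eq[OF F one_nz m(2) frac_one_mem[OF ab]] by (simp add: ore_field_def)
  show "frac (a \<oplus> b) \<one> = frac a \<one> \<oplus>\<^bsub>ore_field\<^esub> frac b \<one>"
    using fadd_eq[OF F one_nz m] by (simp add: ore_field_def)
qed (simp add: ore_field_def)

lemma inj_frac_one: "inj_on (\<lambda>a. frac a \<one>) (carrier R)"
proof (rule inj_onI)
  fix a b assume ab: "a \<in> carrier R" "b \<in> carrier R" "frac a \<one> = frac b \<one>"
  then show "a = b"
    using fracs_functional[OF frac_in_fracs[OF ab(1) one_nz] frac_mem[OF ab(1) one_nz]] frac_mem[OF ab(2) one_nz] by simp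
qed

lemma frac_mult_denominator:
  assumes "a \<in> carrier R" "b \<in> nz"
  shows "frac a b \<otimes>\<^bsub>ore_field\<^esub> frac b \<one> = frac a \<one>"
  using fmult_eq[OF frac_in_fracs[OF assms] frac_in_fracs[OF nzD[OF assms(2)] one_nz] one_nz
      frac_mem[OF nzD[OF assms(2)] one_nz] frac_mem[OF assms]]
  by (simp add: ore_field_def)

end

section \<open>Skew fields of fractions of group algebras\<close>

lemma replicate_append_Cons_eq:
  assumes "a \<noteq> b" "replicate n a @ b # xs = replicate m a @ b # ys"
  shows "n = m \<and> xs = ys"
  using assms(2)
proof (induction n arbitrary: m)
  case 0
  then show ?case using assms(1) by (cases m) auto
next
  case (Suc n)
  then show ?case using assms(1) by (cases m) auto
qed

text \<open>The field may be finite, so numbers are written in unary with the letter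
  \<open>z\<close>; the first \<open>u\<close> ends the number, and the next entry is the value
  \<open>c\<close>, whatever it is.\<close>

definition unary_code :: "'k \<Rightarrow> 'k \<Rightarrow> (nat \<times> 'k) list \<Rightarrow> 'k list" where
  "unary_code z u ps = concat (map (\<lambda>(n, c). replicate n z @ [u, c]) ps)"

lemma unary_code_inject:
  assumes "z \<noteq> u" "unary_code z u ps = unary_code z u qs"
  shows "ps = qs"
  using assms(2)
proof (induction ps arbitrary: qs)
  case Nil
  then show ?case by (cases qs) (auto simp: unary_code_def split: prod.splits)
next
  case (Cons p ps)
  obtain n c where p: "p = (n, c)" by (cases p)
  obtain q qs' where q: "qs = q # qs'" using Cons.prems by (cases qs) (auto simp: unary_code_def p)
  obtain m d where q': "q = (m, d)" by (cases q)
  have "replicate n z @ u # (c # unary_code z u ps) = replicate m z @ u # (d # unary_code z u qs')"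
    using Cons.prems by (simp add: unary_code_def p q q')
  from replicate_append_Cons_eq[OF assms(1) this] show ?case using Cons.IH p q q' by auto
qed

text \<open>A finitely supported function is determined by its graph over the support; countability
  of the index type turns positions into numbers for the unary code.\<close>

lemma finite_support_code:
  assumes "z \<noteq> (u :: 'k)"
  shows "\<exists>enc :: ('i::countable \<Rightarrow> 'k) \<Rightarrow> 'k list. inj_on enc {f. finite {i. f i \<noteq> z}}"
proof
  define graph where "graph f = map (\<lambda>n. (n, f (from_nat n))) (sorted_list_of_set (to_nat ` {i. f i \<noteq> z}))"
    for f :: "'i \<Rightarrow> 'k"
  show "inj_on (unary_code z u \<circ> graph) {f :: 'i \<Rightarrow> 'k. finite {i. f i \<noteq> z}}"
  proof (rule inj_onI)
    fix f g :: "'i \<Rightarrow> 'k"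
    assume fin: "f \<in> {f. finite {i. f i \<noteq> z}}" "g \<in> {f. finite {i. f i \<noteq> z}}"
      and eq: "(unary_code z u \<circ> graph) f = (unary_code z u \<circ> graph) g"
    have set_graph: "set (graph f) = (\<lambda>i. (to_nat i, f i)) ` {i. f i \<noteq> z}" if "finite {i. f i \<noteq> z}" for f
      using that by (auto simp: graph_def image_iff)
    have "graph f = graph g" using unary_code_inject[OF assms] eq by simp
    then have sets: "(\<lambda>i. (to_nat i, f i)) ` {i. f i \<noteq> z} = (\<lambda>i. (to_nat i, g i)) ` {i. g i \<noteq> z}"
      using set_graph[of f] set_graph[of g] fin by simp
    show "f = g"
    proof
      fix i
      show "f i = g i"
      proof (cases "f i = z \<and> g i = z")
        case False
        then have "(to_nat i, f i) \<in> (\<lambda>i. (to_nat i, g i)) ` {i. g i \<noteq> z} \<or> (to_nat i, g i) \<in> (\<lambda>i. (to_nat i, f i)) ` {i. f i \<noteq> z}"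
          using sets by blast
        then show ?thesis by auto
      qed simp
    qed
  qed
qed

text \<open>Hides how the fractions were built: an element \<open>d\<close> of \<open>E\<close> is
  accessed only through equations \<open>d h(b) = h(a)\<close>.\<close>

locale group_algebra_fractions = field k + E: skew_field E
  for k :: "('k, 'm) ring_scheme" and E :: "('e, 'n) ring_scheme" +
  fixes h :: "('g::bi_ordered_group \<Rightarrow> 'k) \<Rightarrow> 'e"
  assumes Ore_GA: "right_Ore_domain (GA :: ('g \<Rightarrow> 'k) ring)"
    and hom: "h \<in> ring_hom GA E"
    and inj: "inj_on h (carrier GA)"
    and fraction: "\<And>d. d \<in> carrier E \<Longrightarrow>
      \<exists>a\<in>carrier GA. \<exists>b\<in>carrier GA. b \<noteq> \<zero>\<^bsub>GA\<^esub> \<and> d \<otimes>\<^bsub>E\<^esub> h b = h a"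

text \<open>The Ore field consists of sets of pairs; a chosen numerator and denominator are coded
  together as one list over the field, and the ring structure is transported along this
  injection.\<close>

lemma (in field) group_algebra_fractions_exists:
  assumes "right_Ore_domain (GA :: ('g::{bi_ordered_group, countable} \<Rightarrow> 'a) ring)"
  shows "\<exists>(E :: 'a list ring) (h :: ('g \<Rightarrow> 'a) \<Rightarrow> 'a list). group_algebra_fractions R E h"
proof -
  interpret O: right_Ore_domain "GA :: ('g \<Rightarrow> 'a) ring" by fact
  interpret Q: skew_field O.ore_field by (rule O.skew_field_ore_field)
  obtain enc :: "('g \<times> bool \<Rightarrow> 'a) \<Rightarrow> 'a list" where enc: "inj_on enc {f. finite {i. f i \<noteq> \<zero>}}"
    using finite_support_code[of \<zero> \<one>] one_not_zero by metis
  \<comment> \<open>Numerator and denominator merged into one finitely supported function, with an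
    additional bit in the index.\<close>
  define pair where "pair = (\<lambda>ab (x :: 'g, t). if t then fst ab x else snd ab x :: 'a)"
  have "\<forall>\<Gamma>\<in>carrier O.ore_field. \<exists>ab. fst ab \<in> carrier GA \<and> snd ab \<in> O.nz \<and> \<Gamma> = O.frac (fst ab) (snd ab)"
    by (auto simp: O.ore_field_def O.fracs_def)
  from bchoice[OF this] obtain rep where
    rep: "\<And>\<Gamma>. \<Gamma> \<in> carrier O.ore_field \<Longrightarrow> fst (rep \<Gamma>) \<in> carrier GA \<and> snd (rep \<Gamma>) \<in> O.nz \<and> \<Gamma> = O.frac (fst (rep \<Gamma>)) (snd (rep \<Gamma>))"
    by blast
  define f where "f = enc \<circ> pair \<circ> rep"
  have f: "inj_on f (carrier O.ore_field)"
  proof (rule inj_onI)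
    fix \<Gamma> \<Delta> assume G: "\<Gamma> \<in> carrier O.ore_field" and D: "\<Delta> \<in> carrier O.ore_field" and eq: "f \<Gamma> = f \<Delta>"
    have fs: "finite {i. pair ab i \<noteq> \<zero>}" if "fst ab \<in> carrier GA" "snd ab \<in> carrier GA" for ab
    proof (rule finite_subset)
      show "{i. pair ab i \<noteq> \<zero>} \<subseteq> (supp (fst ab) \<union> supp (snd ab)) \<times> UNIV"
        by (auto simp: pair_def split: prod.splits if_splits)
    qed (use that in \<open>auto simp: GA_simps\<close>)
    have "pair (rep \<Gamma>) = pair (rep \<Delta>)"
      using inj_onD[OF enc, of "pair (rep \<Gamma>)" "pair (rep \<Delta>)"] eq fs rep[OF G] rep[OF D] O.nzD by (simp add: f_def)
    then have "pair (rep \<Gamma>) (x, t) = pair (rep \<Delta>) (x, t)" for x t by simp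
    from this[of _ True] this[of _ False] have "fst (rep \<Gamma>) = fst (rep \<Delta>)" "snd (rep \<Gamma>) = snd (rep \<Delta>)"
      by (auto simp: pair_def)
    then show "\<Gamma> = \<Delta>" using rep[OF G] rep[OF D] by metis
  qed
  define E where "E = image_ring f O.ore_field"
  have iso: "f \<in> ring_iso O.ore_field E" unfolding E_def by (rule inj_imp_image_ring_iso[OF f])
  have ringE: "ring E" unfolding E_def by (rule Q.inj_imp_image_ring_is_ring[OF f])
  interpret E: ring E by fact
  have fh: "f \<in> ring_hom O.ore_field E" and fbij: "f ` carrier O.ore_field = carrier E"
    using iso by (auto simp: ring_iso_def bij_betw_def)
  interpret fh: ring_hom_ring O.ore_field E f using fh Q.ring_axioms ringE by (intro ring_hom_ringI2)
  have skE: "skew_field E"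
  proof (intro skew_field.intro skew_field_axioms.intro ringE)
    show ne: "\<one>\<^bsub>E\<^esub> \<noteq> \<zero>\<^bsub>E\<^esub>"
      using inj_onD[OF f] Q.one_not_zero fh.hom_one fh.hom_zero by (metis Q.one_closed Q.zero_closed)
    show "Units E = carrier E - {\<zero>\<^bsub>E\<^esub>}"
    proof (intro equalityI subsetI)
      fix x assume "x \<in> Units E"
      then show "x \<in> carrier E - {\<zero>\<^bsub>E\<^esub>}" using ne unfolding Units_def by auto
    next
      fix x assume x: "x \<in> carrier E - {\<zero>\<^bsub>E\<^esub>}"
      then have "x \<in> f ` carrier O.ore_field" using fbij by simp
      then obtain y where y: "y \<in> carrier O.ore_field" "x = f y" by blast
      moreover have "y \<noteq> \<zero>\<^bsub>O.ore_field\<^esub>" using x y(2) fh.hom_zero by auto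
      ultimately have y: "y \<in> carrier O.ore_field" "x = f y" "y \<noteq> \<zero>\<^bsub>O.ore_field\<^esub>" by auto
      note i = Q.nonzero_inverse[OF y(1,3)]
      have "f (inv\<^bsub>O.ore_field\<^esub> y) \<otimes>\<^bsub>E\<^esub> x = \<one>\<^bsub>E\<^esub>" "x \<otimes>\<^bsub>E\<^esub> f (inv\<^bsub>O.ore_field\<^esub> y) = \<one>\<^bsub>E\<^esub>"
        using i y fh.hom_mult fh.hom_one by metis+
      then show "x \<in> Units E" using x i fh.hom_closed unfolding Units_def by blast
    qed
  qed
  define h where "h a = f (O.frac a \<one>\<^bsub>GA\<^esub>)" for a
  have gcl: "O.frac a \<one>\<^bsub>GA\<^esub> \<in> carrier O.ore_field" if "a \<in> carrier GA" for a
    using O.frac_one_hom that by (auto simp: ring_hom_def)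
  have "h \<in> ring_hom GA E"
    using ring_hom_trans[OF O.frac_one_hom fh] by (simp add: h_def[abs_def] o_def)
  moreover have "inj_on h (carrier GA)"
    using comp_inj_on[OF O.inj_frac_one inj_on_subset[OF f]] gcl by (auto simp: h_def[abs_def] o_def)
  moreover have "\<exists>a\<in>carrier GA. \<exists>b\<in>carrier GA. b \<noteq> \<zero>\<^bsub>GA\<^esub> \<and> d \<otimes>\<^bsub>E\<^esub> h b = h a" if d: "d \<in> carrier E" for d
  proof -
    obtain y where y: "y \<in> carrier O.ore_field" "d = f y" using fbij d by auto
    then obtain a b where ab: "a \<in> carrier GA" "b \<in> O.nz" "y = O.frac a b" by (auto simp: O.ore_field_def O.fracs_def)
    have "d \<otimes>\<^bsub>E\<^esub> h b = f (y \<otimes>\<^bsub>O.ore_field\<^esub> O.frac b \<one>\<^bsub>GA\<^esub>)"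
      using fh.hom_mult[OF y(1) gcl[OF O.nzD[OF ab(2)]]] y(2) by (simp add: h_def)
    also have "\<dots> = h a" using O.frac_mult_denominator[OF ab(1,2)] ab(3) by (simp add: h_def)
    finally show ?thesis using ab by (auto simp: O.nz_def)
  qed
  ultimately have "group_algebra_fractions R E h"
    using field_axioms skE assms by (intro group_algebra_fractions.intro group_algebra_fractions_axioms.intro)
  then show ?thesis by blast
qed

context group_algebra_fractions
begin

interpretation O: right_Ore_domain "GA :: ('g \<Rightarrow> 'k) ring" by (rule Ore_GA)

interpretation hr: ring_hom_ring "GA :: ('g \<Rightarrow> 'k) ring" E h
  using hom ring_GA E.ring_axioms by (intro ring_hom_ringI2)

lemma h_eq_zero_iff: "a \<in> carrier GA \<Longrightarrow> h a = \<zero>\<^bsub>E\<^esub> \<longleftrightarrow> a = \<zero>\<^bsub>GA\<^esub>"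
  using inj_onD[OF inj, of a "\<zero>\<^bsub>GA\<^esub>"] hr.hom_zero O.zero_closed by auto

lemma E_r_cancel:
  assumes "x \<in> carrier E" "y \<in> carrier E" "b \<in> carrier E" "b \<noteq> \<zero>\<^bsub>E\<^esub>" "x \<otimes>\<^bsub>E\<^esub> b = y \<otimes>\<^bsub>E\<^esub> b"
  shows "x = y"
proof -
  note i = E.nonzero_inverse[OF assms(3,4)]
  have "x = x \<otimes>\<^bsub>E\<^esub> b \<otimes>\<^bsub>E\<^esub> inv\<^bsub>E\<^esub> b" using assms(1,3) i by (simp add: E.m_assoc)
  also have "\<dots> = y" unfolding assms(5) using assms(2,3) i by (simp add: E.m_assoc)
  finally show ?thesis .
qed

abbreviation \<iota> :: "'k \<Rightarrow> 'e" where "\<iota> \<equiv> \<lambda>c. h (point 0 c)"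

text \<open>A scalar commutes with \<open>h a\<close> and \<open>h b\<close>, hence with the
  fraction \<open>d\<close> after \<open>h b\<close> is cancelled.\<close>

lemma skew_field_extension_fractions: "skew_field_extension k \<iota> E"
proof (intro skew_field_extension.intro unital_algebra.intro unital_algebra_axioms.intro field_axioms E.ring_axioms E.skew_field_axioms)
  show "\<iota> \<in> ring_hom k E" using ring_hom_trans[OF point_zero_hom hom] by (simp add: o_def)
  show "\<iota> ` carrier k \<subseteq> ring_center E"
  proof
    fix z assume "z \<in> \<iota> ` carrier k"
    then obtain c where c: "c \<in> carrier k" "z = h (point 0 c)" by auto
    have pc: "point 0 c \<in> carrier GA" using c point_closed by blast
    interpret C: central_algebra "GA :: ('g \<Rightarrow> 'k) ring" "point 0 ` carrier k" by (rule central_algebra_GA)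
    have z: "z \<in> carrier E" unfolding c(2) by (rule hr.hom_closed[OF pc])
    have "z \<otimes>\<^bsub>E\<^esub> d = d \<otimes>\<^bsub>E\<^esub> z" if d: "d \<in> carrier E" for d
    proof -
      obtain a b where ab: "a \<in> carrier GA" "b \<in> carrier GA" "b \<noteq> \<zero>\<^bsub>GA\<^esub>" "d \<otimes>\<^bsub>E\<^esub> h b = h a" using fraction[OF d] by blast
      have comm: "z \<otimes>\<^bsub>E\<^esub> h u = h u \<otimes>\<^bsub>E\<^esub> z" if "u \<in> carrier GA" for u
        using C.central_K[of "point 0 c" u] hr.hom_mult[OF pc that] hr.hom_mult[OF that pc] c that by simp
      have "(z \<otimes>\<^bsub>E\<^esub> d) \<otimes>\<^bsub>E\<^esub> h b = z \<otimes>\<^bsub>E\<^esub> h a" using z d ab by (simp add: E.m_assoc)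
      also have "\<dots> = (d \<otimes>\<^bsub>E\<^esub> h b) \<otimes>\<^bsub>E\<^esub> z" using comm ab by simp
      also have "\<dots> = d \<otimes>\<^bsub>E\<^esub> (z \<otimes>\<^bsub>E\<^esub> h b)" using comm[OF ab(2)] z d ab(2) by (simp add: E.m_assoc)
      also have "\<dots> = (d \<otimes>\<^bsub>E\<^esub> z) \<otimes>\<^bsub>E\<^esub> h b" using z d ab(2) by (simp add: E.m_assoc)
      finally show ?thesis
        using E_r_cancel[of "z \<otimes>\<^bsub>E\<^esub> d" "d \<otimes>\<^bsub>E\<^esub> z" "h b"] z d ab h_eq_zero_iff by simp
    qed
    then show "z \<in> ring_center E" using z by (simp add: ring_center_def)
  qed
qed

lemma central_E: "central_skew_field E (\<iota> ` carrier k)"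
  by (rule skew_field_extension_central[OF skew_field_extension_fractions])

interpretation A: central_skew_field E "\<iota> ` carrier k" by (rule central_E)

section \<open>The valuation, lower bounds for dimensions, and amenability of the fractions\<close>

abbreviation (input) "nzs \<equiv> O.nz"

text \<open>The valuation of \<open>E\<close> extending the leading exponent on the group algebra.\<close>

definition val :: "'e \<Rightarrow> 'g \<Rightarrow> bool" where
  "val d g \<longleftrightarrow> d \<in> carrier E \<and> (\<exists>a\<in>nzs. \<exists>b\<in>nzs. d \<otimes>\<^bsub>E\<^esub> h b = h a \<and> g = lead a - lead b)"

lemma lead_mult_nz: "a \<in> nzs \<Longrightarrow> b \<in> nzs \<Longrightarrow> lead (a \<otimes>\<^bsub>GA\<^esub> b) = lead a + lead b"
  using lead_mult(2) by (auto simp: O.nz_def)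

lemma valE:
  assumes "val d g"
  obtains a b where "a \<in> nzs" "b \<in> nzs" "d \<in> carrier E" "d \<otimes>\<^bsub>E\<^esub> h b = h a" "g = lead a - lead b"
  using assms unfolding val_def by blast

lemma diff_add_same: "(x + u) - (y + u) = x - (y :: 'g)"
  by (simp add: diff_conv_add_uminus group_add_class.minus_add add.assoc del: add_uminus_conv_diff)

lemma fraction_expand:
  assumes "d \<in> carrier E" "b \<in> carrier GA" "u \<in> carrier GA" "a \<in> carrier GA" "d \<otimes>\<^bsub>E\<^esub> h b = h a"
  shows "d \<otimes>\<^bsub>E\<^esub> h (b \<otimes>\<^bsub>GA\<^esub> u) = h (a \<otimes>\<^bsub>GA\<^esub> u)"
proof -
  have "d \<otimes>\<^bsub>E\<^esub> h (b \<otimes>\<^bsub>GA\<^esub> u) = (d \<otimes>\<^bsub>E\<^esub> h b) \<otimes>\<^bsub>E\<^esub> h u" using assms(1-4) by (simp add: E.m_assoc)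
  then show ?thesis using assms by simp
qed

text \<open>Expanding both fractions to a common denominator adds the same element on the right of
  both leading exponents, and it cancels in their difference.\<close>

lemma val_unique:
  assumes "val d g" "val d g'"
  shows "g = g'"
proof -
  obtain a b where 1: "a \<in> nzs" "b \<in> nzs" "d \<in> carrier E" "d \<otimes>\<^bsub>E\<^esub> h b = h a" "g = lead a - lead b" by (rule valE[OF assms(1)])
  obtain a' b' where 2: "a' \<in> nzs" "b' \<in> nzs" "d \<otimes>\<^bsub>E\<^esub> h b' = h a'" "g' = lead a' - lead b'" by (rule valE[OF assms(2)])
  obtain u u' where u: "u \<in> nzs" "u' \<in> nzs" "b \<otimes>\<^bsub>GA\<^esub> u = b' \<otimes>\<^bsub>GA\<^esub> u'" using O.Ore_nz[OF 1(2) 2(2)] by blast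
  note c = O.nzD[OF 1(1)] O.nzD[OF 1(2)] O.nzD[OF 2(1)] O.nzD[OF 2(2)] O.nzD[OF u(1)] O.nzD[OF u(2)]
  have "h (a \<otimes>\<^bsub>GA\<^esub> u) = h (a' \<otimes>\<^bsub>GA\<^esub> u')"
    using fraction_expand[OF 1(3) c(2,5,1) 1(4)] fraction_expand[OF 1(3) c(4,6,3) 2(3)] u(3) by simp
  then have "a \<otimes>\<^bsub>GA\<^esub> u = a' \<otimes>\<^bsub>GA\<^esub> u'" using inj_onD[OF inj] c by simp
  then have "lead a + lead u = lead a' + lead u'" "lead b + lead u = lead b' + lead u'"
    using u(3) lead_mult_nz 1 2 u by metis+
  then show ?thesis unfolding 1(5) 2(4) by (metis diff_add_same)
qed

text \<open>With \<open>b u = a' u'\<close>, the product of \<open>a b^-1\<close> and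
  \<open>a' b'^-1\<close> is \<open>(a u) (b' u')^-1\<close>; the exponents of \<open>u\<close> and
  \<open>u'\<close> are eliminated by the same equation.\<close>

lemma val_mult:
  assumes "val d g" "val d' g'"
  shows "val (d \<otimes>\<^bsub>E\<^esub> d') (g + g')"
proof -
  obtain a b where 1: "a \<in> nzs" "b \<in> nzs" "d \<in> carrier E" "d \<otimes>\<^bsub>E\<^esub> h b = h a" "g = lead a - lead b" by (rule valE[OF assms(1)])
  obtain a' b' where 2: "a' \<in> nzs" "b' \<in> nzs" "d' \<in> carrier E" "d' \<otimes>\<^bsub>E\<^esub> h b' = h a'" "g' = lead a' - lead b'" by (rule valE[OF assms(2)])
  obtain u u' where u: "u \<in> nzs" "u' \<in> nzs" "b \<otimes>\<^bsub>GA\<^esub> u = a' \<otimes>\<^bsub>GA\<^esub> u'" using O.Ore_nz[OF 1(2) 2(1)] by blast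
  note c = O.nzD[OF 1(1)] O.nzD[OF 1(2)] O.nzD[OF 2(1)] O.nzD[OF 2(2)] O.nzD[OF u(1)] O.nzD[OF u(2)]
  have "(d \<otimes>\<^bsub>E\<^esub> d') \<otimes>\<^bsub>E\<^esub> h (b' \<otimes>\<^bsub>GA\<^esub> u') = d \<otimes>\<^bsub>E\<^esub> (d' \<otimes>\<^bsub>E\<^esub> h (b' \<otimes>\<^bsub>GA\<^esub> u'))"
    using 1(3) 2(3) c by (simp add: E.m_assoc)
  also have "\<dots> = h (a \<otimes>\<^bsub>GA\<^esub> u)"
    using fraction_expand[OF 2(3) c(4,6,3) 2(4)] fraction_expand[OF 1(3) c(2,5,1) 1(4)] u(3) by simp
  finally have "(d \<otimes>\<^bsub>E\<^esub> d') \<otimes>\<^bsub>E\<^esub> h (b' \<otimes>\<^bsub>GA\<^esub> u') = h (a \<otimes>\<^bsub>GA\<^esub> u)" .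
  moreover have "g + g' = lead (a \<otimes>\<^bsub>GA\<^esub> u) - lead (b' \<otimes>\<^bsub>GA\<^esub> u')"
  proof -
    have "lead b + lead u = lead a' + lead u'" using u(3) lead_mult_nz 1 2 u by metis
    then have "lead u - lead u' = - lead b + lead a'"
    proof -
      have "lead u = - lead b + (lead a' + lead u')"
        using \<open>lead b + lead u = lead a' + lead u'\<close> by (metis minus_add_cancel)
      then show ?thesis by (simp add: add.assoc[symmetric])
    qed
    then have "lead a + (lead u - lead u') - lead b' = lead a + (- lead b + lead a') - lead b'" by simp
    then have "lead a + lead u - (lead b' + lead u') = (lead a - lead b) + (lead a' - lead b')"
      by (simp add: diff_conv_add_uminus group_add_class.minus_add add.assoc del: add_uminus_conv_diff)
    then show ?thesis using lead_mult_nz 1 2 u by simp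
  qed
  ultimately show ?thesis
    unfolding val_def using 1(3) 2(3) O.mult_nz[OF 1(1) u(1)] O.mult_nz[OF 2(2) u(2)] by blast
qed

lemma val_exists:
  assumes "d \<in> carrier E" "d \<noteq> \<zero>\<^bsub>E\<^esub>"
  shows "\<exists>g. val d g"
proof -
  obtain a b where ab: "a \<in> carrier GA" "b \<in> carrier GA" "b \<noteq> \<zero>\<^bsub>GA\<^esub>" "d \<otimes>\<^bsub>E\<^esub> h b = h a" using fraction[OF assms(1)] by blast
  have "a \<noteq> \<zero>\<^bsub>GA\<^esub>"
    using ab E.no_zero_divisors[of d "h b"] assms h_eq_zero_iff[OF ab(2)] h_eq_zero_iff[OF ab(1)] by auto
  then show ?thesis unfolding val_def O.nz_def using ab assms(1) by blast
qed

lemma val_nonzero: "val d g \<Longrightarrow> d \<noteq> \<zero>\<^bsub>E\<^esub>"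
proof
  assume v: "val d g" and d: "d = \<zero>\<^bsub>E\<^esub>"
  obtain a b where ab: "a \<in> nzs" "b \<in> nzs" "d \<in> carrier E" "d \<otimes>\<^bsub>E\<^esub> h b = h a" by (rule valE[OF v])
  then have "h a = \<zero>\<^bsub>E\<^esub>" using d hr.hom_closed[OF O.nzD[OF ab(2)]] by simp
  then show False using ab(1) h_eq_zero_iff[of a] by (simp add: O.nz_def)
qed

lemma val_h: "a \<in> nzs \<Longrightarrow> val (h a) (lead a)"
proof -
  assume a: "a \<in> nzs"
  have "lead (\<one>\<^bsub>GA\<^esub> :: 'g \<Rightarrow> 'k) = 0"
    by (rule lead_unique[OF O.one_closed]) (auto simp: GA_simps point_def)
  then show ?thesis unfolding val_def using a O.one_nz O.nzD[OF a]
    by (intro conjI bexI[of _ a] bexI[of _ "\<one>\<^bsub>GA\<^esub>"]) auto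
qed

lemma point_nz: "c \<in> carrier k \<Longrightarrow> c \<noteq> \<zero>\<^bsub>k\<^esub> \<Longrightarrow> point g c \<in> nzs"
  using point_closed[of c g] by (auto simp: O.nz_def GA_simps(3) point_def fun_eq_iff)

lemma val_h_point: "c \<in> carrier k \<Longrightarrow> c \<noteq> \<zero>\<^bsub>k\<^esub> \<Longrightarrow> val (h (point g c)) g"
proof -
  assume c: "c \<in> carrier k" "c \<noteq> \<zero>\<^bsub>k\<^esub>"
  have "lead (point g c) = g" by (rule lead_unique[OF point_closed[OF c(1)]]) (use c in \<open>auto simp: point_def\<close>)
  then show ?thesis using val_h[OF point_nz[OF c]] by metis
qed

text \<open>Zero has no valuation and therefore lies in every \<open>below g\<close>, as a subspace
  requires.\<close>

definition below :: "'g \<Rightarrow> 'e set" where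
  "below g = {d \<in> carrier E. \<forall>g'. val d g' \<longrightarrow> g' < g}"

text \<open>Over a common denominator \<open>e\<close> this becomes the bound
  \<open>lead_add_less\<close> for a sum of numerators, with \<open>g\<close> shifted by
  \<open>lead e\<close>.\<close>

lemma below_add:
  assumes "d \<in> below g" "d' \<in> below g"
  shows "d \<oplus>\<^bsub>E\<^esub> d' \<in> below g"
proof -
  have dc: "d \<in> carrier E" "d' \<in> carrier E" using assms by (auto simp: below_def)
  obtain a b where 1: "a \<in> carrier GA" "b \<in> carrier GA" "b \<noteq> \<zero>\<^bsub>GA\<^esub>" "d \<otimes>\<^bsub>E\<^esub> h b = h a" using fraction[OF dc(1)] by blast
  obtain a' b' where 2: "a' \<in> carrier GA" "b' \<in> carrier GA" "b' \<noteq> \<zero>\<^bsub>GA\<^esub>" "d' \<otimes>\<^bsub>E\<^esub> h b' = h a'" using fraction[OF dc(2)] by blast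
  have b: "b \<in> nzs" "b' \<in> nzs" using 1 2 by (auto simp: O.nz_def)
  obtain u u' where u: "u \<in> nzs" "u' \<in> nzs" "b \<otimes>\<^bsub>GA\<^esub> u = b' \<otimes>\<^bsub>GA\<^esub> u'" using O.Ore_nz[OF b] by blast
  define e where "e = b \<otimes>\<^bsub>GA\<^esub> u"
  have e: "e \<in> nzs" "e \<in> carrier GA" using O.mult_nz[OF b(1) u(1)] O.nzD by (auto simp: e_def)
  define p p' where "p = a \<otimes>\<^bsub>GA\<^esub> u" and "p' = a' \<otimes>\<^bsub>GA\<^esub> u'"
  have p: "p \<in> carrier GA" "p' \<in> carrier GA" using 1 2 u O.nzD by (auto simp: p_def p'_def)
  have de: "d \<otimes>\<^bsub>E\<^esub> h e = h p" "d' \<otimes>\<^bsub>E\<^esub> h e = h p'"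
    using fraction_expand[OF dc(1) 1(2) O.nzD[OF u(1)] 1(1,4)] fraction_expand[OF dc(2) 2(2) O.nzD[OF u(2)] 2(1,4)] u(3)
    by (simp_all add: e_def p_def p'_def)
  have sum: "(d \<oplus>\<^bsub>E\<^esub> d') \<otimes>\<^bsub>E\<^esub> h e = h (p \<oplus>\<^bsub>GA\<^esub> p')" using de dc e p by (simp add: E.l_distr)
  have small: "lead q < g + lead e" if "q \<in> carrier GA" "q \<noteq> \<zero>\<^bsub>GA\<^esub>" "f \<in> below g" "f \<otimes>\<^bsub>E\<^esub> h e = h q" for q f
  proof -
    have "val f (lead q - lead e)" unfolding val_def using that e by (auto simp: below_def O.nz_def)
    then have "lead q - lead e < g" using that(3) by (auto simp: below_def)
    from add_less_right[OF this, of "lead e"] show ?thesis by simp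
  qed
  have "g' < g" if "val (d \<oplus>\<^bsub>E\<^esub> d') g'" for g'
  proof -
    have "d \<oplus>\<^bsub>E\<^esub> d' \<noteq> \<zero>\<^bsub>E\<^esub>" by (rule val_nonzero[OF that])
    then have nz: "p \<oplus>\<^bsub>GA\<^esub> p' \<noteq> \<zero>\<^bsub>GA\<^esub>"
      using sum E.no_zero_divisors[of "d \<oplus>\<^bsub>E\<^esub> d'" "h e"] dc e h_eq_zero_iff[OF e(2)] by (auto simp: O.nz_def)
    have "lead (p \<oplus>\<^bsub>GA\<^esub> p') < g + lead e"
      using lead_add_less[OF p nz] small[OF p(1) _ assms(1) de(1)] small[OF p(2) _ assms(2) de(2)] by blast
    from add_less_right[OF this, of "- lead e"] have "lead (p \<oplus>\<^bsub>GA\<^esub> p') - lead e < g" by (simp add: add.assoc)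
    moreover have "val (d \<oplus>\<^bsub>E\<^esub> d') (lead (p \<oplus>\<^bsub>GA\<^esub> p') - lead e)"
    proof -
      have "p \<oplus>\<^bsub>GA\<^esub> p' \<in> nzs" using nz p by (simp add: O.nz_def)
      then show ?thesis unfolding val_def using sum e(1) E.a_closed[OF dc] by blast
    qed
    ultimately show ?thesis using val_unique[OF that] by metis
  qed
  then show ?thesis using dc by (simp add: below_def)
qed

lemma subalgebra_below: "subalgebra (\<iota> ` carrier k) (below g) E"
proof (rule A.subalgebraI')
  show "below g \<subseteq> carrier E" by (auto simp: below_def)
  show zero: "\<zero>\<^bsub>E\<^esub> \<in> below g" using val_nonzero by (auto simp: below_def)
  show "a \<oplus>\<^bsub>E\<^esub> b \<in> below g" if "a \<in> below g" "b \<in> below g" for a b using below_add that by blast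
  show "c \<otimes>\<^bsub>E\<^esub> d \<in> below g" if "c \<in> \<iota> ` carrier k" "d \<in> below g" for c d
  proof -
    obtain c' where c': "c' \<in> carrier k" "c = h (point 0 c')" using \<open>c \<in> \<iota> ` carrier k\<close> by auto
    have dc: "d \<in> carrier E" using that by (simp add: below_def)
    have cc: "c \<in> carrier E" unfolding c'(2) by (rule hr.hom_closed[OF point_closed[OF c'(1)]])
    show ?thesis
    proof (cases "c' = \<zero>\<^bsub>k\<^esub> \<or> d = \<zero>\<^bsub>E\<^esub>")
      case True
      have "(point 0 \<zero>\<^bsub>k\<^esub> :: 'g \<Rightarrow> 'k) = \<zero>\<^bsub>GA\<^esub>" by (auto simp: point_def GA_simps(3))
      then have "c \<otimes>\<^bsub>E\<^esub> d = \<zero>\<^bsub>E\<^esub>" using True c' dc cc by auto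
      then show ?thesis using zero by simp
    next
      case False
      then obtain g' where g': "val d g'" using val_exists[OF dc] by blast
      have "val c 0" unfolding c'(2) using False c'(1) by (intro val_h_point) auto
      then have "val (c \<otimes>\<^bsub>E\<^esub> d) (0 + g')" by (rule val_mult[OF _ g'])
      then have "val (c \<otimes>\<^bsub>E\<^esub> d) g'" by simp
      moreover have "g' < g" using g' that(2) by (simp add: below_def)
      ultimately show ?thesis using val_unique cc dc by (auto simp: below_def)
    qed
  qed
qed

text \<open>Elements with different valuations are independent: taken in increasing order, the
  earlier ones span a space inside \<open>below g\<close>, which misses an element of valuation
  \<open>g\<close>.\<close>

lemma card_val_le_dim:
  assumes "finite G" and Y: "E.finite_dimension (\<iota> ` carrier k) Y" and "\<And>g. g \<in> G \<Longrightarrow> \<exists>d\<in>Y. val d g"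
  shows "card G \<le> E.dim (\<iota> ` carrier k) Y"
proof -
  let ?K = "\<iota> ` carrier k"
  have "\<exists>Us. E.independent ?K Us \<and> set Us \<subseteq> Y \<and> length Us = card G \<and> (\<forall>u\<in>set Us. \<exists>g\<in>G. val u g)"
    using assms(1,3)
  proof (induction G rule: finite_linorder_max_induct)
    case empty
    then show ?case by (intro exI[of _ "[]"]) auto
  next
    case (insert g G)
    then obtain Us where Us: "E.independent ?K Us" "set Us \<subseteq> Y" "length Us = card G" "\<forall>u\<in>set Us. \<exists>g\<in>G. val u g" by auto
    obtain d where d: "d \<in> Y" "val d g" using insert.prems by auto
    have dc: "d \<in> carrier E" using d(2) by (auto simp: val_def)
    have "set Us \<subseteq> below g"
    proof
      fix u assume "u \<in> set Us"
      then obtain g' where g': "g' \<in> G" "val u g'" using Us(4) by auto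
      moreover have "u \<in> carrier E" using g'(2) by (simp add: val_def)
      ultimately show "u \<in> below g" using val_unique[OF g'(2)] insert.hyps unfolding below_def by blast
    qed
    then have "E.Span ?K Us \<subseteq> below g" by (rule E.subalgebra_Span_incl[OF A.subfield_K subalgebra_below])
    then have "d \<notin> E.Span ?K Us" using d(2) by (auto simp: below_def)
    then have "E.independent ?K (d # Us)" using Us(1) dc by (auto intro: E.li_Cons)
    moreover have "g \<notin> G" using insert.hyps by auto
    ultimately show ?case using Us d insert.hyps by (intro exI[of _ "d # Us"]) auto
  qed
  then show ?thesis using A.independent_le_dim[OF Y] by metis
qed

lemma h_supported:
  assumes "f \<in> carrier GA" "supp f \<subseteq> set Ps"
  shows "h f \<in> E.Span (\<iota> ` carrier k) (map (\<lambda>g. h (point g \<one>\<^bsub>k\<^esub>)) Ps)"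
  using assms
proof (induction Ps arbitrary: f)
  case Nil
  then have "f = \<zero>\<^bsub>GA\<^esub>" by (auto simp: GA_simps(3))
  then show ?case by simp
next
  case (Cons g Ps)
  define f' where "f' = f(g := \<zero>\<^bsub>k\<^esub>)"
  have fc: "f z \<in> carrier k" for z using Cons.prems by (simp add: GA_simps)
  have f': "f' \<in> carrier GA" "supp f' \<subseteq> set Ps"
    using Cons.prems by (auto simp: f'_def GA_simps intro: finite_subset[of _ "supp f"])
  have p: "point g \<one>\<^bsub>k\<^esub> \<in> carrier GA" "point 0 (f g) \<in> carrier GA" using point_closed fc by auto
  have "f = point 0 (f g) \<otimes>\<^bsub>GA\<^esub> point g \<one>\<^bsub>k\<^esub> \<oplus>\<^bsub>GA\<^esub> f'"
    using fc by (intro ext, unfold GA_simps(2) scalar_mult_GA[OF fc p(1)]) (auto simp: point_def f'_def)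
  then have "h f = h (point 0 (f g)) \<otimes>\<^bsub>E\<^esub> h (point g \<one>\<^bsub>k\<^esub>) \<oplus>\<^bsub>E\<^esub> h f'" using p f' by (metis hr.hom_add hr.hom_mult O.m_closed)
  then show ?case using Cons.IH[OF f'] fc unfolding list.map A.Span_Cons E.line_extension_mem_iff by blast
qed

lemma common_denominator:
  assumes "finite S" "S \<subseteq> carrier E"
  shows "\<exists>b\<in>nzs. \<forall>s\<in>S. \<exists>a\<in>carrier GA. s \<otimes>\<^bsub>E\<^esub> h b = h a"
  using assms
proof (induction S rule: finite_induct)
  case empty
  then show ?case using O.one_nz by blast
next
  case (insert s S)
  then obtain b where b: "b \<in> nzs" "\<forall>s\<in>S. \<exists>a\<in>carrier GA. s \<otimes>\<^bsub>E\<^esub> h b = h a" by auto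
  obtain a1 b1 where 1: "a1 \<in> carrier GA" "b1 \<in> carrier GA" "b1 \<noteq> \<zero>\<^bsub>GA\<^esub>" "s \<otimes>\<^bsub>E\<^esub> h b1 = h a1"
    using fraction[of s] insert.prems by blast
  have b1: "b1 \<in> nzs" using 1 by (simp add: O.nz_def)
  obtain u u1 where u: "u \<in> nzs" "u1 \<in> nzs" "b \<otimes>\<^bsub>GA\<^esub> u = b1 \<otimes>\<^bsub>GA\<^esub> u1" using O.Ore_nz[OF b(1) b1] by blast
  have "\<exists>a\<in>carrier GA. x \<otimes>\<^bsub>E\<^esub> h (b \<otimes>\<^bsub>GA\<^esub> u) = h a" if xS: "x \<in> insert s S" for x
  proof (cases "x = s")
    case True
    have "s \<otimes>\<^bsub>E\<^esub> h (b1 \<otimes>\<^bsub>GA\<^esub> u1) = h (a1 \<otimes>\<^bsub>GA\<^esub> u1)"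
      using insert.prems by (intro fraction_expand 1 O.nzD[OF u(2)]) auto
    then show ?thesis using True u(3) 1(1) O.nzD[OF u(2)] by (metis O.m_closed)
  next
    case False
    then obtain a where a: "a \<in> carrier GA" "x \<otimes>\<^bsub>E\<^esub> h b = h a" using b(2) xS by auto
    have "x \<otimes>\<^bsub>E\<^esub> h (b \<otimes>\<^bsub>GA\<^esub> u) = h (a \<otimes>\<^bsub>GA\<^esub> u)"
      using insert.prems xS by (intro fraction_expand O.nzD[OF b(1)] O.nzD[OF u(1)] a) auto
    then show ?thesis using a(1) O.nzD[OF u(1)] by (metis O.m_closed)
  qed
  then show ?case using O.mult_nz[OF b(1) u(1)] by blast
qed

text \<open>Let \<open>b\<close> be a common denominator of \<open>S\<close>, \<open>A\<close> the
  union of the supports of the numerators, and \<open>F\<close> a Folner set for \<open>A\<close>.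
  The span \<open>V\<close> of the elements \<open>h b\<close> times a point of \<open>F\<close> has
  dimension at least \<open>card F\<close> by valuations, while \<open>S V\<close> lies in the span
  of the points of \<open>A + F\<close>.\<close>

lemma amenable_fractions:
  assumes folner: "\<And>(A :: 'g set) \<epsilon> :: real. finite A \<Longrightarrow> 0 < \<epsilon> \<Longrightarrow>
    \<exists>F. finite F \<and> F \<noteq> {} \<and> real (card ((\<lambda>(x, y). x + y) ` (A \<times> F))) < (1 + \<epsilon>) * real (card F)"
  shows "amenable k \<iota> E"
  unfolding amenable_def
proof (intro allI impI, elim conjE)
  let ?K = "\<iota> ` carrier k"
  fix S and \<epsilon> :: real assume S: "finite S" "S \<subseteq> carrier E" and "0 < \<epsilon>"
  obtain b where b: "b \<in> nzs" "\<forall>s\<in>S. \<exists>a\<in>carrier GA. s \<otimes>\<^bsub>E\<^esub> h b = h a" using common_denominator[OF S] by blast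
  from bchoice[OF b(2)[unfolded Bex_def]] obtain num where num: "\<And>s. s \<in> S \<Longrightarrow> num s \<in> carrier GA \<and> s \<otimes>\<^bsub>E\<^esub> h b = h (num s)" by auto
  have bc: "b \<in> carrier GA" "h b \<in> carrier E" "h b \<noteq> \<zero>\<^bsub>E\<^esub>"
    using b(1) h_eq_zero_iff O.nzD[OF b(1)] by (auto simp: O.nz_def)
  define A where "A = (\<Union>s\<in>S. supp (num s))"
  have "finite A" using S num by (auto simp: A_def GA_simps)
  then obtain F where F: "finite F" "F \<noteq> {}" "real (card ((\<lambda>(x, y). x + y) ` (A \<times> F))) < (1 + \<epsilon>) * real (card F)"
    using folner \<open>0 < \<epsilon>\<close> by blast
  obtain Fs where Fs: "set Fs = F" using finite_list[OF F(1)] by auto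
  define P where "P = (\<lambda>(x, y). x + y) ` (A \<times> F)"
  have "finite P" using \<open>finite A\<close> F(1) by (simp add: P_def)
  then obtain Ps where Ps: "set Ps = P" "distinct Ps" using finite_distinct_list by blast
  define B where "B g = h b \<otimes>\<^bsub>E\<^esub> h (point g \<one>\<^bsub>k\<^esub>)" for g
  define V where "V = E.Span ?K (map B Fs)"
  define Y where "Y = E.Span ?K (map (\<lambda>g. h (point g \<one>\<^bsub>k\<^esub>)) Ps)"
  have p1: "point g \<one>\<^bsub>k\<^esub> \<in> carrier GA" for g :: 'g by (simp add: point_closed)
  have Bc: "set (map B Fs) \<subseteq> carrier E" using bc p1 by (auto simp: B_def)
  have Yc: "set (map (\<lambda>g. h (point g \<one>\<^bsub>k\<^esub>)) Ps) \<subseteq> carrier E" using p1 by auto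
  have V: "E.finite_dimension ?K V" unfolding V_def by (rule A.dim_Span_le(1)[OF Bc])
  have Y: "E.finite_dimension ?K Y" "E.dim ?K Y \<le> card P"
    using A.dim_Span_le[OF Yc] distinct_card[OF Ps(2)] Ps(1) by (auto simp: Y_def)
  have valB: "val (B g) (lead b + g)" for g
    unfolding B_def by (rule val_mult[OF val_h[OF b(1)] val_h_point]) auto
  have BV: "B g \<in> V" if "g \<in> F" for g
    using E.Span_base_incl[OF A.subfield_K Bc] that Fs by (auto simp: V_def)
  have "card ((+) (lead b) ` F) \<le> E.dim ?K V"
    using valB BV F(1) by (intro card_val_le_dim V) auto
  then have dimV: "card F \<le> E.dim ?K V" by (simp add: card_image)
  have VsubE: "V \<subseteq> carrier E" using A.subalgebraD(1)[OF A.finite_dimension_subalgebra[OF V]] .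
  have Ysub: "subalgebra ?K Y E" by (rule A.finite_dimension_subalgebra[OF Y(1)])
  have "sum_left_translates E S V \<subseteq> Y"
  proof (rule A.sum_left_translates_least[OF Ysub S(1)])
    fix s v assume s: "s \<in> S" and v: "v \<in> V"
    have sc: "s \<in> carrier E" using s S by auto
    have gen: "s \<otimes>\<^bsub>E\<^esub> B g \<in> Y" if g: "g \<in> F" for g
    proof -
      have n: "num s \<in> carrier GA" using num s by blast
      have "s \<otimes>\<^bsub>E\<^esub> B g = (s \<otimes>\<^bsub>E\<^esub> h b) \<otimes>\<^bsub>E\<^esub> h (point g \<one>\<^bsub>k\<^esub>)" unfolding B_def using sc bc p1 by (simp add: E.m_assoc)
      also have "\<dots> = h (num s \<otimes>\<^bsub>GA\<^esub> point g \<one>\<^bsub>k\<^esub>)" using num[OF s] p1 by simp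
      also have "\<dots> \<in> Y"
        unfolding Y_def
      proof (rule h_supported)
        show "num s \<otimes>\<^bsub>GA\<^esub> point g \<one>\<^bsub>k\<^esub> \<in> carrier GA" using n p1 by simp
        have "supp (num s \<otimes>\<^bsub>GA\<^esub> point g \<one>\<^bsub>k\<^esub>) \<subseteq> (\<lambda>(x, y). x + y) ` (supp (num s) \<times> supp (point g \<one>\<^bsub>k\<^esub>))"
          by (rule supp_mult_subset[OF n p1])
        also have "\<dots> \<subseteq> P" unfolding P_def A_def using s g by (intro image_mono Sigma_mono) (auto simp: point_def)
        finally show "supp (num s \<otimes>\<^bsub>GA\<^esub> point g \<one>\<^bsub>k\<^esub>) \<subseteq> set Ps" using Ps by simp
      qed
      finally show ?thesis .
    qed
    have "(\<lambda>v. s \<otimes>\<^bsub>E\<^esub> v) ` V = E.Span ?K (map (\<lambda>v. s \<otimes>\<^bsub>E\<^esub> v) (map B Fs))"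
      unfolding V_def by (rule A.linear_image_Span[OF Bc A.linear_on_lmult[OF VsubE[unfolded V_def] sc]])
    also have "\<dots> \<subseteq> Y" using gen Fs by (intro E.subalgebra_Span_incl[OF A.subfield_K Ysub]) auto
    finally show "s \<otimes>\<^bsub>E\<^esub> v \<in> Y" using v by auto
  qed
  then have "E.dim ?K (sum_left_translates E S V) \<le> E.dim ?K Y"
    by (intro A.dim_mono(2) A.subalgebra_sum_left_translates S A.finite_dimension_subalgebra V Y(1))
  then have "real (E.dim ?K (sum_left_translates E S V)) \<le> real (card P)" using Y(2) by linarith
  also have "\<dots> < (1 + \<epsilon>) * real (card F)" using F(3) by (simp add: P_def)
  also have "\<dots> \<le> (1 + \<epsilon>) * real (E.dim ?K V)" using dimV \<open>0 < \<epsilon>\<close> by simp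
  finally have lt: "real (E.dim ?K (sum_left_translates E S V)) < (1 + \<epsilon>) * real (E.dim ?K V)" .
  have "0 < E.dim ?K V" using dimV F(1,2) card_gt_0_iff[of F] by linarith
  moreover have "V \<noteq> {\<zero>\<^bsub>E\<^esub>}"
    using calculation A.dimI'[OF E.zero_dim] by auto
  ultimately show "\<exists>V. E.finite_dimension ?K V \<and> V \<noteq> {\<zero>\<^bsub>E\<^esub>} \<and>
      real (E.dim ?K (sum_left_translates E S V)) / real (E.dim ?K V) < 1 + \<epsilon>"
    using lt V by (intro exI[of _ V]) (simp add: divide_less_eq)
qed

end

text \<open>The valuations of the products of length \<open>n\<close> of two elements with
  valuations \<open>\<gamma>\<close> and \<open>\<xi> + \<gamma>\<close>.\<close>

primrec binary_products :: "'g::monoid_add \<Rightarrow> 'g \<Rightarrow> nat \<Rightarrow> 'g set" where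
  "binary_products \<xi> \<gamma> 0 = {0}"
| "binary_products \<xi> \<gamma> (Suc n) = (\<lambda>(e, g). e + \<gamma> + g) ` ({0, \<xi>} \<times> binary_products \<xi> \<gamma> n)"

lemma finite_binary_products: "finite (binary_products \<xi> \<gamma> n)"
  by (induction n) auto

text \<open>The quotient is at least \<open>n * ln 2 / ln n\<close>, which is unbounded since
  \<open>ln n / n\<close> tends to zero.\<close>

lemma limsup_eq_infinity_of_exponential:
  fixes d :: "nat \<Rightarrow> nat"
  assumes "\<And>n. 2 ^ n \<le> d n"
  shows "limsup (\<lambda>n. ereal (ln (real (d n)) / ln (real n))) = \<infinity>"
proof -
  have "((\<lambda>n. ereal (ln (real (d n)) / ln (real n))) \<longlongrightarrow> \<infinity>) sequentially"
    unfolding tendsto_PInfty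
  proof
    fix r :: real
    have "(\<lambda>n. r * (ln (real n) / real n)) \<longlonglongrightarrow> r * 0"
      by (intro tendsto_mult tendsto_const filterlim_compose[OF ln_x_over_x_tendsto_0 filterlim_real_sequentially])
    then have "\<forall>\<^sub>F n in sequentially. r * (ln (real n) / real n) < ln 2"
      by (rule order_tendstoD(2)) simp
    then show "\<forall>\<^sub>F n in sequentially. ereal r < ereal (ln (real (d n)) / ln (real n))"
      using eventually_gt_at_top[of 1]
    proof eventually_elim
      case (elim n)
      then have pos: "0 < ln (real n)" "0 < real n" by auto
      have "r * ln (real n) < real n * ln 2" using elim pos by (simp add: field_simps)
      also have "\<dots> = ln (real (2 ^ n))" by (simp add: ln_realpow)
      also have "\<dots> \<le> ln (real (d n))"
        using assms[of n] by (intro ln_mono of_nat_mono) (auto simp: zero_less_power order.strict_trans2)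
      finally have "r < ln (real (d n)) / ln (real n)" using pos by (simp add: less_divide_eq)
      then show ?case by simp
    qed
  qed
  then show ?thesis by (intro lim_imp_Limsup) auto
qed

lemma skew_field_extension_sub_skew_field:
  assumes "skew_field_extension k \<iota> E" "sub_skew_field L E" "\<iota> ` carrier k \<subseteq> L"
  shows "skew_field_extension k \<iota> (E\<lparr>carrier := L\<rparr>)"
proof -
  interpret S: skew_field_extension k \<iota> E by fact
  have L: "subring L E" "skew_field (E\<lparr>carrier := L\<rparr>)" using assms(2) by (auto simp: sub_skew_field_def)
  have "\<iota> \<in> ring_hom k (E\<lparr>carrier := L\<rparr>)"
    using S.structure_hom assms(3) by (auto simp: ring_hom_def)
  moreover have "\<iota> ` carrier k \<subseteq> ring_center (E\<lparr>carrier := L\<rparr>)"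
    using S.structure_central assms(3) subringE(1)[OF L(1)] by (auto simp: ring_center_def subset_iff)
  ultimately show ?thesis
    using L(2) S.field_axioms
    by (intro skew_field_extension.intro unital_algebra.intro unital_algebra_axioms.intro) (auto simp: skew_field_def)
qed

text \<open>\<open>V\<close> is fixed before \<open>r\<close>, so it holds \<open>1\<close>,
  \<open>x\<close>, \<open>t\<close> and \<open>x t\<close>: whichever \<open>\<sigma>\<close> suits
  the valuation of \<open>r\<close>, an element \<open>s0\<close> of valuation
  \<open>\<sigma>\<close> is at hand with both \<open>s0 r\<close> and \<open>x s0 r\<close> in
  \<open>V r\<close>.\<close>

lemma (in group_algebra_fractions) GK_tr_deg_infinite:
  assumes L: "sub_skew_field L E" "\<iota> ` carrier k \<subseteq> L" and x: "x \<in> L" "val x \<xi>" and t: "t \<in> L" "val t \<tau>"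
    and growth: "\<And>g. \<exists>\<sigma>\<in>{0, \<tau>}. \<forall>n. card (binary_products \<xi> (\<sigma> + g) n) = 2 ^ n"
  shows "GK_tr_deg k \<iota> (E\<lparr>carrier := L\<rparr>) = \<infinity>"
proof -
  let ?K = "\<iota> ` carrier k"
  define D where "D = E\<lparr>carrier := L\<rparr>"
  interpret A: central_skew_field E ?K by (rule central_E)
  interpret D: central_skew_field D ?K
    unfolding D_def by (intro skew_field_extension_central skew_field_extension_sub_skew_field skew_field_extension_fractions L)
  have sub: "subring L E" using L by (simp add: sub_skew_field_def)
  have LE: "L \<subseteq> carrier E" using subringE(1)[OF sub] .
  have D_simps: "carrier D = L" "a \<otimes>\<^bsub>D\<^esub> b = a \<otimes>\<^bsub>E\<^esub> b" "\<one>\<^bsub>D\<^esub> = \<one>\<^bsub>E\<^esub>" "\<zero>\<^bsub>D\<^esub> = \<zero>\<^bsub>E\<^esub>" for a b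
    by (auto simp: D_def)
  define V where "V = D.Span ?K [\<one>\<^bsub>E\<^esub>, x, t, x \<otimes>\<^bsub>E\<^esub> t]"
  have gc: "set [\<one>\<^bsub>E\<^esub>, x, t, x \<otimes>\<^bsub>E\<^esub> t] \<subseteq> carrier D"
    using subringE[OF sub] x t by (auto simp: D_simps)
  have V: "D.finite_dimension ?K V" unfolding V_def by (rule D.dim_Span_le(1)[OF gc])
  have memV: "\<one>\<^bsub>E\<^esub> \<in> V" "x \<in> V" "t \<in> V" "x \<otimes>\<^bsub>E\<^esub> t \<in> V"
    using D.Span_base_incl[OF D.subfield_K gc] by (auto simp: V_def)
  have val_one: "val \<one>\<^bsub>E\<^esub> 0"
  proof -
    have "h (point 0 \<one>\<^bsub>k\<^esub>) = \<one>\<^bsub>E\<^esub>" using hom by (simp add: ring_hom_def flip: GA_simps(4))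
    then show ?thesis using val_h_point[of "\<one>\<^bsub>k\<^esub>" 0] by simp
  qed
  have inf: "limsup (\<lambda>n. ereal (ln (real (D.dim ?K (span_power D ?K (?K <+>\<^bsub>D\<^esub> (V #>\<^bsub>D\<^esub> r)) n))) / ln (real n))) = \<infinity>"
    if r: "r \<in> carrier D - {\<zero>\<^bsub>D\<^esub>}" for r
  proof (rule limsup_eq_infinity_of_exponential)
    fix n
    define U where "U = ?K <+>\<^bsub>D\<^esub> (V #>\<^bsub>D\<^esub> r)"
    have U: "D.finite_dimension ?K U" unfolding U_def using r by (intro D.finite_dimension_affine_translate V) auto
    have rc: "r \<in> L" "r \<in> carrier E" "r \<noteq> \<zero>\<^bsub>E\<^esub>" using r LE by (auto simp: D_simps)
    obtain g where g: "val r g" using val_exists[OF rc(2,3)] by blast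
    obtain \<sigma> where \<sigma>: "\<sigma> \<in> {0, \<tau>}" "\<And>n. card (binary_products \<xi> (\<sigma> + g) n) = 2 ^ n" using growth by blast
    define s0 where "s0 = (if \<sigma> = 0 then \<one>\<^bsub>E\<^esub> else t)"
    have s0: "s0 \<in> V" "x \<otimes>\<^bsub>E\<^esub> s0 \<in> V" "val s0 \<sigma>"
      using memV \<sigma>(1) t val_one x LE by (auto simp: s0_def)
    have s1: "val (x \<otimes>\<^bsub>E\<^esub> s0) (\<xi> + \<sigma>)" by (rule val_mult[OF x(2) s0(3)])
    have VL: "V \<subseteq> L" using D.subalgebraD(1)[OF D.finite_dimension_subalgebra[OF V]] by (simp add: D_simps)
    have inU: "v \<otimes>\<^bsub>E\<^esub> r \<in> U" if "v \<in> V" for v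
    proof -
      have "\<zero>\<^bsub>D\<^esub> \<oplus>\<^bsub>D\<^esub> v \<otimes>\<^bsub>D\<^esub> r \<in> U" unfolding U_def by (rule D.affine_translate_mem[OF D.K_zero that])
      moreover have "v \<otimes>\<^bsub>D\<^esub> r \<in> carrier D" using that VL rc by (auto simp: D_simps(1) intro!: D.m_closed[unfolded D_simps(1)])
      ultimately show ?thesis by (simp add: D_simps(2))
    qed
    have prods: "\<exists>xs. length xs = n \<and> set xs \<subseteq> U \<and> val (foldr (\<otimes>\<^bsub>E\<^esub>) xs \<one>\<^bsub>E\<^esub>) g'"
      if "g' \<in> binary_products \<xi> (\<sigma> + g) n" for g' n
      using that
    proof (induction n arbitrary: g')
      case 0
      then show ?case using val_one by simp
    next
      case (Suc n)
      then obtain e g2 where e: "e \<in> {0, \<xi>}" "g2 \<in> binary_products \<xi> (\<sigma> + g) n" "g' = e + (\<sigma> + g) + g2" by auto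
      obtain xs where xs: "length xs = n" "set xs \<subseteq> U" "val (foldr (\<otimes>\<^bsub>E\<^esub>) xs \<one>\<^bsub>E\<^esub>) g2" using Suc.IH[OF e(2)] by blast
      obtain v where v: "v \<in> V" "val v (e + \<sigma>)" using e(1) s0 s1 by auto
      have "val (v \<otimes>\<^bsub>E\<^esub> r) (e + (\<sigma> + g))" using val_mult[OF v(2) g] by (simp add: add.assoc)
      from val_mult[OF this xs(3)] have "val (foldr (\<otimes>\<^bsub>E\<^esub>) (v \<otimes>\<^bsub>E\<^esub> r # xs) \<one>\<^bsub>E\<^esub>) g'" using e(3) by simp
      then show ?case using xs inU[OF v(1)] by (intro exI[of _ "v \<otimes>\<^bsub>E\<^esub> r # xs"]) auto
    qed
    let ?P = "span_power D ?K U n"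
    have P: "D.finite_dimension ?K ?P" by (rule D.finite_dimension_span_power[OF U])
    then have PE: "E.finite_dimension ?K ?P" "?P \<subseteq> L"
      using A.finite_dimension_consistent[OF sub L(2)] by (auto simp: D_def)
    \<comment> \<open>Distinct valuations bound the dimension in \<open>E\<close>, which agrees with
      the one in \<open>D\<close>.\<close>
    have "card (binary_products \<xi> (\<sigma> + g) n) \<le> E.dim ?K ?P"
    proof (rule card_val_le_dim[OF finite_binary_products PE(1)])
      fix g' assume "g' \<in> binary_products \<xi> (\<sigma> + g) n"
      then obtain xs where xs: "length xs = n" "set xs \<subseteq> U" "val (foldr (\<otimes>\<^bsub>E\<^esub>) xs \<one>\<^bsub>E\<^esub>) g'" using prods by blast
      have "(\<otimes>\<^bsub>D\<^esub>) = (\<otimes>\<^bsub>E\<^esub>)" by (simp add: D_def)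
      then have "foldr (\<otimes>\<^bsub>E\<^esub>) xs \<one>\<^bsub>E\<^esub> \<in> ?P" using D.product_in_span_power[OF xs(1,2)] by (simp add: D_simps(3))
      then show "\<exists>d\<in>?P. val d g'" using xs(3) by blast
    qed
    also have "E.dim ?K ?P = D.dim ?K ?P" using A.dim_consistent[OF sub L(2) PE(2)] by (simp add: D_def)
    finally show "2 ^ n \<le> D.dim ?K (span_power D ?K (?K <+>\<^bsub>D\<^esub> (V #>\<^bsub>D\<^esub> r)) n)" using \<sigma>(2) by (simp add: U_def)
  qed
  have "(INF r \<in> carrier D - {\<zero>\<^bsub>D\<^esub>}. limsup (\<lambda>n. ereal (ln (real (D.dim ?K (span_power D ?K (?K <+>\<^bsub>D\<^esub> (V #>\<^bsub>D\<^esub> r)) n))) / ln (real n))))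
      \<le> GK_tr_deg k \<iota> D"
    unfolding GK_tr_deg_def Let_def using V memV(1) by (intro SUP_upper) (simp add: D_simps)
  moreover have "\<infinity> \<le> (INF r \<in> carrier D - {\<zero>\<^bsub>D\<^esub>}. limsup (\<lambda>n. ereal (ln (real (D.dim ?K (span_power D ?K (?K <+>\<^bsub>D\<^esub> (V #>\<^bsub>D\<^esub> r)) n))) / ln (real n))))"
    using inf by (intro INF_greatest) simp
  ultimately have "\<infinity> \<le> GK_tr_deg k \<iota> D" by (rule order_trans[rotated])
  then show ?thesis by (simp add: D_def)
qed

section \<open>The group of maps scaling by powers of two and translating\<close>

text \<open>\<open>Scaling n q\<close> is the map \<open>x \<mapsto> 2\<^sup>n x + q\<close> of the rational line; composition is written additively.\<close>

datatype scaling = Scaling (expo: int) (transl: rat)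

instance scaling :: countable by countable_datatype

instantiation scaling :: bi_ordered_group
begin

definition zero_scaling where "0 = Scaling 0 0"

definition plus_scaling where "g + h = Scaling (expo g + expo h) (transl g + 2 powi expo g * transl h)"

definition uminus_scaling where "- g = Scaling (- expo g) (- (2 powi (- expo g) * transl g))"

definition minus_scaling where "g - h = g + - (h :: scaling)"

text \<open>Lexicographic with the exponent first: exponents add, and for equal exponents adding an
  element on the left scales translations by a positive power of two and shifts them, on the right
  it only shifts them.\<close>

definition less_scaling where "g < h \<longleftrightarrow> expo g < expo h \<or> expo g = expo h \<and> transl g < transl h"

definition less_eq_scaling where "g \<le> h \<longleftrightarrow> expo g < expo h \<or> expo g = expo h \<and> transl g \<le> transl h"

instance
proof
  fix a b c :: scaling
  show "a + b + c = a + (b + c)" by (simp add: plus_scaling_def power_int_add algebra_simps)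
  show "0 + a = a" "a + 0 = a" by (simp_all add: plus_scaling_def zero_scaling_def)
  show "- a + a = 0" by (simp add: plus_scaling_def zero_scaling_def uminus_scaling_def)
  show "a + - b = a - b" by (simp add: minus_scaling_def)
  show "(a < b) = (a \<le> b \<and> \<not> b \<le> a)" by (auto simp: less_scaling_def less_eq_scaling_def)
  show "a \<le> a" by (simp add: less_eq_scaling_def)
  show "a \<le> b \<Longrightarrow> b \<le> c \<Longrightarrow> a \<le> c" by (auto simp: less_eq_scaling_def)
  show "a \<le> b \<Longrightarrow> b \<le> a \<Longrightarrow> a = b" by (auto simp: less_eq_scaling_def intro: scaling.expand)
  show "a \<le> b \<or> b \<le> a" by (auto simp: less_eq_scaling_def)
  show "a < b \<Longrightarrow> c + a < c + b" by (auto simp: less_scaling_def plus_scaling_def)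
  show "a < b \<Longrightarrow> a + c < b + c" by (auto simp: less_scaling_def plus_scaling_def)
qed

end

lemma Scaling_add: "Scaling m p + Scaling n q = Scaling (m + n) (p + 2 powi m * q)"
  by (simp add: plus_scaling_def)

text \<open>For \<open>m > 0\<close> the translation parts differ by integers, for \<open>m < 0\<close> by less than \<open>2\<close>; either way
  the next digit can be read off.\<close>

lemma card_binary_products:
  assumes "m \<noteq> 0"
  shows "card (binary_products (Scaling 0 1) (Scaling m p) n) = 2 ^ n"
proof -
  \<comment> \<open>The translation parts of the products; all products of length \<open>n\<close>
    share the exponent \<open>n * m\<close>.\<close>
  define Q where "Q = rec_nat {0} (\<lambda>_ S. (\<lambda>(e, q). e + p + 2 powi m * q) ` ({0, 1} \<times> S))"
  have Q0: "Q 0 = {0 :: rat}" and QS: "Q (Suc n) = (\<lambda>(e, q). e + p + 2 powi m * q) ` ({0, 1} \<times> Q n)" for n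
    by (simp_all add: Q_def)
  have BQ: "binary_products (Scaling 0 1) (Scaling m p) n = Scaling (int n * m) ` Q n" for n
  proof (induction n)
    case 0
    then show ?case by (simp add: Q0 zero_scaling_def)
  next
    case (Suc n)
    have "binary_products (Scaling 0 1) (Scaling m p) (Suc n)
        = (\<lambda>(e, g). Scaling 0 e + Scaling m p + g) ` ({0, 1} \<times> Scaling (int n * m) ` Q n)"
    proof -
      have "{0, Scaling 0 1} \<times> Y = (\<lambda>(e, g). (Scaling 0 e, g)) ` ({0, 1} \<times> Y)" for Y :: "scaling set"
        by (auto simp: zero_scaling_def)
      then show ?thesis unfolding binary_products.simps Suc.IH by (simp add: image_image case_prod_beta)
    qed
    also have "\<dots> = (\<lambda>(e, q). Scaling (int (Suc n) * m) (e + p + 2 powi m * q)) ` ({0, 1} \<times> Q n)"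
    proof -
      have "{0, 1 :: rat} \<times> Scaling (int n * m) ` Q n = (\<lambda>(e, q). (e, Scaling (int n * m) q)) ` ({0, 1} \<times> Q n)"
        by auto
      then show ?thesis by (simp add: image_image case_prod_beta Scaling_add algebra_simps)
    qed
    also have "\<dots> = Scaling (int (Suc n) * m) ` Q (Suc n)" unfolding QS by (simp add: image_image case_prod_beta)
    finally show ?case .
  qed
  have fin: "finite (Q n)" for n by (induction n) (auto simp: Q0 QS)
  \<comment> \<open>The parts with new digit \<open>0\<close> and \<open>1\<close> are disjoint
    unless two earlier translations differ by exactly \<open>2 powi (- m)\<close>.\<close>
  have step: "card (Q (Suc n)) = 2 * card (Q n)"
    if no: "\<And>a b. a \<in> Q n \<Longrightarrow> b \<in> Q n \<Longrightarrow> 2 powi m * (a - b) \<noteq> 1" for n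
  proof -
    have "inj_on (\<lambda>(e, q). e + p + 2 powi m * q) ({0, 1} \<times> Q n)"
    proof (rule inj_onI, clarify)
      fix e q e' q' assume *: "e \<in> {0, 1}" "e' \<in> {0, 1}" "q \<in> Q n" "q' \<in> Q n"
        "e + p + 2 powi m * q = e' + p + 2 powi m * q'"
      then have "e - e' = 2 powi m * (q' - q)" "e' - e = 2 powi m * (q - q')" by (simp_all add: algebra_simps)
      with no[OF *(3,4)] no[OF *(4,3)] *(1,2) have "e = e'" by auto
      with * show "e = e' \<and> q = q'" by simp
    qed
    then show ?thesis unfolding QS by (simp add: card_image card_cartesian_product)
  qed
  have "card (Q n) = 2 ^ n" for n
  proof (cases "0 < m")
    case True
    \<comment> \<open>Half of \<open>2 powi m\<close>: an even number times an integer is never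
      one.\<close>
    define c :: int where "c = 2 ^ (nat m - 1)"
    have "nat m = Suc (nat m - 1)" using True by simp
    then have "(2 :: int) ^ nat m = 2 * c" by (metis c_def power_Suc)
    then have "of_int (2 ^ nat m) = (of_int (2 * c) :: rat)" by (rule arg_cong)
    then have c: "2 powi m = (of_int (2 * c) :: rat)" using True by (simp add: power_int_def)
    have diff: "\<exists>z. a - b = of_int z" if "a \<in> Q n" "b \<in> Q n" for a b n
      using that
    proof (induction n arbitrary: a b)
      case (Suc n)
      then obtain e q e' q' where *: "e \<in> {0, 1}" "e' \<in> {0, 1}" "q \<in> Q n" "q' \<in> Q n"
        "a = e + p + 2 powi m * q" "b = e' + p + 2 powi m * q'" by (auto simp: QS)
      obtain z where z: "q - q' = of_int z" using Suc.IH * by blast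
      have "a - b = (e - e') + 2 powi m * (q - q')" using * by (simp add: algebra_simps)
      also have "\<dots> = of_int ((if e = 1 then 1 else 0) - (if e' = 1 then 1 else 0) + 2 * c * z)"
        using *(1,2) z c by auto
      finally show ?case by blast
    qed (auto simp: Q0 intro: exI[of _ 0])
    have "2 powi m * (a - b) \<noteq> 1" if ab: "a \<in> Q n" "b \<in> Q n" for a b n
    proof
      assume one: "2 powi m * (a - b) = 1"
      obtain z where "a - b = of_int z" using diff[OF ab] by blast
      then have "of_int (2 * c * z) = (1 :: rat)" using one c by simp
      then have "2 * c * z = 1" by (simp only: of_int_eq_1_iff)
      then show False by (metis dvd_triv_left mult.assoc odd_one)
    qed
    then show ?thesis by (induction n) (auto simp: Q0 step)
  next
    case False
    then have "m \<le> - 1" using assms by simp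
    then have "2 powi m \<le> (2 powi (- 1) :: rat)" by (intro power_int_increasing) auto
    then have c: "0 < (2 powi m :: rat)" "2 powi m \<le> (1 / 2 :: rat)" by auto
    have small: "2 powi m * \<bar>a - b\<bar> < 1" if "\<bar>a - b\<bar> < 2" for a b :: rat
    proof -
      have "2 powi m * \<bar>a - b\<bar> \<le> 1 / 2 * \<bar>a - b\<bar>" using c by (intro mult_right_mono) auto
      also have "1 / 2 * \<bar>a - b\<bar> < 1" using that by simp
      finally show ?thesis .
    qed
    \<comment> \<open>With \<open>2 powi m \<le> 1 / 2\<close> the bound \<open>2\<close> reproduces
      itself: the digits differ by at most \<open>1\<close> and the scaled rest by less than
      \<open>1\<close>.\<close>
    have diff: "\<bar>a - b\<bar> < 2" if "a \<in> Q n" "b \<in> Q n" for a b n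
      using that
    proof (induction n arbitrary: a b)
      case (Suc n)
      then obtain e q e' q' where *: "e \<in> {0, 1}" "e' \<in> {0, 1}" "q \<in> Q n" "q' \<in> Q n"
        "a = e + p + 2 powi m * q" "b = e' + p + 2 powi m * q'" by (auto simp: QS)
      have "a - b = (e - e') + 2 powi m * (q - q')" using * by (simp add: algebra_simps)
      moreover have "\<bar>2 powi m * (q - q')\<bar> < 1" using small[OF Suc.IH[OF *(3,4)]] c(1) by (simp add: abs_mult)
      moreover have "\<bar>e - e'\<bar> \<le> 1" using *(1,2) by auto
      ultimately show ?case by linarith
    qed (auto simp: Q0)
    have "2 powi m * (a - b) \<noteq> 1" if "a \<in> Q n" "b \<in> Q n" for a b n
    proof
      assume one: "2 powi m * (a - b) = 1"
      then have "\<bar>2 powi m * (a - b)\<bar> = 1" by simp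
      then show False using small[OF diff[OF that]] c(1) by (simp add: abs_mult)
    qed
    then show ?thesis by (induction n) (auto simp: Q0 step)
  qed
  moreover have "inj (Scaling (int n * m))" by (auto simp: inj_def)
  ultimately show ?thesis unfolding BQ by (simp add: card_image inj_on_subset)
qed

lemma finite_int_bound: "finite S \<Longrightarrow> \<exists>C\<ge>0. \<forall>x\<in>S. \<bar>f x\<bar> \<le> (C::int)"
proof (induction S rule: finite_induct)
  case (insert x S)
  then obtain C where "C \<ge> 0" "\<forall>x\<in>S. \<bar>f x\<bar> \<le> C" by blast
  then show ?case by (intro exI[of _ "max C \<bar>f x\<bar>"]) (auto simp: max.coboundedI1)
qed auto

lemma common_denominator_rat:
  assumes "finite (T :: rat set)"
  shows "\<exists>d>0. \<forall>q\<in>T. \<exists>y. q = of_int y / of_int d"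
  using assms
proof (induction T rule: finite_induct)
  case empty
  show ?case by (intro exI[of _ 1]) auto
next
  case (insert q T)
  then obtain d where d: "d > 0" "\<forall>q\<in>T. \<exists>y. q = of_int y / of_int d" by blast
  obtain a b where ab: "q = of_int a / of_int b" "b > 0"
    by (metis quotient_of_denom_pos quotient_of_div surj_pair)
  have "\<exists>y. x = of_int y / of_int (d * b)" if xT: "x \<in> insert q T" for x
  proof (cases "x = q")
    case True
    then have "x = of_int (a * d) / of_int (d * b)" using ab d by simp
    then show ?thesis by blast
  next
    case False
    then obtain y where "x = of_int y / of_int d" using d xT by auto
    then have "x = of_int (y * b) / of_int (d * b)" using ab by simp
    then show ?thesis by blast
  qed
  then show ?case using d(1) ab(2) by (intro exI[of _ "d * b"]) auto
qed

text \<open>The boxes are adapted to left multiplication: \<open>g\<close> moves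
  \<open>f (j, x)\<close> to \<open>f (l, num q + x)\<close> with \<open>l = expo g + j\<close> and
  \<open>q = 2 powi (- l) * transl g\<close>. Hence \<open>N\<close> is chosen first, then a common
  denominator \<open>d\<close> of the finitely many \<open>q\<close> and a bound \<open>C\<close> on
  the shifts, and \<open>B\<close> last.\<close>

lemma scaling_Folner:
  fixes A :: "scaling set"
  assumes "finite A" "0 < \<epsilon>"
  shows "\<exists>F. finite F \<and> F \<noteq> {} \<and> real (card ((\<lambda>(x, y). x + y) ` (A \<times> F))) < (1 + \<epsilon>) * real (card F)"
proof -
  \<comment> \<open>Each side of the box contributes a factor \<open>1 + \<eta>\<close>, and
    \<open>(1 + \<eta>)^2 \<le> 1 + 3 * \<eta> < 1 + \<epsilon>\<close>.\<close>
  define \<eta> where "\<eta> = min 1 (\<epsilon> / 4)"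
  have \<eta>: "0 < \<eta>" "\<eta> \<le> 1" "4 * \<eta> \<le> \<epsilon>" using assms(2) by (auto simp: \<eta>_def min_def)
  have large: "\<exists>N::nat. 0 < N \<and> real N + 2 * real_of_int C \<le> (1 + \<eta>) * real N" if "C \<ge> 0" for C
  proof -
    obtain N :: nat where N: "2 * real_of_int C / \<eta> < real N" using reals_Archimedean2 by blast
    moreover have "0 \<le> 2 * real_of_int C / \<eta>" using that \<eta> by simp
    ultimately have "0 < N" using of_nat_0_less_iff[of N, where ?'a = real] by linarith
    then show ?thesis using N \<eta>(1) by (intro exI[of _ N]) (auto simp: field_simps)
  qed
  obtain m where m: "m \<ge> 0" "\<forall>g\<in>A. \<bar>expo g\<bar> \<le> m" using finite_int_bound[OF assms(1), of expo] by blast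
  obtain N where N: "0 < N" "real N + 2 * real_of_int m \<le> (1 + \<eta>) * real N" using large[OF m(1)] by blast
  \<comment> \<open>All shifts that can occur, with \<open>l\<close> ranging over the exponents
    reachable from \<open>0\<close>, ..., \<open>N - 1\<close> by elements of
    \<open>A\<close>.\<close>
  define T where "T = (\<lambda>(l, g). 2 powi (- l) * transl g) ` ({- m..<int N + m} \<times> A)"
  have "finite T" using assms(1) by (simp add: T_def)
  then obtain d where d: "d > 0" "\<forall>q\<in>T. \<exists>y. q = of_int y / of_int d" using common_denominator_rat by blast
  from bchoice[OF d(2)] obtain num where num: "\<And>q. q \<in> T \<Longrightarrow> q = of_int (num q) / of_int d" by blast
  obtain C where C: "C \<ge> 0" "\<forall>q\<in>T. \<bar>num q\<bar> \<le> C" using finite_int_bound[OF \<open>finite T\<close>, of num] by blast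
  obtain B where B: "0 < B" "real B + 2 * real_of_int C \<le> (1 + \<eta>) * real B" using large[OF C(1)] by blast
  define f where "f = (\<lambda>(l, x). Scaling l (2 powi l * (of_int x / of_int d)))"
  have inj: "inj f" using d(1) by (auto simp: inj_def f_def)
  define F where "F = f ` ({0..<int N} \<times> {0..<int B})"
  define P where "P = {- m..<int N + m} \<times> {- C..<int B + C}"
  have cardF: "card F = N * B" unfolding F_def using inj by (simp add: card_image inj_on_subset card_cartesian_product)
  have cardP: "real (card P) = (real N + 2 * real_of_int m) * (real B + 2 * real_of_int C)"
    using m(1) C(1) by (simp add: P_def card_cartesian_product add.commute)
  have "(\<lambda>(x, y). x + y) ` (A \<times> F) \<subseteq> f ` P"
  proof
    fix z assume "z \<in> (\<lambda>(x, y). x + y) ` (A \<times> F)"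
    then obtain g j x where *: "g \<in> A" "0 \<le> j" "j < int N" "0 \<le> x" "x < int B" "z = g + f (j, x)" by (auto simp: F_def)
    define l where "l = expo g + j"
    have l: "l \<in> {- m..<int N + m}" using m(2) *(1-3) by (force simp: l_def)
    define q where "q = 2 powi (- l) * transl g"
    have q: "q \<in> T" unfolding T_def q_def using l *(1) by force
    have "2 powi l * q = transl g" by (simp add: q_def power_int_minus)
    then have "z = Scaling l (2 powi l * (q + of_int x / of_int d))"
      unfolding *(6) by (simp add: f_def plus_scaling_def l_def power_int_add distrib_left mult.assoc)
    also have "q + of_int x / of_int d = of_int (num q + x) / of_int d"
      using num[OF q] by (simp add: add_divide_distrib)
    finally have "z = f (l, num q + x)" by (simp add: f_def)
    moreover have "(l, num q + x) \<in> P" using l C(2) q *(4,5) by (force simp: P_def)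
    ultimately show "z \<in> f ` P" by blast
  qed
  moreover have finP: "finite P" by (simp add: P_def)
  ultimately have "card ((\<lambda>(x, y). x + y) ` (A \<times> F)) \<le> card (f ` P)" by (intro card_mono) auto
  also have "\<dots> \<le> card P" by (rule card_image_le[OF finP])
  finally have "card ((\<lambda>(x, y). x + y) ` (A \<times> F)) \<le> card P" .
  then have "real (card ((\<lambda>(x, y). x + y) ` (A \<times> F))) \<le> (real N + 2 * real_of_int m) * (real B + 2 * real_of_int C)"
    using cardP by linarith
  also have "\<dots> \<le> ((1 + \<eta>) * real N) * ((1 + \<eta>) * real B)"
    using N(2) B(2) m(1) C(1) \<eta>(1) by (intro mult_mono) auto
  also have "\<dots> = (1 + \<eta>)\<^sup>2 * real (card F)" by (simp add: cardF power2_eq_square)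
  also have "\<dots> < (1 + \<epsilon>) * real (card F)"
  proof (rule mult_strict_right_mono)
    have "\<eta> * \<eta> \<le> 1 * \<eta>" using \<eta> by (intro mult_right_mono) auto
    moreover have "(1 + \<eta>)\<^sup>2 = 1 + 2 * \<eta> + \<eta> * \<eta>" by (simp add: power2_eq_square algebra_simps)
    ultimately show "(1 + \<eta>)\<^sup>2 < 1 + \<epsilon>" using \<eta> by linarith
    show "0 < real (card F)" using N(1) B(1) by (simp add: cardF)
  qed
  finally have "real (card ((\<lambda>(x, y). x + y) ` (A \<times> F))) < (1 + \<epsilon>) * real (card F)" .
  moreover have "finite F" "F \<noteq> {}" using N(1) B(1) by (auto simp: F_def)
  ultimately show ?thesis by blast
qed

section \<open>A finitely generated amenable example\<close>

text \<open>The Folner condition with \<open>\<epsilon> = 1\<close> is the bound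
  \<open>2 * card F\<close> required by \<open>right_Ore_GA\<close>.\<close>

lemma (in field) right_Ore_domain_scaling: "right_Ore_domain (GA :: (scaling \<Rightarrow> 'a) ring)"
proof (intro right_Ore_domain.intro right_Ore_domain_axioms.intro ring_GA)
  show "\<one>\<^bsub>GA\<^esub> \<noteq> (\<zero>\<^bsub>GA\<^esub> :: scaling \<Rightarrow> 'a)" by (auto simp: GA_simps point_def fun_eq_iff)
  fix a b :: "scaling \<Rightarrow> 'a" assume ab: "a \<in> carrier GA" "b \<in> carrier GA"
  show "a \<otimes>\<^bsub>GA\<^esub> b = \<zero>\<^bsub>GA\<^esub> \<Longrightarrow> a = \<zero>\<^bsub>GA\<^esub> \<or> b = \<zero>\<^bsub>GA\<^esub>" using lead_mult(1) ab by blast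
  assume nz: "a \<noteq> \<zero>\<^bsub>GA\<^esub>" "b \<noteq> \<zero>\<^bsub>GA\<^esub>"
  have "\<exists>F. finite F \<and> F \<noteq> {} \<and> card ((\<lambda>(x, y). x + y) ` (A \<times> F)) < 2 * card F" if fin: "finite A" for A :: "scaling set"
  proof -
    obtain F where F: "finite F" "F \<noteq> {}" "real (card ((\<lambda>(x, y). x + y) ` (A \<times> F))) < (1 + 1) * real (card F)"
      using scaling_Folner[OF fin, of 1] by auto
    then have "real (card ((\<lambda>(x, y). x + y) ` (A \<times> F))) < real (2 * card F)" by simp
    then show ?thesis using F(1,2) by (simp only: of_nat_less_iff) blast
  qed
  then show "\<exists>u\<in>carrier GA. \<exists>v\<in>carrier GA. u \<noteq> \<zero>\<^bsub>GA\<^esub> \<and> v \<noteq> \<zero>\<^bsub>GA\<^esub> \<and> a \<otimes>\<^bsub>GA\<^esub> u = b \<otimes>\<^bsub>GA\<^esub> v"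
    by (rule right_Ore_GA[OF _ ab(1) nz(1) ab(2) nz(2)])
qed

section \<open>Intersections and towers of sub-skew-fields\<close>

context skew_field
begin

lemma sub_skew_field_inv:
  assumes "sub_skew_field L R" "a \<in> L" "a \<noteq> \<zero>"
  shows "inv a \<in> L"
proof -
  have sub: "subring L R" and "Units (R\<lparr>carrier := L\<rparr>) = L - {\<zero>}"
    using assms(1) by (auto simp: sub_skew_field_def skew_field_def skew_field_axioms_def)
  then have "a \<in> Units (R\<lparr>carrier := L\<rparr>)" using assms by auto
  then obtain b where b: "b \<in> L" "b \<otimes> a = \<one>" "a \<otimes> b = \<one>" by (auto simp: Units_def)
  have "inv a = b" using subringE(1)[OF sub] assms(2) b by (intro inv_unique'[symmetric]) auto
  then show ?thesis using b by simp
qed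

lemma sub_skew_field_Inter:
  assumes "\<And>L. L \<in> S \<Longrightarrow> sub_skew_field L R" "S \<noteq> {}"
  shows "sub_skew_field (\<Inter>S) R"
proof (rule sub_skew_fieldI)
  show "subring (\<Inter>S) R" using assms by (intro subring_Inter) (auto simp: sub_skew_field_def)
qed (use assms sub_skew_field_inv in blast)

lemma sub_skew_field_trans:
  assumes "sub_skew_field L R" "sub_skew_field M (R\<lparr>carrier := L\<rparr>)"
  shows "sub_skew_field M R"
proof -
  have L: "subring L R" and M: "subring M (R\<lparr>carrier := L\<rparr>)" "skew_field (R\<lparr>carrier := M\<rparr>)"
    using assms by (auto simp: sub_skew_field_def)
  interpret L: ring "R\<lparr>carrier := L\<rparr>" by (rule subring_is_ring[OF L])
  have Lc: "L \<subseteq> carrier R" using subringE(1)[OF L] .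
  have MsubL: "M \<subseteq> L" using subringE(1)[OF M(1)] by simp
  have "subring M R"
  proof (rule subringI)
    show "M \<subseteq> carrier R" using MsubL Lc by blast
    show "\<one> \<in> M" using subringE(3)[OF M(1)] by simp
    show "h1 \<otimes> h2 \<in> M" "h1 \<oplus> h2 \<in> M" if "h1 \<in> M" "h2 \<in> M" for h1 h2
      using subringE(6,7)[OF M(1) that] by auto
    show "\<ominus> a \<in> M" if a: "a \<in> M" for a
    proof -
      have b: "\<ominus>\<^bsub>R\<lparr>carrier := L\<rparr>\<^esub> a \<in> M" by (rule subringE(5)[OF M(1) a])
      have "\<ominus>\<^bsub>R\<lparr>carrier := L\<rparr>\<^esub> a \<oplus> a = \<zero>" using L.l_neg[of a] a MsubL by auto
      then have "\<ominus> a = \<ominus>\<^bsub>R\<lparr>carrier := L\<rparr>\<^esub> a" using a b MsubL Lc by (intro minus_equality) auto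
      then show ?thesis using b by simp
    qed
  qed
  then show ?thesis using M(2) by (simp add: sub_skew_field_def)
qed

end

lemma finitely_generated_amenable_infinite_GK:
  fixes k :: "('k, 'm) ring_scheme"
  assumes "field k"
  shows "\<exists>(D :: 'k list ring) \<iota>. skew_field_extension k \<iota> D \<and> amenable k \<iota> D \<and>
    finitely_generated_skew_field k \<iota> D \<and> GK_tr_deg k \<iota> D = \<infinity>"
proof -
  obtain E :: "'k list ring" and h where "group_algebra_fractions k E (h :: (scaling \<Rightarrow> 'k) \<Rightarrow> 'k list)"
    using field.group_algebra_fractions_exists[OF assms field.right_Ore_domain_scaling[OF assms]] by blast
  then interpret group_algebra_fractions k E h .
  let ?K = "\<iota> ` carrier k"
  define x where "x = h (point (Scaling 0 1) \<one>\<^bsub>k\<^esub>)"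
  define t where "t = h (point (Scaling 1 0) \<one>\<^bsub>k\<^esub>)"
  have valx: "val x (Scaling 0 1)" unfolding x_def by (rule val_h_point) auto
  have valt: "val t (Scaling 1 0)" unfolding t_def by (rule val_h_point) auto
  from valx valt have xt: "x \<in> carrier E" "t \<in> carrier E" by (auto simp: val_def)
  \<comment> \<open>Its intersection is the least sub-skew-field over \<open>k\<close> containing
    \<open>x\<close> and \<open>t\<close>. By \<open>sub_skew_field_trans\<close>, a sub-skew-field
    of it that contains \<open>k\<close>, \<open>x\<close> and \<open>t\<close> belongs to
    \<open>\<L>\<close> again, so it is not proper.\<close>
  define \<L> where "\<L> = {L. sub_skew_field L E \<and> ?K \<subseteq> L \<and> {x, t} \<subseteq> L}"
  define L where "L = \<Inter>\<L>"
  have "carrier E \<in> \<L>"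
  proof -
    have "sub_skew_field (carrier E) E"
      using E.nonzero_inverse by (intro E.sub_skew_fieldI E.carrier_is_subring) auto
    moreover have "?K \<subseteq> carrier E"
      using skew_field_extension.central_algebra_image[OF skew_field_extension_fractions]
      by (rule central_algebra.K_subset)
    ultimately show ?thesis using xt by (simp add: \<L>_def)
  qed
  then have L: "sub_skew_field L E" unfolding L_def by (intro E.sub_skew_field_Inter) (auto simp: \<L>_def)
  have KL: "?K \<subseteq> L" "x \<in> L" "t \<in> L" unfolding L_def \<L>_def by auto
  have ext: "skew_field_extension k \<iota> (E\<lparr>carrier := L\<rparr>)"
    by (rule skew_field_extension_sub_skew_field[OF skew_field_extension_fractions L KL(1)])
  have "amenable k \<iota> (E\<lparr>carrier := L\<rparr>)"
    by (rule amenable_sub_skew_field[OF skew_field_extension_fractions L KL(1) amenable_fractions[OF scaling_Folner]])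
  moreover have "finitely_generated_skew_field k \<iota> (E\<lparr>carrier := L\<rparr>)"
    unfolding finitely_generated_skew_field_def
  proof (intro exI[of _ "{x, t}"] conjI allI impI)
    fix M assume M: "sub_skew_field M (E\<lparr>carrier := L\<rparr>) \<and> ?K \<subseteq> M \<and> {x, t} \<subseteq> M"
    then have "M \<in> \<L>" using E.sub_skew_field_trans[OF L] by (simp add: \<L>_def)
    then have "L \<subseteq> M" by (auto simp: L_def)
    moreover have "M \<subseteq> L" using M subringE(1)[of M "E\<lparr>carrier := L\<rparr>"] by (simp add: sub_skew_field_def)
    ultimately show "M = carrier (E\<lparr>carrier := L\<rparr>)" by simp
  qed (use KL in auto)
  moreover have "GK_tr_deg k \<iota> (E\<lparr>carrier := L\<rparr>) = \<infinity>"
  proof (rule GK_tr_deg_infinite[OF L KL(1,2) valx KL(3) valt])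
    fix g :: scaling
    obtain m p where g: "g = Scaling m p" by (cases g)
    \<comment> \<open>The exponent has to be nonzero for \<open>card_binary_products\<close>; if
      that of \<open>g\<close> is zero, adding the valuation of \<open>t\<close> makes it
      \<open>1\<close>.\<close>
    show "\<exists>\<sigma>\<in>{0, Scaling 1 0}. \<forall>n. card (binary_products (Scaling 0 1) (\<sigma> + g) n) = 2 ^ n"
    proof (cases "m = 0")
      case True
      then show ?thesis using card_binary_products[of 1] g by (auto simp: Scaling_add)
    next
      case False
      then show ?thesis using card_binary_products[of m] g by auto
    qed
  qed
  ultimately show ?thesis using ext by blast
qed

theorem theorem1:
  fixes k :: "'k ring"
  assumes "field k"
  shows
    "(\<forall>(D :: 'd ring) \<iota>. skew_field_extension k \<iota> D \<and>
        ring.finite_dimension D (ring_center D) (carrier D) \<longrightarrow> amenable k \<iota> D)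
   \<and> (\<forall>(D :: 'd ring) \<iota>. skew_field_extension k \<iota> D \<and> GK_tr_deg k \<iota> D < \<infinity> \<longrightarrow> amenable k \<iota> D)
   \<and> (\<exists>(D :: 'k list ring) \<iota>. skew_field_extension k \<iota> D \<and> amenable k \<iota> D \<and>
        finitely_generated_skew_field k \<iota> D \<and> GK_tr_deg k \<iota> D = \<infinity>)
   \<and> (\<forall>(E :: 'd ring) \<iota> D. skew_field_extension k \<iota> E \<and> sub_skew_field D E \<and>
        \<iota> ` carrier k \<subseteq> D \<and> \<not> amenable k \<iota> (E\<lparr>carrier := D\<rparr>) \<longrightarrow> \<not> amenable k \<iota> E)
   \<and> (\<forall>(F :: 'f ring) (\<phi> :: (bool list \<Rightarrow> complex) \<Rightarrow> 'f). cohn_free_field complex_field \<phi> F \<longrightarrow>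
        \<not> amenable complex_field (\<phi> \<circ> free_algebra_const complex_field) F)"
proof (intro conjI allI impI; (elim conjE)?)
  show "amenable k \<iota> D" if "skew_field_extension k \<iota> D" "ring.finite_dimension D (ring_center D) (carrier D)"
    for D :: "'d ring" and \<iota>
    by (rule amenable_finite_dimension_center[OF that])
  show "amenable k \<iota> D" if "skew_field_extension k \<iota> D" "GK_tr_deg k \<iota> D < \<infinity>"
    for D :: "'d ring" and \<iota>
    by (rule amenable_finite_GK_tr_deg[OF that])
  show "\<exists>(D :: 'k list ring) \<iota>. skew_field_extension k \<iota> D \<and> amenable k \<iota> D \<and>
      finitely_generated_skew_field k \<iota> D \<and> GK_tr_deg k \<iota> D = \<infinity>"
    by (rule finitely_generated_amenable_infinite_GK[OF assms])
  show "\<not> amenable k \<iota> E" if "skew_field_extension k \<iota> E" "sub_skew_field D E" "\<iota> ` carrier k \<subseteq> D"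
    "\<not> amenable k \<iota> (E\<lparr>carrier := D\<rparr>)" for E :: "'d ring" and \<iota> D
    using amenable_sub_skew_field[OF that(1-3)] that(4) by blast
  show "\<not> amenable complex_field (\<phi> \<circ> free_algebra_const complex_field) F" if "cohn_free_field complex_field \<phi> F"
    for F :: "'f ring" and \<phi> :: "(bool list \<Rightarrow> complex) \<Rightarrow> 'f"
    by (rule cohn_free_field_not_amenable[OF that])
qed

end
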